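(* Let $n\ge1$ and let $A:[\Omega_*(J^\infty E)^{\otimes n}]_0\to\Omega_0(J^\infty E)$ be a local differential operator, i.e. (under the identifications in the context) $A\in\mathrm{LDO}(n)$. Then $A$ can be lifted to a sequence $f_s:[\Omega_*(J^\infty E)^{\otimes n}]_s\to\Omega_s(J^\infty E)$ of maps with matrix coefficients in $\mathrm{LDO}(n)$ which is a chain map ($d_Hf_s=f_{s-1}d_H^{\otimes n}$ for all $s\ge 1$) and has $f_0=A$, if and only if $$\chi\Big(A\circ\frac d{dx^i_j}\Big)=0\quad\text{for each }1\le i\le N,\ 1\le j\le n.$$ In the case $\chi(A)=0$, the lift can be chosen in such a way that $f_s=0$ for $s\ge2$.
   Context: Jets. Let $N\ge1$ and let $E=\mathbf R^N\times\mathbf R\to\mathbf R^N$ be the trivial line bundle, with base coordinates $\mathbf x=(x^1,\dots,x^N)$ and fibre coordinate $u$. The infinite jet bundle $J^\infty E$ has coordinates $(x^i,u_J)$, where $J=(j_1,\dots,j_N)$ runs over multi-indices of non-negative integers, $|J|=j_1+\dots+j_N$. $\mathrm{Loc}(E)$ is the real vector space of local functions: smooth functions of $\mathbf x$ and finitely many of the $u_J$ (pullbacks of smooth functions on some finite jet bundle $J^kE$). The total derivative is $\frac{d}{dx^i}=\frac{\partial}{\partial x^i}+\sum_J u_{iJ}\frac{\partial}{\partial u_J}$, where $iJ$ is $J$ with $j_i$ raised by one; $(\frac d{d\mathbf x})^I=\prod_i(\frac d{dx^i})^{i_i}$ for a multi-index $I=(i_1,\dots,i_N)$ and $(-1)^I=(-1)^{i_1+\dots+i_N}$.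 For a finitely supported function $\alpha$ from multi-indices to non-negative integers, $(\frac{\partial}{\partial\mathbf u})^\alpha=\prod_J\frac{\partial^{\alpha(J)}}{\partial u_J^{\alpha(J)}}$, and $\deg_f(\alpha)$ is the maximal $|J|$ with $\alpha(J)\ne0$ (and $0$ if $\alpha=0$). Operators. $\mathrm{LDO}(n)$ ($n$-multilinear local differential operators) is the space of $n$-linear maps $A:\mathrm{Loc}(E)^{\otimes n}\to\mathrm{Loc}(E)$ of the form $A(f_1,\dots,f_n)=\sum p_{I_1,\dots,I_n,\alpha_1,\dots,\alpha_n}\prod_{j=1}^n\big((\frac d{d\mathbf x})^{I_j}(\frac\partial{\partial\mathbf u})^{\alpha_j}f_j\big)$ with $p_{I_1,\dots,I_n,\alpha_1,\dots,\alpha_n}\in\mathrm{Loc}(E)$, such that for each $m$ only finitely many $p_{I_1,\dots,I_n,\alpha_1,\dots,\alpha_n}$ with $\sum_j\deg_f(\alpha_j)\le m$ are nonzero. Write $\frac d{dx^i_j}$ and $(\frac\partial{\partial\mathbf u_j})^{\alpha}$ for the total derivative $\frac d{dx^i}$ and vertical derivative acting on the $j$-th function; $(A\circ\frac d{dx^i_j})(f_1,\dots,f_n)=A(f_1,\dots,\frac{d}{dx^i}f_j,\dots,f_n)$. Characteristic. Put $\frac d{dy^i_1}=\sum_{j=1}^n\frac d{dx^i_j}$ and $\frac d{dy^i_j}=\frac d{dx^i_j}$ for $2\le j\le n$. Every $A\in\mathrm{LDO}(n)$ can be written in polarized form $A=\sum q_{I_1,\dots,I_n;\alpha_1,\dots,\alpha_n}(\frac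 d{d\mathbf y_1})^{I_1}\cdots(\frac d{d\mathbf y_n})^{I_n}(\frac\partial{\partial\mathbf u_1})^{\alpha_1}\cdots(\frac\partial{\partial\mathbf u_n})^{\alpha_n}$, and its characteristic is $\chi(A)=\sum(-1)^{I_1}\big((\frac d{d\mathbf x})^{I_1}q_{I_1,\dots,I_n;\alpha_1,\dots,\alpha_n}\big)(\frac d{d\mathbf y_2})^{I_2}\cdots(\frac d{d\mathbf y_n})^{I_n}(\frac\partial{\partial\mathbf u_1})^{\alpha_1}\cdots(\frac\partial{\partial\mathbf u_n})^{\alpha_n}\in\mathrm{LDO}(n)$. Complexes. $\Omega^{k,0}(J^\infty E)$ is the free $\mathrm{Loc}(E)$-module with basis $(d\mathbf x)^\epsilon=(dx^1)^{\epsilon^1}\wedge\cdots\wedge(dx^N)^{\epsilon^N}$, $\epsilon\in\{0,1\}^N$, $\sum\epsilon^i=k$; $d_H\omega=\sum_i dx^i\wedge\frac{d}{dx^i}\omega$ ($\frac{d}{dx^i}$ acting on coefficients). Regrade: $\Omega_i(J^\infty E)=\Omega^{N-i,0}(J^\infty E)$ for $0\le i\le N$ (zero otherwise), a chain complex with $\deg d_H=-1$. Tensor powers are over $\mathbf R$, $[\;]_s$ denotes the degree $s$ part, and $d_H^{\otimes n}$ is the standard differential on the tensor power. A map $f_s:[\Omega_*(J^\infty E)^{\otimes n}]_s\to\Omega_{s}(J^\infty E)$ has matrix coefficients in $\mathrm{LDO}(n)$ if $f_s\big(h_1(d\mathbf x)^{\epsilon_1}\otimes\cdots\otimes h_n(d\mathbf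 x)^{\epsilon_n}\big)=\sum_\epsilon A^{\epsilon_1,\dots,\epsilon_n}_{s,\epsilon}(h_1,\dots,h_n)(d\mathbf x)^\epsilon$ with all $A^{\epsilon_1,\dots,\epsilon_n}_{s,\epsilon}\in\mathrm{LDO}(n)$. Via $h\,dx^1\wedge\cdots\wedge dx^N\leftrightarrow h$ one identifies $\Omega_0(J^\infty E)\cong\mathrm{Loc}(E)$ and $[\Omega_*(J^\infty E)^{\otimes n}]_0\cong\mathrm{Loc}(E)^{\otimes n}$. *)

theory Defs
  imports "HOL-Analysis.Analysis" "HOL-Library.Poly_Mapping"
begin

text \<open>
  The base dimension $N$ is the cardinality of the index type \<open>'d\<close>, the arity $n$ that of the
  index type \<open>'n\<close>; both are of class \<open>{finite, linorder}\<close>.  The order on \<open>'d\<close> fixes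
  the order of the factors of a wedge product, the order on \<open>'n\<close> that of the factors of a
  tensor product; the distinguished index $1$ of the polarized coordinates is \<open>Min UNIV\<close>.
\<close>

section \<open>The infinite jet space and local functions\<close>

type_synonym 'd mindex = "'d \<Rightarrow> nat"

definition mabs :: "'d::finite mindex \<Rightarrow> nat" where
  "mabs J = (\<Sum>i\<in>UNIV. J i)"

text \<open>\<open>Base i\<close> is the coordinate $x^i$, \<open>Fibre J\<close> the coordinate $u_J$.\<close>

datatype 'd coord = Base 'd | Fibre "'d mindex"

type_synonym 'd jet = "'d coord \<Rightarrow> real"

fun coord_order :: "'d::finite coord \<Rightarrow> nat" where
  "coord_order (Base i) = 0"
| "coord_order (Fibre J) = mabs J"

definition depends_on :: "'d coord set \<Rightarrow> ('d jet \<Rightarrow> real) \<Rightarrow> bool" where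
  "depends_on S f \<longleftrightarrow> (\<forall>p q. (\<forall>c\<in>S. p c = q c) \<longrightarrow> f p = f q)"

definition partial :: "'d coord \<Rightarrow> ('d jet \<Rightarrow> real) \<Rightarrow> 'd jet \<Rightarrow> real" where
  "partial c f p = deriv (\<lambda>t. f (p(c := t))) (p c)"

text \<open>
  Continuity is with respect to the product topology on jets.  For a function depending on finitely
  many coordinates only, this is continuity in these coordinates, and \<open>Ck k f\<close> says that
  all iterated partial derivatives of order at most \<open>k\<close> exist and are continuous.
\<close>

fun Ck :: "nat \<Rightarrow> ('d jet \<Rightarrow> real) \<Rightarrow> bool" where
  "Ck 0 f \<longleftrightarrow> continuous_on UNIV f"
| "Ck (Suc k) f \<longleftrightarrow> continuous_on UNIV f
     \<and> (\<forall>c p. (\<lambda>t. f (p(c := t))) field_differentiable at (p c))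
     \<and> (\<forall>c. Ck k (partial c f))"

definition local_function :: "('d::finite jet \<Rightarrow> real) \<Rightarrow> bool" where
  "local_function f \<longleftrightarrow> (\<exists>m. depends_on {c. coord_order c \<le> m} f) \<and> (\<forall>k. Ck k f)"

lemma Ck_continuous: "Ck k f \<Longrightarrow> continuous_on UNIV f"
  by (cases k) auto

lemma Ck_Suc_imp: "Ck (Suc k) f \<Longrightarrow> Ck k f"
  by (induction k arbitrary: f) (auto dest: Ck_continuous)

lemma partial_const [simp]: "partial c (\<lambda>_. a) = (\<lambda>_. 0)"
  by (simp add: partial_def fun_eq_iff)

lemma Ck_const: "Ck k (\<lambda>_. a)"
  by (induction k arbitrary: a) auto

lemma partial_coord: "partial c (\<lambda>p. p c') = (\<lambda>_. if c = c' then 1 else 0)"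
  by (auto simp: partial_def fun_eq_iff)

lemma Ck_coord: "Ck k (\<lambda>p. p c)"
proof (cases k)
  case 0
  then show ?thesis by (auto intro: continuous_on_product_coordinates)
next
  case (Suc j)
  have "(\<lambda>t. (p(c' := t)) c) field_differentiable at a" for p :: "'a jet" and c' a
    by (cases "c = c'") (auto simp: field_differentiable_ident)
  then show ?thesis
    using Suc by (auto simp: partial_coord Ck_const intro: continuous_on_product_coordinates)
qed

lemma Ck_add: "Ck k f \<Longrightarrow> Ck k g \<Longrightarrow> Ck k (\<lambda>p. f p + g p)"
proof (induction k arbitrary: f g)
  case 0
  then show ?case by (auto intro: continuous_intros)
next
  case (Suc k)
  have "partial c (\<lambda>p. f p + g p) = (\<lambda>p. partial c f p + partial c g p)" for c
    using Suc.prems by (auto simp: partial_def fun_eq_iff intro!: deriv_add)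
  then show ?case
    using Suc by (auto intro!: continuous_intros field_differentiable_add)
qed

lemma Ck_mult: "Ck k f \<Longrightarrow> Ck k g \<Longrightarrow> Ck k (\<lambda>p. f p * g p)"
proof (induction k arbitrary: f g)
  case 0
  then show ?case by (auto intro: continuous_intros)
next
  case (Suc k)
  have eq: "partial c (\<lambda>p. f p * g p) = (\<lambda>p. f p * partial c g p + partial c f p * g p)" for c
    using Suc.prems by (auto simp: partial_def fun_eq_iff)
  have "Ck k (partial c (\<lambda>p. f p * g p))" for c
    unfolding eq using Suc.prems by (intro Ck_add Suc.IH Ck_Suc_imp[OF Suc.prems(1)]
        Ck_Suc_imp[OF Suc.prems(2)]) auto
  then show ?case
    using Suc.prems by (auto intro!: continuous_intros field_differentiable_mult)
qed

lemma depends_on_partial: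
  assumes "depends_on S f"
  shows "depends_on S (partial c f)"
  unfolding depends_on_def
proof (intro allI impI)
  fix p q :: "'a jet"
  assume pq: "\<forall>c\<in>S. p c = q c"
  show "partial c f p = partial c f q"
  proof (cases "c \<in> S")
    case True
    have "f (p(c := t)) = f (q(c := t))" for t
      using assms pq by (auto simp: depends_on_def)
    then show ?thesis using True pq by (simp add: partial_def)
  next
    case False
    have "f (p(c := t)) = f p" "f (q(c := t)) = f q" for t
      using assms False unfolding depends_on_def by (metis fun_upd_other)+
    then show ?thesis by (simp add: partial_def)
  qed
qed

lemma local_function_const: "local_function (\<lambda>_. a)"
  by (auto simp: local_function_def depends_on_def Ck_const)

lemma local_function_coord: "local_function (\<lambda>p. p c)"
  by (auto simp: local_function_def depends_on_def Ck_coord)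

lemma local_function_binop:
  assumes "local_function f" "local_function g"
    and "\<And>k. Ck k f \<Longrightarrow> Ck k g \<Longrightarrow> Ck k (\<lambda>p. h (f p) (g p))"
  shows "local_function (\<lambda>p. h (f p) (g p))"
proof -
  obtain m m' where m: "depends_on {c. coord_order c \<le> m} f" "depends_on {c. coord_order c \<le> m'} g"
    using assms unfolding local_function_def by blast
  have "depends_on {c. coord_order c \<le> max m m'} (\<lambda>p. h (f p) (g p))"
    unfolding depends_on_def
  proof (intro allI impI)
    fix p q :: "'a jet"
    assume pq: "\<forall>c\<in>{c. coord_order c \<le> max m m'}. p c = q c"
    have "f p = f q" using m(1) pq by (auto simp: depends_on_def)
    moreover have "g p = g q" using m(2) pq by (auto simp: depends_on_def)
    ultimately show "h (f p) (g p) = h (f q) (g q)" by simp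
  qed
  then show ?thesis using assms unfolding local_function_def by blast
qed

lemma local_function_add:
  "local_function f \<Longrightarrow> local_function g \<Longrightarrow> local_function (\<lambda>p. f p + g p)"
  by (rule local_function_binop) (auto intro: Ck_add)

lemma local_function_mult:
  "local_function f \<Longrightarrow> local_function g \<Longrightarrow> local_function (\<lambda>p. f p * g p)"
  by (rule local_function_binop) (auto intro: Ck_mult)

lemma local_function_partial: "local_function f \<Longrightarrow> local_function (partial c f)"
  unfolding local_function_def by (metis depends_on_partial Ck.simps(2))

typedef (overloaded) ('d::finite) loc = "{f :: 'd jet \<Rightarrow> real. local_function f}"
  morphisms loc_fun Loc
  using local_function_const by blast

setup_lifting type_definition_loc

instantiation loc :: (finite) "{comm_ring_1, real_algebra_1}"
begin

lift_definition zero_loc :: "'a loc" is "\<lambda>_. 0"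
  by (rule local_function_const)

lift_definition one_loc :: "'a loc" is "\<lambda>_. 1"
  by (rule local_function_const)

lift_definition plus_loc :: "'a loc \<Rightarrow> 'a loc \<Rightarrow> 'a loc" is "\<lambda>f g p. f p + g p"
  by (rule local_function_add)

lift_definition uminus_loc :: "'a loc \<Rightarrow> 'a loc" is "\<lambda>f p. - f p"
  using local_function_mult[OF local_function_const[of "-1"]] by simp

lift_definition minus_loc :: "'a loc \<Rightarrow> 'a loc \<Rightarrow> 'a loc" is "\<lambda>f g p. f p - g p"
proof -
  fix f g :: "'a jet \<Rightarrow> real"
  assume "local_function f" "local_function g"
  then show "local_function (\<lambda>p. f p - g p)"
    using local_function_add[OF _ local_function_mult[OF local_function_const[of "-1"]], of f g]
    by simp
qed

lift_definition times_loc :: "'a loc \<Rightarrow> 'a loc \<Rightarrow> 'a loc" is "\<lambda>f g p. f p * g p"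
  by (rule local_function_mult)

lift_definition scaleR_loc :: "real \<Rightarrow> 'a loc \<Rightarrow> 'a loc" is "\<lambda>a f p. a * f p"
  by (rule local_function_mult[OF local_function_const])

instance
  by standard (transfer; simp add: fun_eq_iff algebra_simps)+

end

lift_definition coordinate :: "'d::finite coord \<Rightarrow> 'd loc" is "\<lambda>c p. p c"
  by (rule local_function_coord)

lift_definition pd :: "'d::finite coord \<Rightarrow> 'd loc \<Rightarrow> 'd loc" is partial
  by (rule local_function_partial)

text \<open>
  \<open>Sum_any\<close> sums over the indices with nonzero summand; here these are finitely many,
  since a local function depends on finitely many of the $u_J$.
\<close>

definition total_deriv :: "'d::finite \<Rightarrow> 'd loc \<Rightarrow> 'd loc" where
  "total_deriv i f = pd (Base i) f
     + Sum_any (\<lambda>J. coordinate (Fibre (J(i := Suc (J i)))) * pd (Fibre J) f)"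

text \<open>
  The product $\prod_c D_c^{I(c)}$ applied to \<open>x\<close>, for commuting operators $D_c$ and \<open>I\<close> of
  finite support.
\<close>

definition power_op :: "('c \<Rightarrow> 'x \<Rightarrow> 'x) \<Rightarrow> ('c \<Rightarrow> nat) \<Rightarrow> 'x \<Rightarrow> 'x" where
  "power_op D I x = Finite_Set.fold (\<lambda>c. D c ^^ I c) x {c. I c \<noteq> 0}"

type_synonym 'd vindex = "'d mindex \<Rightarrow>\<^sub>0 nat"

definition deg_f :: "'d::finite vindex \<Rightarrow> nat" where
  "deg_f \<alpha> = Max (insert 0 (mabs ` Poly_Mapping.keys \<alpha>))"

definition dx_power :: "'d::finite mindex \<Rightarrow> 'd loc \<Rightarrow> 'd loc" where
  "dx_power I = power_op total_deriv I"

definition du_power :: "'d::finite vindex \<Rightarrow> 'd loc \<Rightarrow> 'd loc" where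
  "du_power \<alpha> = power_op (\<lambda>J. pd (Fibre J)) (Poly_Mapping.lookup \<alpha>)"


section \<open>Multilinear local differential operators\<close>

type_synonym ('n, 'd) multiop = "('n \<Rightarrow> 'd loc) \<Rightarrow> 'd loc"

type_synonym ('n, 'd) coeffs = "('n \<Rightarrow> 'd mindex) \<Rightarrow> ('n \<Rightarrow> 'd vindex) \<Rightarrow> 'd loc"

definition admissible :: "('n::finite, 'd::finite) coeffs \<Rightarrow> bool" where
  "admissible p \<longleftrightarrow>
     (\<forall>m. finite {(I, \<alpha>). p I \<alpha> \<noteq> 0 \<and> (\<Sum>j\<in>UNIV. deg_f (\<alpha> j)) \<le> m})"

text \<open>
  For admissible \<open>p\<close> only finitely many summands are nonzero on given local functions,
  because $(\partial/\partial\mathbf u)^\alpha$ kills functions of jet order below \<open>deg_f \<alpha>\<close>.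
\<close>

definition op_of_coeffs :: "('n::finite, 'd::finite) coeffs \<Rightarrow> ('n, 'd) multiop" where
  "op_of_coeffs p f =
     Sum_any (\<lambda>(I, \<alpha>). p I \<alpha> * (\<Prod>j\<in>UNIV. dx_power (I j) (du_power (\<alpha> j) (f j))))"

definition LDO :: "('n::finite, 'd::finite) multiop set" where
  "LDO = {op_of_coeffs p |p. admissible p}"

text \<open>\<open>A \<circ> slot_deriv j i\<close> is $A\circ\frac{d}{dx^i_j}$.\<close>

definition slot_deriv :: "'n \<Rightarrow> 'd::finite \<Rightarrow> ('n \<Rightarrow> 'd loc) \<Rightarrow> ('n \<Rightarrow> 'd loc)" where
  "slot_deriv j i f = f(j := total_deriv i (f j))"


section \<open>Polarized form and characteristic\<close>

text \<open>
  \<open>dy j i\<close> is $A \mapsto A\circ\frac{d}{dy^i_j}$; the summation over the slots for the first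
  index is performed on values, as operators are represented by functions of tuples.
\<close>

definition dy :: "'n::{finite,linorder} \<Rightarrow> 'd::finite \<Rightarrow> ('n, 'd) multiop \<Rightarrow> ('n, 'd) multiop" where
  "dy j i A = (if j = Min UNIV then (\<lambda>f. \<Sum>l\<in>UNIV. (A \<circ> slot_deriv l i) f) else A \<circ> slot_deriv j i)"

text \<open>The operator
  $(\frac{d}{d\mathbf y_1})^{I_1}\cdots(\frac{d}{d\mathbf y_n})^{I_n}
   (\frac{\partial}{\partial\mathbf u_1})^{\alpha_1}\cdots(\frac{\partial}{\partial\mathbf u_n})^{\alpha_n}$,
  followed by multiplication of the \<open>n\<close> factors.\<close>

definition polarized_monomial ::
    "('n::{finite,linorder} \<Rightarrow> 'd::finite mindex) \<Rightarrow> ('n \<Rightarrow> 'd vindex) \<Rightarrow> ('n, 'd) multiop" where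
  "polarized_monomial I \<alpha> f =
     power_op (\<lambda>(j, i). dy j i) (\<lambda>(j, i). I j i) (\<lambda>g. \<Prod>j\<in>UNIV. g j) (\<lambda>j. du_power (\<alpha> j) (f j))"

definition polarized_op :: "('n::{finite,linorder}, 'd::finite) coeffs \<Rightarrow> ('n, 'd) multiop" where
  "polarized_op q f = Sum_any (\<lambda>(I, \<alpha>). q I \<alpha> * polarized_monomial I \<alpha> f)"

text \<open>The polarized coefficients are uniquely determined by the operator.\<close>

definition polarized_coeffs :: "('n::{finite,linorder}, 'd::finite) multiop \<Rightarrow> ('n, 'd) coeffs" where
  "polarized_coeffs A = (SOME q. admissible q \<and> A = polarized_op q)"

definition characteristic :: "('n::{finite,linorder}, 'd::finite) multiop \<Rightarrow> ('n, 'd) multiop" where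
  "characteristic A f = Sum_any (\<lambda>(I, \<alpha>).
     (-1) ^ mabs (I (Min UNIV)) * dx_power (I (Min UNIV)) (polarized_coeffs A I \<alpha>)
       * polarized_monomial (I(Min UNIV := (\<lambda>_. 0))) \<alpha> f)"


section \<open>Horizontal forms and lifts\<close>

text \<open>
  A horizontal form is given by its coefficients; the basis element $(d\mathbf x)^\epsilon$ is indexed
  by the set of those $i$ with $\epsilon^i = 1$, and $h\,(d\mathbf x)^\epsilon$ is \<open>axis \<epsilon> h\<close>.
\<close>

type_synonym 'd form = "('d loc, 'd set) vec"

definition Omega :: "nat \<Rightarrow> 'd::finite form set" where
  "Omega s = {w. \<forall>\<epsilon>. w $ \<epsilon> \<noteq> 0 \<longrightarrow> card \<epsilon> + s = CARD('d)}"

definition wedge_dx :: "'d::{finite,linorder} \<Rightarrow> 'd form \<Rightarrow> 'd form" where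
  "wedge_dx i w =
     (\<chi> \<epsilon>. if i \<in> \<epsilon> then (-1) ^ card {k\<in>\<epsilon>. k < i} * w $ (\<epsilon> - {i}) else 0)"

definition d_H :: "'d::{finite,linorder} form \<Rightarrow> 'd form" where
  "d_H w = (\<Sum>i\<in>UNIV. wedge_dx i (\<chi> \<epsilon>. total_deriv i (w $ \<epsilon>)))"

text \<open>
  Linear maps on the tensor power $\Omega_*^{\otimes n}$ are represented by the corresponding
  \<open>n\<close>-linear maps on tuples of forms, and a linear map on the summand
  $[\Omega_*^{\otimes n}]_s$ by its extension by zero to the other degrees.
\<close>

type_synonym ('n, 'd) tensor_map = "('n \<Rightarrow> 'd form) \<Rightarrow> 'd form"

definition multilinear :: "('n, 'd::finite) tensor_map \<Rightarrow> bool" where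
  "multilinear F \<longleftrightarrow> (\<forall>w j. linear (\<lambda>v. F (w(j := v))))"

definition LDO_map :: "nat \<Rightarrow> ('n::finite, 'd::finite) tensor_map \<Rightarrow> bool" where
  "LDO_map s F \<longleftrightarrow> multilinear F \<and>
     (\<exists>A :: ('n \<Rightarrow> 'd set) \<Rightarrow> 'd set \<Rightarrow> ('n, 'd) multiop.
        (\<forall>E \<epsilon>. A E \<epsilon> \<in> LDO) \<and>
        (\<forall>E h. F (\<lambda>j. axis (E j) (h j)) =
           (if (\<Sum>j\<in>UNIV. CARD('d) - card (E j)) = s
            then \<Sum>\<epsilon>\<in>{\<epsilon>. card \<epsilon> + s = CARD('d)}. axis \<epsilon> (A E \<epsilon> h) else 0)))"

text \<open>
  The composite of \<open>F\<close> with the differential of the tensor power, evaluated on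
  $\omega_1\otimes\cdots\otimes\omega_n$ with $\omega_j$ homogeneous of degree \<open>k j\<close>.
\<close>

definition comp_tensor_d ::
    "('n::{finite,linorder}, 'd::{finite,linorder}) tensor_map \<Rightarrow> ('n \<Rightarrow> nat) \<Rightarrow> ('n, 'd) tensor_map" where
  "comp_tensor_d F k w = (\<Sum>j\<in>UNIV. (-1) ^ (\<Sum>l | l < j. k l) *\<^sub>R F (w(j := d_H (w j))))"

definition chain_map :: "(nat \<Rightarrow> ('n::{finite,linorder}, 'd::{finite,linorder}) tensor_map) \<Rightarrow> bool" where
  "chain_map f \<longleftrightarrow> (\<forall>s\<ge>1. \<forall>k w. (\<Sum>j\<in>UNIV. k j) = s \<and> (\<forall>j. w j \<in> Omega (k j)) \<longrightarrow>
     d_H (f s w) = comp_tensor_d (f (s - 1)) k w)"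

definition is_lift :: "('n::{finite,linorder}, 'd::{finite,linorder}) multiop
    \<Rightarrow> (nat \<Rightarrow> ('n, 'd) tensor_map) \<Rightarrow> bool" where
  "is_lift A f \<longleftrightarrow> (\<forall>s. LDO_map s (f s)) \<and> chain_map f \<and>
     (\<forall>h. f 0 (\<lambda>j. axis UNIV (h j)) = axis UNIV (A h))"

end

theory Submission
  imports Defs
begin

text \<open>
  Separating the vertical derivatives, a local differential operator is a locally finite sum of
  terms \<open>Q\<^sub>\<alpha> \<circ> \<partial>\<^sup>\<alpha>\<close>, where \<open>Q\<^sub>\<alpha>\<close> is multidifferential in the total derivatives. The
  \<open>Q\<^sub>\<alpha>\<close> are determined by the operator: test it on functions of \<open>x\<close> times a monomial in the
  \<open>u\<^sub>J\<close> with minimal exponent. In polarized coordinates \<open>d/dy\<^sub>1\<close> is composition with the total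
  derivative on the left, so \<open>Q\<^sub>\<alpha> = \<Sum>\<^sub>I D\<^sup>I \<circ> C\<^sub>I\<close> with unique \<open>C\<^sub>I\<close> of order zero in the first
  slot: the operators \<open>D\<^sub>i \<circ> _\<close> act like multiplication by independent polynomial variables.
  Hence operator-valued horizontal forms make up a Koszul complex, which is exact below the top
  degree, and integration by parts identifies the top cohomology class of \<open>A\<close>, that is \<open>C\<^sub>0\<close>,
  with \<open>\<chi>(A)\<close>. So \<open>\<chi>(A) = 0\<close> says that \<open>A\<close> is a total divergence. The only obstruction to
  lifting is therefore the existence of \<open>f\<^sub>1\<close>. If \<open>A = \<Sum>\<^sub>i D\<^sub>i \<circ> B\<^sub>i\<close>, then \<open>f\<^sub>1 = B \<circ> d\<close> is a lift
  with \<open>f\<^sub>1 \<circ> d = 0\<close>.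
\<close>

text \<open>Two obstacles shape the proof. An operator in \<open>LDO\<close> may involve infinitely
  many vertical exponents \<alpha>, of which only finitely many act on functions of bounded jet
  order. Choices made separately for each \<alpha> (coefficients, primitives, divergences) must
  therefore be zero where their datum is zero; the exactness lemmas carry a support clause for this
  purpose, and the same clause keeps primitives homogeneous in form degree. Moreover, vertical
  derivatives do not commute with total derivatives, so composing with a total derivative in a slot
  mixes the exponents; this lowers their degree by at most one, which saves local finiteness.
  Independence of the D_i on the left rests on C_I being linear over local functions, not only over
  the reals, in the first slot. The Koszul homotopy has eigenvalue |I| + N - |\<epsilon>|, which is
  zero only for I = 0 on top forms; what survives there is C_0. For s \<ge> 2 the form to be
  integrated, f_(s-1) o d, has form degree N - s + 1 < N, so no obstruction arises.\<close>

section \<open>Symmetry of second partial derivatives\<close>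

text \<open>The second difference of \<open>g\<close> over a square of side h at (a, b) is computed
  by the mean value theorem, used twice in either order. This gives points within h of (a, b) at
  which \<open>g12\<close> and \<open>g21\<close> take the same value; then h tends to 0.\<close>

lemma mixed_derivatives_eq:
  fixes g g1 g2 g12 g21 :: "real \<Rightarrow> real \<Rightarrow> real"
  assumes d1: "\<And>x y. ((\<lambda>x. g x y) has_real_derivative g1 x y) (at x)"
    and d2: "\<And>x y. ((\<lambda>y. g x y) has_real_derivative g2 x y) (at y)"
    and d12: "\<And>x y. ((\<lambda>y. g1 x y) has_real_derivative g12 x y) (at y)"
    and d21: "\<And>x y. ((\<lambda>x. g2 x y) has_real_derivative g21 x y) (at x)"
    and c12: "isCont (\<lambda>z. g12 (fst z) (snd z)) (a, b)"
    and c21: "isCont (\<lambda>z. g21 (fst z) (snd z)) (a, b)"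
  shows "g12 a b = g21 a b"
proof -
  have "\<exists>x y x' y'. a < x \<and> x < a + h \<and> b < y \<and> y < b + h \<and> a < x' \<and> x' < a + h
      \<and> b < y' \<and> y' < b + h \<and> g12 x y = g21 x' y'" if h: "h > 0" for h
  proof -
    have "\<exists>x>a. x < a + h \<and>
      (g (a+h) (b+h) - g (a+h) b) - (g a (b+h) - g a b) = (a + h - a) * (g1 x (b+h) - g1 x b)"
      by (rule MVT2) (use h in \<open>auto intro!: DERIV_diff d1\<close>)
    then obtain x where x: "a < x" "x < a + h"
      "(g (a+h) (b+h) - g (a+h) b) - (g a (b+h) - g a b) = (a + h - a) * (g1 x (b+h) - g1 x b)"
      by blast
    have "\<exists>y>b. y < b + h \<and> g1 x (b+h) - g1 x b = (b + h - b) * g12 x y"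
      by (rule MVT2) (use h in \<open>auto intro!: d12\<close>)
    then obtain y where y: "b < y" "y < b + h" "g1 x (b+h) - g1 x b = (b + h - b) * g12 x y"
      by blast
    have "\<exists>y>b. y < b + h \<and>
      (g (a+h) (b+h) - g a (b+h)) - (g (a+h) b - g a b) = (b + h - b) * (g2 (a+h) y - g2 a y)"
      by (rule MVT2) (use h in \<open>auto intro!: DERIV_diff d2\<close>)
    then obtain y' where y': "b < y'" "y' < b + h"
      "(g (a+h) (b+h) - g a (b+h)) - (g (a+h) b - g a b) = (b + h - b) * (g2 (a+h) y' - g2 a y')"
      by blast
    have "\<exists>x>a. x < a + h \<and> g2 (a+h) y' - g2 a y' = (a + h - a) * g21 x y'"
      by (rule MVT2) (use h in \<open>auto intro!: d21\<close>)
    then obtain x' where x': "a < x'" "x' < a + h" "g2 (a+h) y' - g2 a y' = (a + h - a) * g21 x' y'"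
      by blast
    have "(g (a+h) (b+h) - g (a+h) b) - (g a (b+h) - g a b) = h * (h * g12 x y)"
      using x(3) y(3) by simp
    moreover have "(g (a+h) (b+h) - g a (b+h)) - (g (a+h) b - g a b) = h * (h * g21 x' y')"
      using x'(3) y'(3) by simp
    ultimately have "h * (h * g12 x y) = h * (h * g21 x' y')"
      by linarith
    then show ?thesis using h x y x' y' by auto
  qed
  then have "\<forall>n. \<exists>x y x' y'. a < x \<and> x < a + inverse (real (Suc n)) \<and> b < y
      \<and> y < b + inverse (real (Suc n)) \<and> a < x' \<and> x' < a + inverse (real (Suc n))
      \<and> b < y' \<and> y' < b + inverse (real (Suc n)) \<and> g12 x y = g21 x' y'" by auto
  then obtain x y x' y' where bd: "\<And>n. a < x n \<and> x n < a + inverse (real (Suc n)) \<and> b < y n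
      \<and> y n < b + inverse (real (Suc n)) \<and> a < x' n \<and> x' n < a + inverse (real (Suc n))
      \<and> b < y' n \<and> y' n < b + inverse (real (Suc n)) \<and> g12 (x n) (y n) = g21 (x' n) (y' n)"
    by metis
  have lim: "z \<longlonglongrightarrow> c" if "\<And>n. c < z n \<and> z n < c + inverse (real (Suc n))" for z c
  proof (rule tendsto_sandwich[of "\<lambda>_. c" _ _ "\<lambda>n. c + inverse (real (Suc n))"])
    show "(\<lambda>n. c + inverse (real (Suc n))) \<longlonglongrightarrow> c"
      using tendsto_add[OF tendsto_const[of c] LIMSEQ_inverse_real_of_nat] by simp
  qed (use that in \<open>auto intro!: always_eventually less_imp_le\<close>)
  have "(\<lambda>n. (x n, y n)) \<longlonglongrightarrow> (a, b)" "(\<lambda>n. (x' n, y' n)) \<longlonglongrightarrow> (a, b)"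
    using bd by (auto intro!: tendsto_Pair lim)
  from isCont_tendsto_compose[OF c12 this(1)] isCont_tendsto_compose[OF c21 this(2)] bd
  show ?thesis by (auto intro: LIMSEQ_unique)
qed

lemma partial_has_derivative:
  assumes "Ck (Suc k) f"
  shows "((\<lambda>t. f (p(c := t))) has_real_derivative partial c f (p(c := x))) (at x)"
proof -
  have "(\<lambda>t. f ((p(c := x))(c := t))) field_differentiable at ((p(c := x)) c)"
    using assms unfolding Ck.simps by blast
  then show ?thesis
    by (auto simp: partial_def DERIV_deriv_iff_field_differentiable[symmetric])
qed

lemma continuous_on_fun_upd2:
  "continuous_on UNIV (\<lambda>z::real \<times> real. (p :: 'a \<Rightarrow> real)(c := fst z, c' := snd z))"
proof (rule continuous_on_coordinatewise_then_product)
  fix i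
  show "continuous_on UNIV (\<lambda>z::real \<times> real. (p(c := fst z, c' := snd z)) i)"
    by (cases "i = c'"; cases "i = c") (auto intro!: continuous_intros)
qed

text \<open>Freezing all coordinates except \<open>c\<close> and \<open>c'\<close> reduces the claim
  to two real variables; continuity in the product topology restricts to this plane.\<close>

lemma partial_commute:
  assumes f: "Ck 2 f"
  shows "partial c (partial c' f) = partial c' (partial c f)"
proof (cases "c = c'")
  case False
  show ?thesis
  proof
    fix p :: "'a jet"
    have C2: "Ck (Suc 1) f" using f by (simp add: numeral_2_eq_2)
    then have C1: "Ck (Suc 0) (partial e f)" for e by simp
    define u where "u = (\<lambda>x y. p(c := x, c' := y))"
    have sw: "u x y = p(c' := y, c := x)" for x y
      using False by (auto simp: u_def fun_upd_twist)
    have c: "isCont (\<lambda>z. partial d (partial e f) (u (fst z) (snd z))) w" for d e w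
    proof -
      have "continuous_on UNIV (partial d (partial e f))" using C1[of e] by simp
      then have "continuous_on UNIV (\<lambda>z. partial d (partial e f) (u (fst z) (snd z)))"
        unfolding u_def
        by (rule continuous_on_compose2[OF _ continuous_on_fun_upd2]) auto
      then show ?thesis by (metis UNIV_I continuous_on_eq_continuous_at open_UNIV)
    qed
    have "partial c' (partial c f) (u (p c) (p c')) = partial c (partial c' f) (u (p c) (p c'))"
    proof (rule mixed_derivatives_eq[where
          g = "\<lambda>x y. f (u x y)" and ?g1.0 = "\<lambda>x y. partial c f (u x y)" and ?g2.0 = "\<lambda>x y. partial c' f (u x y)"
          and ?g12.0 = "\<lambda>x y. partial c' (partial c f) (u x y)"
          and ?g21.0 = "\<lambda>x y. partial c (partial c' f) (u x y)"])
      show "((\<lambda>x. f (u x y)) has_real_derivative partial c f (u x y)) (at x)" for x y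
        unfolding sw by (rule partial_has_derivative[OF C2])
      show "((\<lambda>y. f (u x y)) has_real_derivative partial c' f (u x y)) (at y)" for x y
        unfolding u_def by (rule partial_has_derivative[OF C2])
      show "((\<lambda>y. partial c f (u x y)) has_real_derivative partial c' (partial c f) (u x y)) (at y)" for x y
        unfolding u_def by (rule partial_has_derivative[OF C1])
      show "((\<lambda>x. partial c' f (u x y)) has_real_derivative partial c (partial c' f) (u x y)) (at x)" for x y
        unfolding sw by (rule partial_has_derivative[OF C1])
    qed (rule c)+
    moreover have "u (p c) (p c') = p" by (simp add: u_def)
    ultimately show "partial c (partial c' f) p = partial c' (partial c f) p" by simp
  qed
qed simp

lemma pd_commute: "pd c (pd c' f) = pd c' (pd c f)"
  by transfer (auto simp: local_function_def intro: partial_commute)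

lemma local_function_differentiable:
  "local_function f \<Longrightarrow> (\<lambda>t. f (p(c := t))) field_differentiable at (p c)"
  unfolding local_function_def by (metis Ck.simps(2))

lemma pd_add: "pd c (f + g) = pd c f + pd c g"
  by transfer (auto simp: partial_def fun_eq_iff intro!: deriv_add local_function_differentiable)

lemma pd_mult: "pd c (f * g) = pd c f * g + f * pd c g"
  by transfer (auto simp: partial_def fun_eq_iff local_function_differentiable)

lemma pd_scaleR: "pd c (a *\<^sub>R f) = a *\<^sub>R pd c f"
  by transfer (auto simp: partial_def fun_eq_iff local_function_differentiable)

lemma pd_zero [simp]: "pd c 0 = 0"
  by transfer simp

lemma pd_coordinate: "pd c (coordinate c') = (if c = c' then 1 else 0)"
  by transfer (simp add: partial_coord)

lemma pd_sum: "pd c (sum f S) = (\<Sum>x\<in>S. pd c (f x))"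
  by (induction S rule: infinite_finite_induct) (auto simp: pd_add)

section \<open>Total derivatives as commuting vector fields\<close>

text \<open>Jet order is read off from vanishing vertical derivatives and not from
  \<open>depends_on\<close>, since this is the form in which it kills
  \<open>du_power \<alpha>\<close>.\<close>

definition ord_le :: "nat \<Rightarrow> 'd::finite loc \<Rightarrow> bool" where
  "ord_le m f \<longleftrightarrow> (\<forall>J. m < mabs J \<longrightarrow> pd (Fibre J) f = 0)"

lemma partial_eq_0_if_independent:
  assumes "depends_on S f" "c \<notin> S"
  shows "partial c f = (\<lambda>_. 0)"
proof
  fix p
  have "(\<lambda>t. f (p(c := t))) = (\<lambda>t. f p)"
    using assms unfolding depends_on_def by (metis fun_upd_other)
  then show "partial c f p = 0" by (simp add: partial_def)
qed

lemma ord_le_exists: "\<exists>m. ord_le m f"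
  unfolding ord_le_def
proof transfer
  fix f :: "'a jet \<Rightarrow> real"
  assume "local_function f"
  then obtain m where "depends_on {c. coord_order c \<le> m} f"
    unfolding local_function_def by blast
  then show "\<exists>m. \<forall>J. m < mabs J \<longrightarrow> partial (Fibre J) f = (\<lambda>_. 0)"
    by (intro exI[of _ m]) (auto intro: partial_eq_0_if_independent)
qed

lemma ord_le_mono: "ord_le m f \<Longrightarrow> m \<le> m' \<Longrightarrow> ord_le m' f"
  by (auto simp: ord_le_def)

lemma finite_mabs_le: "finite {J :: 'd::finite mindex. mabs J \<le> m}"
proof (rule finite_subset)
  have "J i \<le> mabs J" for J :: "'d mindex" and i
    unfolding mabs_def by (rule member_le_sum) auto
  then show "{J :: 'd mindex. mabs J \<le> m} \<subseteq> {J. \<forall>i. J i \<in> {..m}}"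
    by (auto intro: order_trans)
  show "finite {J :: 'd mindex. \<forall>i. J i \<in> {..m}}"
    using finite_set_of_finite_funs[of "UNIV :: 'd set" "{..m}" undefined] by auto
qed

lemma finite_pd_Fibre_nonzero: "finite {J. pd (Fibre J) f \<noteq> 0}"
proof -
  obtain m where "ord_le m f" using ord_le_exists by blast
  then have "{J. pd (Fibre J) f \<noteq> 0} \<subseteq> {J. mabs J \<le> m}"
    by (auto simp: ord_le_def not_less[symmetric])
  then show ?thesis using finite_mabs_le finite_subset by blast
qed

lemma finite_pd_nonzero: "finite {c. pd c (f :: 'd::finite loc) \<noteq> 0}"
proof (rule finite_subset)
  show "{c. pd c f \<noteq> 0} \<subseteq> range Base \<union> Fibre ` {J. pd (Fibre J) f \<noteq> 0}"
  proof
    fix c assume "c \<in> {c. pd c f \<noteq> 0}"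
    then show "c \<in> range Base \<union> Fibre ` {J. pd (Fibre J) f \<noteq> 0}" by (cases c) auto
  qed
qed (simp add: finite_pd_Fibre_nonzero)

text \<open>The total derivative is the vector field with components \<open>shift_coord i\<close>.\<close>

fun shift_coord :: "'d::finite \<Rightarrow> 'd coord \<Rightarrow> 'd loc" where
  "shift_coord i (Base k) = (if k = i then 1 else 0)"
| "shift_coord i (Fibre J) = coordinate (Fibre (J(i := Suc (J i))))"

text \<open>\<open>Sum_any\<close> runs over a support that depends on \<open>f\<close>. Allowing
  any finite superset puts the sums for several functions on one index set.\<close>

lemma total_deriv_eq_sum:
  assumes "finite S" "{c. pd c f \<noteq> 0} \<subseteq> S"
  shows "total_deriv i f = (\<Sum>c\<in>S. shift_coord i c * pd c f)"
proof -
  let ?F = "{J. pd (Fibre J) f \<noteq> 0}"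
  have "(\<Sum>c\<in>S. shift_coord i c * pd c f) = (\<Sum>c\<in>insert (Base i) (Fibre ` ?F). shift_coord i c * pd c f)"
  proof (rule sum.mono_neutral_cong)
    show "shift_coord i c * pd c f = 0" if "c \<in> S - insert (Base i) (Fibre ` ?F)" for c
      using that by (cases c) auto
    show "shift_coord i c * pd c f = 0" if "c \<in> insert (Base i) (Fibre ` ?F) - S" for c
      using that assms(2) by auto
  qed (use assms finite_pd_Fibre_nonzero in auto)
  also have "\<dots> = pd (Base i) f + (\<Sum>J\<in>?F. coordinate (Fibre (J(i := Suc (J i)))) * pd (Fibre J) f)"
    by (subst sum.insert) (auto simp: finite_pd_Fibre_nonzero sum.reindex inj_on_def)
  also have "\<dots> = total_deriv i f"
    unfolding total_deriv_def
    by (subst Sum_any.expand_superset[of ?F]) (auto simp: finite_pd_Fibre_nonzero)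
  finally show ?thesis by simp
qed

lemma total_deriv_add: "total_deriv i (f + g) = total_deriv i f + total_deriv i g"
proof -
  let ?S = "{c. pd c f \<noteq> 0} \<union> {c. pd c g \<noteq> 0}"
  have "{c. pd c (f + g) \<noteq> 0} \<subseteq> ?S" by (auto simp: pd_add)
  then show ?thesis
    by (simp add: total_deriv_eq_sum[of ?S] finite_pd_nonzero pd_add distrib_left sum.distrib)
qed

lemma total_deriv_mult: "total_deriv i (f * g) = total_deriv i f * g + f * total_deriv i g"
proof -
  let ?S = "{c. pd c f \<noteq> 0} \<union> {c. pd c g \<noteq> 0}"
  have "{c. pd c (f * g) \<noteq> 0} \<subseteq> ?S" by (auto simp: pd_mult)
  then show ?thesis
    by (simp add: total_deriv_eq_sum[of ?S] finite_pd_nonzero pd_mult distrib_left sum.distrib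
        sum_distrib_left sum_distrib_right mult_ac)
qed

lemma total_deriv_scaleR: "total_deriv i (a *\<^sub>R f) = a *\<^sub>R total_deriv i f"
proof -
  have "{c. pd c (a *\<^sub>R f) \<noteq> 0} \<subseteq> {c. pd c f \<noteq> 0}" by (auto simp: pd_scaleR)
  then show ?thesis
    by (simp add: total_deriv_eq_sum[of "{c. pd c f \<noteq> 0}"] finite_pd_nonzero pd_scaleR scaleR_sum_right)
qed

lemma total_deriv_zero [simp]: "total_deriv i 0 = 0"
  using total_deriv_scaleR[of i 0 0] by simp

lemma total_deriv_sum: "total_deriv i (sum f S) = (\<Sum>x\<in>S. total_deriv i (f x))"
  by (induction S rule: infinite_finite_induct) (auto simp: total_deriv_add)

lemma total_deriv_minus: "total_deriv i (- f) = - total_deriv i f"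
  using total_deriv_scaleR[of i "-1" f] by simp

lemma total_deriv_coordinate: "total_deriv i (coordinate c) = shift_coord i c"
  by (subst total_deriv_eq_sum[of "{c}"]) (auto simp: pd_coordinate)

lemma pd_shift_coord:
  "pd (Fibre J) (shift_coord i c) = (if 0 < J i \<and> c = Fibre (J(i := J i - 1)) then 1 else 0)"
proof (cases c)
  case (Base k)
  have "pd (Fibre J) 1 = 0" by transfer simp
  then show ?thesis using Base by simp
next
  case (Fibre K)
  have "J = K(i := Suc (K i)) \<longleftrightarrow> 0 < J i \<and> K = J(i := J i - 1)"
    by (auto simp: fun_eq_iff split: if_splits)
  then show ?thesis using Fibre by (simp add: pd_coordinate)
qed

text \<open>In the composite of the two vector fields the second-order part is symmetric by
  \<open>pd_commute\<close>. The first-order part has coefficients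
  \<open>total_deriv i (shift_coord k c)\<close>, symmetric because raising J in the directions i
  and k commutes.\<close>

lemma total_deriv_commute: "total_deriv i (total_deriv k f) = total_deriv k (total_deriv i f)"
proof -
  let ?S = "{c. pd c f \<noteq> 0}"
  have S: "{c. pd c (pd e f) \<noteq> 0} \<subseteq> ?S" for e
    by (auto simp: pd_commute[of _ e])
  have "total_deriv i (total_deriv k f) = (\<Sum>c\<in>?S. total_deriv i (shift_coord k c) * pd c f
      + (\<Sum>e\<in>?S. shift_coord k c * shift_coord i e * pd e (pd c f)))" for i k
    by (simp add: total_deriv_eq_sum[of ?S f] finite_pd_nonzero total_deriv_sum total_deriv_mult
        total_deriv_eq_sum[of ?S "pd _ f"] S sum_distrib_left mult.assoc)
  note eq = this
  have sc: "total_deriv i (shift_coord k c) = total_deriv k (shift_coord i c)" for c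
  proof (cases c)
    case (Base l)
    have "total_deriv i (1::'a loc) = 0" for i
      using total_deriv_mult[of i 1 1] by simp
    then show ?thesis using Base by simp
  next
    case (Fibre J)
    then show ?thesis
      by (simp add: total_deriv_coordinate) (cases "i = k"; simp add: fun_upd_twist)
  qed
  have "(\<Sum>c\<in>?S. \<Sum>e\<in>?S. shift_coord k c * shift_coord i e * pd e (pd c f))
      = (\<Sum>c\<in>?S. \<Sum>e\<in>?S. shift_coord i c * shift_coord k e * pd e (pd c f))"
    by (subst sum.swap) (simp add: pd_commute mult_ac cong: sum.cong)
  then show ?thesis unfolding eq sum.distrib sc by simp
qed

text \<open>Among the components of D_i the coordinate u_J occurs only as the coefficient of the
  derivative in u_K with iK = J, hence a single correction term.\<close>

lemma pd_total_deriv: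
  "pd (Fibre J) (total_deriv i f)
    = total_deriv i (pd (Fibre J) f) + (if 0 < J i then pd (Fibre (J(i := J i - 1))) f else 0)"
proof -
  let ?S = "{c. pd c f \<noteq> 0}"
  have S: "{c. pd c (pd e f) \<noteq> 0} \<subseteq> ?S" for e
    by (auto simp: pd_commute[of _ e])
  have "pd (Fibre J) (total_deriv i f) = (\<Sum>c\<in>?S. (if 0 < J i \<and> c = Fibre (J(i := J i - 1)) then 1 else 0) * pd c f)
      + (\<Sum>c\<in>?S. shift_coord i c * pd (Fibre J) (pd c f))"
    by (simp only: total_deriv_eq_sum[of ?S f] finite_pd_nonzero order_refl pd_sum pd_mult
        pd_shift_coord sum.distrib)
  also have "(\<Sum>c\<in>?S. shift_coord i c * pd (Fibre J) (pd c f)) = total_deriv i (pd (Fibre J) f)"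
    by (subst total_deriv_eq_sum[of ?S "pd _ f"]) (simp_all add: finite_pd_nonzero S pd_commute)
  also have "(\<Sum>c\<in>?S. (if 0 < J i \<and> c = Fibre (J(i := J i - 1)) then 1 else 0) * pd c f)
      = (if 0 < J i then pd (Fibre (J(i := J i - 1))) f else 0)"
    using finite_pd_nonzero[of f] by (auto simp: if_distrib[of "\<lambda>z. z * _"] sum.delta cong: if_cong)
  finally show ?thesis by simp
qed

section \<open>Monomials in commuting operators\<close>

definition fin_supp :: "('c \<Rightarrow> nat) \<Rightarrow> bool" where
  "fin_supp I \<longleftrightarrow> finite {c. I c \<noteq> 0}"

lemma fin_supp_finite [simp]: "fin_supp (I :: 'c::finite \<Rightarrow> nat)"
  by (simp add: fin_supp_def)

lemma fin_supp_upd: "fin_supp I \<Longrightarrow> fin_supp (I(e := n))"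
  unfolding fin_supp_def by (rule finite_subset[of _ "insert e {c. I c \<noteq> 0}"]) auto

lemma fin_supp_induct [consumes 1, case_names zero Suc]:
  fixes I :: "'c \<Rightarrow> nat"
  assumes "fin_supp I"
    and z: "P (\<lambda>_. 0)"
    and s: "\<And>I c. fin_supp I \<Longrightarrow> P I \<Longrightarrow> P (I(c := Suc (I c)))"
  shows "P I"
  using assms(1)
proof (induction "\<Sum>c | I c \<noteq> 0. I c" arbitrary: I)
  case 0
  then have "I = (\<lambda>_. 0)" by (auto simp: fun_eq_iff fin_supp_def)
  then show ?case using z by simp
next
  case (Suc n)
  then obtain c where c: "I c \<noteq> 0" by fastforce
  define K where "K = I(c := I c - 1)"
  have K: "fin_supp K" unfolding K_def by (rule fin_supp_upd[OF Suc.prems])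
  have "(\<Sum>c | K c \<noteq> 0. K c) = (\<Sum>c | I c \<noteq> 0. K c)"
    by (rule sum.mono_neutral_left) (use Suc.prems c in \<open>auto simp: K_def fin_supp_def\<close>)
  also have "\<dots> = n"
  proof -
    have fin: "finite {c. I c \<noteq> 0}" using Suc.prems by (simp add: fin_supp_def)
    have "sum f {c. I c \<noteq> 0} = f c + sum f ({c. I c \<noteq> 0} - {c})" for f :: "'c \<Rightarrow> nat"
      using sum.remove[OF fin] c by simp
    from this[of K] this[of I] show ?thesis using Suc.hyps(2) c by (simp add: K_def)
  qed
  finally have "P K" using Suc.hyps(1) K by simp
  from s[OF K this, of c] c show ?case by (simp add: K_def)
qed

text \<open>\<open>power_op\<close> is a fold over the support; the locale turns it into rules for
  adding one factor. Total and vertical derivatives use it with linearity added, the operators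
  \<open>dy\<close> in this bare form.\<close>

locale commuting_operators =
  fixes D :: "'c \<Rightarrow> 'x \<Rightarrow> 'x"
  assumes commute: "D (c::'c) (D e x) = D e (D c x)"
begin

lemma funpow_commute: "(D c ^^ m) ((D e ^^ n) x) = (D e ^^ n) ((D c ^^ m) x)"
proof -
  have "D c ((D e ^^ n) x) = (D e ^^ n) (D c x)" for n x
    by (induction n arbitrary: x) (auto simp: commute[of c e])
  then show ?thesis
    by (induction m arbitrary: x) auto
qed

lemma power_op_zero [simp]: "power_op D (\<lambda>_. 0) x = x"
  by (simp add: power_op_def)

lemma power_op_insert:
  assumes fin: "fin_supp I"
  shows "power_op D I x = (D c ^^ I c) (power_op D (I(c := 0)) x)"
proof -
  interpret comp_fun_commute "\<lambda>c. D c ^^ I c"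
    by standard (auto simp: fun_eq_iff funpow_commute)
  have comm: "comp_fun_commute (\<lambda>e. D e ^^ K e)" for K
    by standard (auto simp: fun_eq_iff funpow_commute)
  let ?S = "{c. I c \<noteq> 0} - {c}"
  have "Finite_Set.fold (\<lambda>c. D c ^^ I c) x ?S = Finite_Set.fold (\<lambda>e. D e ^^ (I(c := 0)) e) x ?S"
    by (rule Finite_Set.fold_cong[of UNIV])
      (use fin[unfolded fin_supp_def] comm[of I] comm[of "I(c := 0)"] in \<open>simp_all add: comp_fun_commute_def'\<close>)
  moreover have "{e. (I(c := 0)) e \<noteq> 0} = ?S" by auto
  moreover have "Finite_Set.fold (\<lambda>c. D c ^^ I c) x {c. I c \<noteq> 0}
      = (D c ^^ I c) (Finite_Set.fold (\<lambda>c. D c ^^ I c) x ?S)"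
  proof (cases "I c = 0")
    case False
    then show ?thesis using fold_rec[OF fin[unfolded fin_supp_def], of c x] by simp
  next
    case True
    then have "?S = {c. I c \<noteq> 0}" by auto
    then show ?thesis using True by simp
  qed
  ultimately show ?thesis by (simp add: power_op_def)
qed

lemma power_op_Suc:
  assumes "fin_supp I"
  shows "power_op D (I(c := Suc (I c))) x = D c (power_op D I x)"
proof -
  let ?I = "I(c := Suc (I c))"
  have "power_op D ?I x = (D c ^^ ?I c) (power_op D (?I(c := 0)) x)"
    by (rule power_op_insert[OF fin_supp_upd[OF assms]])
  then show ?thesis using power_op_insert[OF assms, of x c] by simp
qed

lemma power_op_commute1:
  assumes "fin_supp I"
  shows "power_op D I (D c x) = D c (power_op D I x)"
  using assms
proof (induction I rule: fin_supp_induct)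
  case (Suc I e)
  then show ?case by (simp only: power_op_Suc commute[of c e])
qed simp

lemma power_op_Suc':
  assumes "fin_supp I"
  shows "power_op D (I(c := Suc (I c))) x = power_op D I (D c x)"
  using assms by (simp add: power_op_Suc power_op_commute1)

lemma power_op_unfold:
  assumes "fin_supp I" "0 < I c"
  shows "D c (power_op D (I(c := I c - 1)) x) = power_op D I x"
proof -
  let ?I = "I(c := I c - 1)"
  have "power_op D (?I(c := Suc (?I c))) x = D c (power_op D ?I x)"
    by (rule power_op_Suc[OF fin_supp_upd[OF assms(1)]])
  then show ?thesis using assms(2) by simp
qed

end

locale commuting_linear_operators = commuting_operators D
  for D :: "'c \<Rightarrow> 'x::real_vector \<Rightarrow> 'x" +
  assumes linear: "linear (D c)"
begin

lemma linear_power_op: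
  assumes "fin_supp I"
  shows "linear (power_op D I)"
  using assms
proof (induction I rule: fin_supp_induct)
  case zero
  have "power_op D (\<lambda>_. 0) = id" by (simp add: fun_eq_iff)
  then show ?case by (simp only: linear_id)
next
  case (Suc I c)
  then have "power_op D (I(c := Suc (I c))) = D c \<circ> power_op D I"
    by (simp add: fun_eq_iff power_op_Suc)
  then show ?case using linear_compose[OF Suc.IH linear] by (simp only:)
qed

lemma power_op_of_0 [simp]: "fin_supp I \<Longrightarrow> power_op D I 0 = 0"
  by (rule linear_0[OF linear_power_op])

lemma power_op_eq_0_if_step:
  assumes "fin_supp I" "0 < I c" "D c x = 0"
  shows "power_op D I x = 0"
proof -
  let ?I = "I(c := I c - 1)"
  have fin: "fin_supp ?I" by (rule fin_supp_upd[OF assms(1)])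
  have "power_op D I x = power_op D ?I (D c x)"
    using power_op_Suc'[OF fin, of c x] assms(2) by simp
  then show ?thesis by (simp only: assms(3) power_op_of_0[OF fin])
qed

end

text \<open>\<open>coord\<close> is the canonical commutation relation between derivations and
  coordinates. It covers D_i with x^i as well as vertical derivatives with u_J.\<close>

locale coordinate_operators = commuting_linear_operators D
  for D :: "'c \<Rightarrow> 'x::real_algebra_1 \<Rightarrow> 'x" +
  fixes z :: "'c \<Rightarrow> 'x"
  assumes coord: "D c (z e * h) = z e * D c h + (if c = e then h else 0)"
begin

text \<open>The commutator of D^I with z_c is I_c D^(I-c), by the Leibniz rule one factor at a time.
  The truncated \<open>I c - 1\<close> is harmless at 0, where its coefficient vanishes.\<close>

lemma power_op_coord:
  assumes "fin_supp I"
  shows "power_op D I (z c * h) = z c * power_op D I h + real (I c) *\<^sub>R power_op D (I(c := I c - 1)) h"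
  using assms
proof (induction I rule: fin_supp_induct)
  case (Suc I e)
  let ?Ic = "I(c := I c - 1)"
  have fin: "fin_supp ?Ic" by (rule fin_supp_upd[OF Suc.hyps])
  have IH: "power_op D I (z c * h) = z c * power_op D I h + real (I c) *\<^sub>R power_op D ?Ic h"
    by (rule Suc.IH)
  have "power_op D (I(e := Suc (I e))) (z c * h) = D e (power_op D I (z c * h))"
    by (rule power_op_Suc[OF Suc.hyps])
  also have "\<dots> = z c * power_op D (I(e := Suc (I e))) h + ((if c = e then power_op D I h else 0)
        + real (I c) *\<^sub>R D e (power_op D ?Ic h))"
    unfolding IH power_op_Suc[OF Suc.hyps]
    by (simp add: linear_add[OF linear] linear_scale[OF linear] coord add.assoc)
  also have "(if c = e then power_op D I h else 0) + real (I c) *\<^sub>R D e (power_op D (I(c := I c - 1)) h)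
      = real ((I(e := Suc (I e))) c) *\<^sub>R power_op D ((I(e := Suc (I e)))(c := (I(e := Suc (I e))) c - 1)) h"
  proof (cases "c = e")
    case True
    then show ?thesis
      using power_op_unfold[OF Suc.hyps, of e h] by (cases "I e = 0") (simp_all add: algebra_simps fun_upd_idem)
  next
    case False
    then have "(I(e := Suc (I e)))(c := I c - 1) = ?Ic(e := Suc (?Ic e))"
      by (auto simp: fun_eq_iff)
    then show ?thesis using False power_op_Suc[OF fin, of e h] by simp
  qed
  finally show ?case .
qed simp

text \<open>The witness is the divided monomial z^I / I!. \<open>P\<close> records a further
  property that survives multiplication by scaled coordinates, such as independence of all u_J. The
  factor \<open>h\<close> is a constant for the operators, so that a vertical monomial can be
  multiplied by a function of x.\<close>

lemma test_function_exists:
  assumes "fin_supp I" and P: "P 1" "\<And>w c r. P w \<Longrightarrow> P (r *\<^sub>R (z c * w))"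
  shows "\<exists>w. P w \<and> (\<forall>h. (\<forall>c. D c h = 0) \<longrightarrow> power_op D I (w * h) = h \<and>
    (\<forall>K. fin_supp K \<longrightarrow> \<not> K \<le> I \<longrightarrow> power_op D K (w * h) = 0))"
  using assms(1)
proof (induction I rule: fin_supp_induct)
  case zero
  have "power_op D K h = 0" if h: "\<forall>c. D c h = 0" and K: "fin_supp K" "\<not> K \<le> (\<lambda>_. 0)" for K h
  proof -
    obtain c where "0 < K c" using K(2) by (auto simp: le_fun_def)
    then show ?thesis using power_op_eq_0_if_step[OF K(1), of c h] h by simp
  qed
  then show ?case using P(1) by (intro exI[of _ 1]) simp
next
  case (Suc I c)
  obtain w where Pw: "P w" and w: "\<And>h. (\<forall>c. D c h = 0) \<Longrightarrow> power_op D I (w * h) = h"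
    "\<And>K h. (\<forall>c. D c h = 0) \<Longrightarrow> fin_supp K \<Longrightarrow> \<not> K \<le> I \<Longrightarrow> power_op D K (w * h) = 0"
    using Suc.IH by blast
  let ?I = "I(c := Suc (I c))"
  have fin: "fin_supp ?I" by (rule fin_supp_upd[OF Suc.hyps])
  have eq: "power_op D K (((1 / real (Suc (I c))) *\<^sub>R (z c * w)) * h) = (1 / real (Suc (I c))) *\<^sub>R
      (z c * power_op D K (w * h) + real (K c) *\<^sub>R power_op D (K(c := K c - 1)) (w * h))"
    if "fin_supp K" for K h
    using power_op_coord[OF that, of c "w * h"] linear_scale[OF linear_power_op[OF that]]
    by (simp add: mult.assoc)
  show ?case
  proof (intro exI[of _ "(1 / real (Suc (I c))) *\<^sub>R (z c * w)"] allI impI conjI P(2) Pw)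
    fix h assume h: "\<forall>c. D c h = 0"
    \<comment> \<open>Hence the exponent \<open>?I\<close> kills \<open>w * h\<close>; only the
      commutator term with coefficient \<open>Suc (I c)\<close> remains, and the scalar cancels this
      coefficient.\<close>
    have "\<not> ?I \<le> I" by (metis fun_upd_same le_fun_def not_less_eq_eq order_refl)
    then show "power_op D ?I ((1 / real (Suc (I c))) *\<^sub>R (z c * w) * h) = h"
      unfolding eq[OF fin] w(2)[OF h fin \<open>\<not> ?I \<le> I\<close>] using w(1)[OF h] by simp
    fix K :: "'c \<Rightarrow> nat"
    assume K: "fin_supp K" "\<not> K \<le> ?I"
    have "\<not> K \<le> I" using K(2) by (auto simp: le_fun_def) (metis le_SucI)
    moreover have "\<not> K(c := K c - 1) \<le> I" if "0 < K c"
    proof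
      assume "K(c := K c - 1) \<le> I"
      then have "K e \<le> ?I e" for e
        using that by (cases "e = c") (auto simp: le_fun_def dest: spec[of _ e])
      then show False using K(2) by (auto simp: le_fun_def)
    qed
    ultimately show "power_op D K ((1 / real (Suc (I c))) *\<^sub>R (z c * w) * h) = 0"
      unfolding eq[OF K(1)]
      using w(2)[OF h K(1)] w(2)[OF h fin_supp_upd[OF K(1), of c "K c - 1"]]
      by (cases "K c = 0") simp_all
  qed
qed

end

section \<open>Powers of total and vertical derivatives\<close>

lemma linear_total_deriv: "linear (total_deriv i)"
  by (intro linearI total_deriv_add total_deriv_scaleR)

global_interpretation dx: coordinate_operators "total_deriv :: 'd::finite \<Rightarrow> _" "\<lambda>i. coordinate (Base i)"
  by unfold_locales (auto simp: total_deriv_commute total_deriv_add total_deriv_scaleR total_deriv_mult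
      total_deriv_coordinate)

global_interpretation du: coordinate_operators "\<lambda>J :: 'd::finite mindex. pd (Fibre J)" "\<lambda>J. coordinate (Fibre J)"
  by unfold_locales (auto simp: pd_commute pd_add pd_scaleR pd_mult pd_coordinate)

lemmas dx_power_zero [simp] = dx.power_op_zero[folded dx_power_def]
lemmas dx_power_Suc = dx.power_op_Suc[folded dx_power_def, OF fin_supp_finite]
lemmas dx_power_Suc' = dx.power_op_Suc'[folded dx_power_def, OF fin_supp_finite]
lemmas dx_power_commute1 = dx.power_op_commute1[folded dx_power_def, OF fin_supp_finite]
lemmas linear_dx_power = dx.linear_power_op[folded dx_power_def, OF fin_supp_finite]
lemmas dx_power_coord = dx.power_op_coord[folded dx_power_def, OF fin_supp_finite]
lemmas dx_test_function_exists = dx.test_function_exists[folded dx_power_def, OF fin_supp_finite]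

lemma finite_lookup: "fin_supp (Poly_Mapping.lookup \<alpha>)"
  by (simp add: fin_supp_def)

lemmas linear_du_power = du.linear_power_op[OF finite_lookup, folded du_power_def]
lemmas mindex_induct = fin_supp_induct[OF fin_supp_finite, case_names zero Suc]

lemma du_power_zero [simp]: "du_power 0 f = f"
  by (simp add: du_power_def zero_poly_mapping.rep_eq)

lemma lookup_add_single:
  "Poly_Mapping.lookup (\<alpha> + Poly_Mapping.single J 1) = (Poly_Mapping.lookup \<alpha>)(J := Suc (Poly_Mapping.lookup \<alpha> J))"
  by (auto simp: fun_eq_iff lookup_add lookup_single)

lemma du_power_add_single: "du_power (\<alpha> + Poly_Mapping.single J 1) f = du_power \<alpha> (pd (Fibre J) f)"
  by (simp only: du_power_def lookup_add_single du.power_op_Suc'[OF finite_lookup])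

lemma vindex_induct [case_names zero add]:
  fixes \<alpha> :: "'d vindex"
  assumes z: "P 0" and s: "\<And>\<alpha> J. P \<alpha> \<Longrightarrow> P (\<alpha> + Poly_Mapping.single J 1)"
  shows "P \<alpha>"
proof -
  have "\<forall>\<alpha>. Poly_Mapping.lookup \<alpha> = I \<longrightarrow> P \<alpha>" if "fin_supp I" for I
    using that
  proof (induction I rule: fin_supp_induct)
    case zero
    then show ?case using z by (metis lookup_zero poly_mapping_eqI)
  next
    case (Suc I c)
    show ?case
    proof (intro allI impI)
      fix \<alpha> assume \<alpha>: "Poly_Mapping.lookup \<alpha> = I(c := Suc (I c))"
      define \<beta> where "\<beta> = Abs_poly_mapping I"
      have \<beta>: "Poly_Mapping.lookup \<beta> = I"
        unfolding \<beta>_def by (rule lookup_Abs_poly_mapping[OF Suc.hyps[unfolded fin_supp_def]])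
      have "\<alpha> = \<beta> + Poly_Mapping.single c 1"
        by (rule poly_mapping_eqI) (simp only: \<alpha> lookup_add_single \<beta>)
      then show "P \<alpha>" using Suc.IH \<beta> s by blast
    qed
  qed
  then show ?thesis using finite_lookup by blast
qed

lemma du_power_eq_0:
  assumes "ord_le m f" "m < deg_f \<alpha>"
  shows "du_power \<alpha> f = 0"
proof -
  have "\<exists>J\<in>Poly_Mapping.keys \<alpha>. m < mabs J"
    using assms(2) unfolding deg_f_def by (subst (asm) Max_gr_iff) auto
  then obtain J where "J \<in> Poly_Mapping.keys \<alpha>" "m < mabs J" by blast
  then show ?thesis
    using assms(1) unfolding du_power_def
    by (intro du.power_op_eq_0_if_step[of _ J]) (auto simp: ord_le_def in_keys_iff finite_lookup)
qed

lemma keys_add_single: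
  "Poly_Mapping.keys (\<alpha> + Poly_Mapping.single J (1::nat)) = insert J (Poly_Mapping.keys \<alpha>)"
  by (auto simp: in_keys_iff lookup_add lookup_single when_def split: if_splits)

lemma deg_f_add_single: "deg_f (\<alpha> + Poly_Mapping.single J 1) = max (mabs J) (deg_f \<alpha>)"
  unfolding deg_f_def keys_add_single
  by (cases "Poly_Mapping.keys \<alpha> = {}") (auto simp: max.left_commute)

lemma mabs_decr: "0 < J i \<Longrightarrow> mabs J = Suc (mabs (J(i := J i - 1)))"
  unfolding mabs_def by (simp add: sum.remove[of UNIV i])

text \<open>Repeated use of \<open>\<partial>\<^sub>J D\<^sub>i = D\<^sub>i \<partial>\<^sub>J + \<partial>\<^sub>K\<close> with \<open>iK = J\<close>; the list collects the correction terms,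
  with repetitions instead of coefficients.\<close>

lemma du_power_total_deriv:
  "\<exists>bs. (\<forall>\<beta>\<in>set bs. deg_f \<alpha> \<le> Suc (deg_f \<beta>)) \<and>
    (\<forall>f. du_power \<alpha> (total_deriv i f) = total_deriv i (du_power \<alpha> f) + (\<Sum>\<beta>\<leftarrow>bs. du_power \<beta> f))"
proof (induction \<alpha> rule: vindex_induct)
  case zero
  show ?case by (rule exI[of _ "[]"]) simp
next
  case (add \<alpha> J)
  then obtain bs where bs: "\<And>\<beta>. \<beta> \<in> set bs \<Longrightarrow> deg_f \<alpha> \<le> Suc (deg_f \<beta>)"
    "\<And>f. du_power \<alpha> (total_deriv i f) = total_deriv i (du_power \<alpha> f) + (\<Sum>\<beta>\<leftarrow>bs. du_power \<beta> f)"
    by blast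
  let ?K = "J(i := J i - 1)"
  define cs where "cs = (if 0 < J i then [\<alpha> + Poly_Mapping.single ?K 1] else [])"
  show ?case
  proof (intro exI[of _ "map (\<lambda>\<beta>. \<beta> + Poly_Mapping.single J 1) bs @ cs"] conjI allI ballI)
    fix \<beta> assume "\<beta> \<in> set (map (\<lambda>\<beta>. \<beta> + Poly_Mapping.single J 1) bs @ cs)"
    then consider \<gamma> where "\<gamma> \<in> set bs" "\<beta> = \<gamma> + Poly_Mapping.single J 1"
      | "0 < J i" "\<beta> = \<alpha> + Poly_Mapping.single ?K 1"
      by (auto simp: cs_def split: if_splits)
    then show "deg_f (\<alpha> + Poly_Mapping.single J 1) \<le> Suc (deg_f \<beta>)"
    proof cases
      case 1
      show ?thesis using bs(1)[OF 1(1)] unfolding 1(2) deg_f_add_single by linarith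
    next
      case 2
      \<comment> \<open>K has order one less than J, so replacing J by K costs at most one in
        \<open>deg_f\<close>.\<close>
      show ?thesis using mabs_decr[of J i, OF 2(1)] unfolding 2(2) deg_f_add_single by linarith
    qed
  next
    fix f
    have "du_power (\<alpha> + Poly_Mapping.single J 1) (total_deriv i f)
        = du_power \<alpha> (total_deriv i (pd (Fibre J) f)) + (if 0 < J i then du_power \<alpha> (pd (Fibre ?K) f) else 0)"
      using linear_add[OF linear_du_power] linear_0[OF linear_du_power]
      by (simp only: du_power_add_single pd_total_deriv) auto
    then show "du_power (\<alpha> + Poly_Mapping.single J 1) (total_deriv i f)
        = total_deriv i (du_power (\<alpha> + Poly_Mapping.single J 1) f)
          + (\<Sum>\<beta>\<leftarrow>map (\<lambda>\<beta>. \<beta> + Poly_Mapping.single J 1) bs @ cs. du_power \<beta> f)"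
      by (simp add: bs(2) du_power_add_single cs_def comp_def flip: One_nat_def)
  qed
qed

section \<open>Loc-linear combinations of operators\<close>

text \<open>The left module over the local functions generated by the operators \<open>b I\<close>.
  The inductive form lets closure properties be checked on scaled generators;
  \<open>loc_span_coeffs\<close> recovers coefficients.\<close>

inductive_set loc_span :: "('i \<Rightarrow> ('n, 'd::finite) multiop) \<Rightarrow> ('n, 'd) multiop set"
  for b :: "'i \<Rightarrow> ('n, 'd) multiop" where
  zero: "(\<lambda>_. 0) \<in> loc_span b"
| add_term: "Q \<in> loc_span b \<Longrightarrow> (\<lambda>g. a * b I g + Q g) \<in> loc_span b"

lemma loc_span_base: "b I \<in> loc_span b"
  using loc_span.add_term[OF loc_span.zero, of 1 b I] by simp

lemma loc_span_add: "Q \<in> loc_span b \<Longrightarrow> R \<in> loc_span b \<Longrightarrow> (\<lambda>g. Q g + R g) \<in> loc_span b"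
proof (induction Q rule: loc_span.induct)
  case (add_term Q a I)
  then show ?case using loc_span.add_term[of "\<lambda>g. Q g + R g" b a I] by (simp add: add.assoc)
qed simp

lemma loc_span_mult: "Q \<in> loc_span b \<Longrightarrow> (\<lambda>g. c * Q g) \<in> loc_span b"
proof (induction Q rule: loc_span.induct)
  case (add_term Q a I)
  then show ?case using loc_span.add_term[of "\<lambda>g. c * Q g" b "c * a" I] by (simp add: distrib_left mult.assoc)
qed (simp add: loc_span.zero)

lemma loc_span_sum: "(\<And>k. k \<in> S \<Longrightarrow> Q k \<in> loc_span b) \<Longrightarrow> (\<lambda>g. \<Sum>k\<in>S. Q k g) \<in> loc_span b"
  by (induction S rule: infinite_finite_induct) (auto intro: loc_span.zero loc_span_add)

lemma loc_span_scaleR: "Q \<in> loc_span b \<Longrightarrow> (\<lambda>g. r *\<^sub>R Q g) \<in> loc_span b"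
  using loc_span_mult[of Q b "r *\<^sub>R 1"] by simp

lemma loc_span_uminus: "Q \<in> loc_span b \<Longrightarrow> (\<lambda>g. - Q g) \<in> loc_span b"
  using loc_span_scaleR[of Q b "-1"] by simp

lemma loc_span_diff: "Q \<in> loc_span b \<Longrightarrow> R \<in> loc_span b \<Longrightarrow> (\<lambda>g. Q g - R g) \<in> loc_span b"
  using loc_span_add[OF _ loc_span_uminus, of Q b R] by simp

lemma loc_span_closed:
  assumes "Q \<in> loc_span b" and "(\<lambda>_. 0) \<in> X" and "\<And>Q R. Q \<in> X \<Longrightarrow> R \<in> X \<Longrightarrow> (\<lambda>g. Q g + R g) \<in> X"
    and "\<And>a I. (\<lambda>g. a * b I g) \<in> X"
  shows "Q \<in> X"
  using assms(1) by (induction Q rule: loc_span.induct) (auto intro: assms)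

lemma loc_span_coeffs:
  assumes "Q \<in> loc_span b"
  shows "\<exists>p. finite {I. p I \<noteq> 0} \<and> (\<forall>g. Q g = (\<Sum>I | p I \<noteq> 0. p I * b I g))"
  using assms
proof (induction Q rule: loc_span.induct)
  case zero
  show ?case by (rule exI[of _ "\<lambda>_. 0"]) simp
next
  case (add_term Q a I)
  then obtain p where p: "finite {I. p I \<noteq> 0}" "\<And>g. Q g = (\<Sum>I | p I \<noteq> 0. p I * b I g)" by blast
  let ?q = "\<lambda>J. p J + (if J = I then a else 0)"
  let ?S = "insert I {I. p I \<noteq> 0}"
  have "{J. ?q J \<noteq> 0} \<subseteq> ?S" by auto
  then have fin: "finite {J. ?q J \<noteq> 0}" using p(1) finite_subset by blast
  have "a * b I g + Q g = (\<Sum>J | ?q J \<noteq> 0. ?q J * b J g)" for g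
  proof -
    have "(\<Sum>J | ?q J \<noteq> 0. ?q J * b J g) = (\<Sum>J\<in>?S. ?q J * b J g)"
      by (rule sum.mono_neutral_left) (use p(1) in auto)
    also have "\<dots> = (\<Sum>J\<in>?S. p J * b J g) + (\<Sum>J\<in>?S. if J = I then a * b I g else 0)"
      by (subst sum.distrib[symmetric]) (auto intro!: sum.cong simp: distrib_right)
    also have "(\<Sum>J\<in>?S. if J = I then a * b I g else 0) = a * b I g"
      using p(1) by (simp add: sum.delta')
    also have "(\<Sum>J\<in>?S. p J * b J g) = Q g"
      unfolding p(2) by (rule sum.mono_neutral_right) (use p(1) in auto)
    finally show ?thesis by (simp add: add.commute)
  qed
  then show ?case using fin by (intro exI[of _ ?q]) simp
qed

section \<open>Standard and polarized monomials\<close>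

definition stdmono :: "('n::finite \<Rightarrow> 'd::finite mindex) \<Rightarrow> ('n, 'd) multiop" where
  "stdmono I g = (\<Prod>j\<in>UNIV. dx_power (I j) (g j))"

text \<open>d/dy_1 acts as the total derivative of the whole product, so its powers stand outside as
  \<open>dx_power\<close>. \<open>polarized_monomial_eq\<close> identifies this closed form with
  \<open>polarized_monomial\<close>.\<close>

definition polmono :: "('n::{finite,linorder} \<Rightarrow> 'd::finite mindex) \<Rightarrow> ('n, 'd) multiop" where
  "polmono I g = dx_power (I (Min UNIV)) (stdmono (I(Min UNIV := \<lambda>_. 0)) g)"

abbreviation incr :: "'d \<Rightarrow> 'd mindex \<Rightarrow> 'd mindex" where
  "incr i K \<equiv> K(i := Suc (K i))"

lemma total_deriv_prod:
  fixes h :: "'a \<Rightarrow> 'd::finite loc"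
  assumes "finite S"
  shows "total_deriv i (prod h S) = (\<Sum>j\<in>S. total_deriv i (h j) * prod h (S - {j}))"
  using assms
proof (induction S rule: finite_induct)
  case empty
  have "total_deriv i (1::'d loc) = 0"
    using total_deriv_mult[of i 1 1] by simp
  then show ?case by simp
next
  case (insert x S)
  have "(\<Sum>j\<in>S. total_deriv i (h j) * prod h (insert x S - {j})) = h x * (\<Sum>j\<in>S. total_deriv i (h j) * prod h (S - {j}))"
    unfolding sum_distrib_left
  proof (rule sum.cong)
    fix j assume "j \<in> S"
    then have "insert x S - {j} = insert x (S - {j})" using insert by auto
    then show "total_deriv i (h j) * prod h (insert x S - {j}) = h x * (total_deriv i (h j) * prod h (S - {j}))"
      using insert by simp
  qed simp
  then show ?case using insert by (simp add: total_deriv_mult)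
qed

lemma stdmono_slot: "stdmono I (slot_deriv j i g) = stdmono (I(j := incr i (I j))) g"
  unfolding stdmono_def slot_deriv_def by (rule prod.cong) (auto simp: dx_power_Suc')

lemma total_deriv_stdmono: "total_deriv i (stdmono I g) = (\<Sum>j\<in>UNIV. stdmono (I(j := incr i (I j))) g)"
proof -
  have "stdmono (I(j := incr i (I j))) g
      = total_deriv i (dx_power (I j) (g j)) * (\<Prod>l\<in>UNIV - {j}. dx_power (I l) (g l))" for j
    unfolding stdmono_def by (subst prod.remove[of _ j]) (auto simp: dx_power_Suc intro!: prod.cong)
  then show ?thesis unfolding stdmono_def[of I] by (simp add: total_deriv_prod)
qed

lemma total_deriv_polmono: "total_deriv i (polmono I g) = polmono (I(Min UNIV := incr i (I (Min UNIV)))) g"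
  by (simp add: polmono_def dx_power_Suc)

section \<open>Multidifferential operators in total derivatives\<close>

definition MDO :: "('n::finite, 'd::finite) multiop set" where
  "MDO = loc_span stdmono"

text \<open>These are the coefficients C_I of the normal form. The first index is overwritten
  instead of constrained, so that the family stays indexed by a whole type; repeated generators do
  not change the span.\<close>

definition MDO0 :: "('n::{finite,linorder}, 'd::finite) multiop set" where
  "MDO0 = loc_span (\<lambda>I. stdmono (I(Min UNIV := \<lambda>_. 0)))"

lemmas MDO_intros = loc_span.zero[of stdmono, folded MDO_def] loc_span_add[of _ stdmono, folded MDO_def]
  loc_span_mult[of _ stdmono, folded MDO_def] loc_span_sum[of _ _ stdmono, folded MDO_def]
  loc_span_scaleR[of _ stdmono, folded MDO_def] loc_span_uminus[of _ stdmono, folded MDO_def]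
  loc_span_diff[of _ stdmono, folded MDO_def] loc_span_base[of stdmono, folded MDO_def]

lemmas MDO0_intros = loc_span.zero[of "\<lambda>I. stdmono (I(Min UNIV := \<lambda>_. 0))", folded MDO0_def]
  loc_span_add[of _ "\<lambda>I. stdmono (I(Min UNIV := \<lambda>_. 0))", folded MDO0_def]
  loc_span_mult[of _ "\<lambda>I. stdmono (I(Min UNIV := \<lambda>_. 0))", folded MDO0_def]
  loc_span_sum[of _ _ "\<lambda>I. stdmono (I(Min UNIV := \<lambda>_. 0))", folded MDO0_def]
  loc_span_scaleR[of _ "\<lambda>I. stdmono (I(Min UNIV := \<lambda>_. 0))", folded MDO0_def]
  loc_span_base[of "\<lambda>I. stdmono (I(Min UNIV := \<lambda>_. 0))", folded MDO0_def]

lemma MDO0_imp_MDO: "Q \<in> MDO0 \<Longrightarrow> Q \<in> MDO"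
  unfolding MDO0_def by (erule loc_span_closed) (auto intro: MDO_intros)

lemma MDO_total_deriv:
  assumes "Q \<in> MDO" shows "(\<lambda>g. total_deriv i (Q g)) \<in> MDO"
proof -
  have "Q \<in> {Q. (\<lambda>g. total_deriv i (Q g)) \<in> MDO}"
    using assms unfolding MDO_def
    by (rule loc_span_closed)
      (auto simp: total_deriv_add total_deriv_mult total_deriv_stdmono simp flip: MDO_def intro!: MDO_intros)
  then show ?thesis by simp
qed

lemma MDO_dx_power: "Q \<in> MDO \<Longrightarrow> (\<lambda>g. dx_power K (Q g)) \<in> MDO"
  by (induction K rule: mindex_induct) (simp_all add: dx_power_Suc MDO_total_deriv)

lemma MDO_slot:
  assumes "Q \<in> MDO" shows "Q \<circ> slot_deriv j i \<in> MDO"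
proof -
  have "Q \<in> {Q. (\<lambda>g. Q (slot_deriv j i g)) \<in> MDO}"
    using assms unfolding MDO_def
    by (rule loc_span_closed) (auto simp: stdmono_slot simp flip: MDO_def intro!: MDO_intros)
  then show ?thesis by (simp add: comp_def)
qed

lemma loc_span_polmono_imp_MDO: "Q \<in> loc_span polmono \<Longrightarrow> Q \<in> MDO"
proof (erule loc_span_closed)
  have "polmono I \<in> MDO" for I :: "'a \<Rightarrow> 'b mindex"
    using MDO_dx_power[OF MDO_intros(8), of "I (Min UNIV)" "I(Min UNIV := \<lambda>_. 0)"]
    by (simp add: polmono_def[abs_def])
  then show "(\<lambda>g. a * polmono I g) \<in> MDO" for a and I :: "'a \<Rightarrow> 'b mindex"
    by (rule MDO_intros)
qed (auto intro: MDO_intros)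

lemma loc_span_polmono_total_deriv:
  assumes "Q \<in> loc_span polmono" shows "(\<lambda>g. total_deriv i (Q g)) \<in> loc_span polmono"
proof -
  have "Q \<in> {Q. (\<lambda>g. total_deriv i (Q g)) \<in> loc_span polmono}"
    using assms
    by (rule loc_span_closed)
      (auto simp: total_deriv_add total_deriv_mult total_deriv_polmono
        intro!: loc_span.zero loc_span_add loc_span_mult loc_span_base)
  then show ?thesis by simp
qed

text \<open>\<open>d/dx\<^sub>1 = d/dy\<^sub>1 - \<Sum>\<^sub>j d/dy\<^sub>j\<close> lowers the order in the first slot.\<close>

lemma stdmono_in_loc_span_polmono: "stdmono I \<in> loc_span polmono"
proof -
  let ?m = "Min UNIV"
  have "\<forall>I :: 'a \<Rightarrow> 'b mindex. I ?m = K \<longrightarrow> stdmono I \<in> loc_span polmono" for K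
  proof (induction K rule: mindex_induct)
    case zero
    show ?case
    proof (intro allI impI)
      fix I :: "'a \<Rightarrow> 'b mindex"
      assume "I ?m = (\<lambda>_. 0)"
      then have "I(?m := \<lambda>_. 0) = I" by (rule fun_upd_idem)
      with \<open>I ?m = (\<lambda>_. 0)\<close> have "stdmono I = polmono I"
        by (simp add: polmono_def fun_eq_iff[where f = "stdmono I"] del: fun_upd_apply)
      then show "stdmono I \<in> loc_span polmono" by (simp add: loc_span_base)
    qed
  next
    case (Suc K i)
    show ?case
    proof (intro allI impI)
      fix I :: "'a \<Rightarrow> 'b mindex"
      assume I: "I ?m = incr i K"
      define L where "L = I(?m := K)"
      have L: "L ?m = K" "L(?m := incr i (L ?m)) = I" using I by (auto simp: L_def fun_eq_iff)
      have "stdmono I = (\<lambda>g. total_deriv i (stdmono L g)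
          - (\<Sum>j\<in>UNIV - {?m}. stdmono (L(j := incr i (L j))) g))"
        unfolding total_deriv_stdmono by (subst sum.remove[of _ ?m]) (auto simp: L(2))
      also have "\<dots> \<in> loc_span polmono"
        using Suc.IH L
        by (intro loc_span_diff loc_span_sum loc_span_polmono_total_deriv) auto
      finally show "stdmono I \<in> loc_span polmono" .
    qed
  qed
  then show ?thesis by blast
qed

lemma MDO_imp_loc_span_polmono: "Q \<in> MDO \<Longrightarrow> Q \<in> loc_span polmono"
  unfolding MDO_def
  by (erule loc_span_closed)
    (auto intro: loc_span.zero loc_span_add loc_span_mult stdmono_in_loc_span_polmono)

section \<open>Integration by parts\<close>

text \<open>The analogue of exact top forms: integration by parts works modulo this set, and
  \<open>MDO0\<close> meets it only in 0 by \<open>MDO0_Div_trivial\<close>.\<close>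

definition Div :: "('n::finite, 'd::finite) multiop set" where
  "Div = {\<lambda>g. \<Sum>i\<in>UNIV. total_deriv i (B i g) |B. \<forall>i. B i \<in> MDO}"

lemma Div_zero: "(\<lambda>_. 0) \<in> Div"
  unfolding Div_def by (auto intro!: exI[of _ "\<lambda>_ _. 0"] MDO_intros)

lemma Div_add: "Q \<in> Div \<Longrightarrow> R \<in> Div \<Longrightarrow> (\<lambda>g. Q g + R g) \<in> Div"
proof -
  assume "Q \<in> Div" "R \<in> Div"
  then obtain B C where B: "\<forall>i. B i \<in> MDO" "Q = (\<lambda>g. \<Sum>i\<in>UNIV. total_deriv i (B i g))"
    and C: "\<forall>i. C i \<in> MDO" "R = (\<lambda>g. \<Sum>i\<in>UNIV. total_deriv i (C i g))"
    unfolding Div_def by blast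
  then show ?thesis unfolding Div_def
    by (auto intro!: exI[of _ "\<lambda>i g. B i g + C i g"] MDO_intros simp: total_deriv_add sum.distrib)
qed

lemma Div_uminus: "Q \<in> Div \<Longrightarrow> (\<lambda>g. - Q g) \<in> Div"
proof -
  assume "Q \<in> Div"
  then obtain B where B: "\<forall>i. B i \<in> MDO" "Q = (\<lambda>g. \<Sum>i\<in>UNIV. total_deriv i (B i g))"
    unfolding Div_def by blast
  then show ?thesis unfolding Div_def
    by (auto intro!: exI[of _ "\<lambda>i g. - B i g"] MDO_intros simp: total_deriv_minus sum_negf)
qed

lemma Div_sum: "(\<And>k. k \<in> S \<Longrightarrow> Q k \<in> Div) \<Longrightarrow> (\<lambda>g. \<Sum>k\<in>S. Q k g) \<in> Div"
  by (induction S rule: infinite_finite_induct) (auto intro: Div_zero Div_add)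

lemma Div_total_deriv: "Q \<in> MDO \<Longrightarrow> (\<lambda>g. total_deriv i (Q g)) \<in> Div"
  unfolding Div_def
proof (intro CollectI exI[of _ "\<lambda>k. if k = i then Q else (\<lambda>_. 0)"] conjI ext)
  show "total_deriv i (Q g) = (\<Sum>k\<in>UNIV. total_deriv k ((if k = i then Q else (\<lambda>_. 0)) g))" for g
    by (subst sum.remove[of _ i]) auto
qed (auto intro: MDO_intros)

lemma mabs_incr: "mabs (incr i K) = Suc (mabs K)"
  using mabs_decr[of "incr i K" i] by simp

lemma mabs_zero [simp]: "mabs (\<lambda>_. 0) = 0"
  by (simp add: mabs_def)

text \<open>Moving one D_i off the operator replaces \<open>a\<close> by
  \<open>total_deriv i a\<close>, so the induction on K keeps \<open>a\<close> arbitrary.\<close>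

lemma integration_by_parts:
  assumes "M \<in> MDO"
  shows "(\<lambda>g. a * dx_power K (M g) - (-1) ^ mabs K * dx_power K a * M g) \<in> Div"
proof (induction K arbitrary: a rule: mindex_induct)
  case zero
  show ?case by (simp add: Div_zero)
next
  case (Suc K i)
  have "(\<lambda>g. total_deriv i (a * dx_power K (M g))
      + - (total_deriv i a * dx_power K (M g) - (-1) ^ mabs K * dx_power K (total_deriv i a) * M g)) \<in> Div"
    by (intro Div_add Div_total_deriv Div_uminus Suc.IH MDO_intros MDO_dx_power assms)
  then show ?case
    by (simp add: total_deriv_mult mabs_incr algebra_simps dx_power_commute1
        dx_power_Suc del: fun_upd_apply)
qed

section \<open>The normal form with total derivatives on the left\<close>

text \<open>No rule multiplies by a coefficient: coefficients sit inside the \<open>MDO0\<close>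
  operators only, to the right of all D_i.\<close>

inductive_set left_span :: "('n::{finite,linorder}, 'd::finite) multiop set" where
  base: "Q \<in> MDO0 \<Longrightarrow> Q \<in> left_span"
| add: "Q \<in> left_span \<Longrightarrow> R \<in> left_span \<Longrightarrow> (\<lambda>g. Q g + R g) \<in> left_span"
| deriv: "Q \<in> left_span \<Longrightarrow> (\<lambda>g. total_deriv i (Q g)) \<in> left_span"

text \<open>The identity a D_i Q = D_i (a Q) - (D_i a) Q pushes a coefficient through the
  derivatives.\<close>

lemma left_span_mult: "Q \<in> left_span \<Longrightarrow> (\<lambda>g. a * Q g) \<in> left_span"
proof (induction Q arbitrary: a rule: left_span.induct)
  case (base Q)
  then show ?case by (intro left_span.base MDO0_intros)
next
  case (add Q R)
  then show ?case using left_span.add[OF add.IH(1)[of a] add.IH(2)[of a]] by (simp add: distrib_left)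
next
  case (deriv Q i)
  have "(\<lambda>g. total_deriv i (a * Q g) + (- total_deriv i a) * Q g) \<in> left_span"
    by (intro left_span.add left_span.deriv deriv.IH)
  then show ?case by (simp add: total_deriv_mult algebra_simps)
qed

lemma MDO_imp_left_span:
  assumes "Q \<in> MDO" shows "Q \<in> left_span"
  using MDO_imp_loc_span_polmono[OF assms]
proof (rule loc_span_closed)
  have "(\<lambda>g. dx_power K (stdmono (I(Min UNIV := \<lambda>_. 0)) g)) \<in> left_span"
    for K :: "'b mindex" and I :: "'a \<Rightarrow> 'b mindex"
    by (induction K rule: mindex_induct)
      (simp_all add: dx_power_Suc left_span.deriv left_span.base MDO0_intros del: fun_upd_apply)
  then show "(\<lambda>g. a * polmono I g) \<in> left_span" for a and I :: "'a \<Rightarrow> 'b mindex"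
    unfolding polmono_def by (rule left_span_mult)
qed (auto intro: left_span.add left_span.base MDO0_intros)

text \<open>The value of the sum of all D^I o C_I at a fixed argument g, with c I = C_I(g). Working
  with values places the later algebra in a vector space; the truncation at order n makes the sum
  finite.\<close>

definition nform :: "nat \<Rightarrow> ('d::finite mindex \<Rightarrow> 'd loc) \<Rightarrow> 'd loc" where
  "nform n c = (\<Sum>I | mabs I \<le> n. dx_power I (c I))"

lemma nform_add: "nform n (\<lambda>I. c I + d I) = nform n c + nform n d"
  by (simp add: nform_def linear_add[OF linear_dx_power] sum.distrib)

lemma nform_scaleR: "nform n (\<lambda>I. r *\<^sub>R c I) = r *\<^sub>R nform n c"
  by (simp add: nform_def linear_scale[OF linear_dx_power] scaleR_sum_right)

lemma nform_zero [simp]: "nform n (\<lambda>_. 0) = 0"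
  by (simp add: nform_def linear_0[OF linear_dx_power])

lemma nform_sum: "nform n (\<lambda>I. \<Sum>k\<in>S. c k I) = (\<Sum>k\<in>S. nform n (c k))"
  by (induction S rule: infinite_finite_induct) (auto simp: nform_add)

lemma nform_mono:
  assumes "n \<le> m" "\<And>I. n < mabs I \<Longrightarrow> c I = 0"
  shows "nform m c = nform n c"
  unfolding nform_def
  by (rule sum.mono_neutral_right)
    (use assms in \<open>auto simp: finite_mabs_le linear_0[OF linear_dx_power] not_le\<close>)

lemma sum_mabs_shift:
  "(\<Sum>K | mabs K \<le> Suc n. if 0 < K i then F K else 0) = (\<Sum>I | mabs I \<le> n. F (incr i I))"
proof -
  have "(\<Sum>K | mabs K \<le> Suc n. if 0 < K i then F K else 0) = (\<Sum>K | mabs K \<le> Suc n \<and> 0 < K i. F K)"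
    by (subst sum.inter_filter[symmetric]) (auto simp: finite_mabs_le)
  also have "\<dots> = (\<Sum>I | mabs I \<le> n. F (incr i I))"
    by (rule sum.reindex_bij_witness[of _ "incr i" "\<lambda>K. K(i := K i - 1)"])
      (auto simp: mabs_incr dest: mabs_decr)
  finally show ?thesis .
qed

text \<open>Multiplication by the i-th variable, when \<open>c\<close> is read as the coefficients
  of a polynomial in the D_i.\<close>

definition shift :: "'d \<Rightarrow> ('d mindex \<Rightarrow> 'v::zero) \<Rightarrow> 'd mindex \<Rightarrow> 'v" where
  "shift i c I = (if 0 < I i then c (I(i := I i - 1)) else 0)"

lemma total_deriv_nform: "total_deriv i (nform n c) = nform (Suc n) (shift i c)"
proof -
  have "nform (Suc n) (shift i c)
      = (\<Sum>K | mabs K \<le> Suc n. if 0 < K i then dx_power K (c (K(i := K i - 1))) else 0)"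
    unfolding nform_def shift_def
    by (rule sum.cong) (auto simp: linear_0[OF linear_dx_power])
  also have "\<dots> = (\<Sum>I | mabs I \<le> n. dx_power (incr i I) (c I))"
    by (subst sum_mabs_shift) simp
  finally show ?thesis by (simp add: nform_def total_deriv_sum dx_power_Suc)
qed

text \<open>The vanishing of \<open>C I\<close> above order n is part of the claim, so that
  different truncations can be raised to a common one by \<open>nform_mono\<close>.\<close>

lemma nform_exists:
  assumes "Q \<in> MDO"
  shows "\<exists>n C. (\<forall>I. C I \<in> MDO0) \<and> (\<forall>I g. n < mabs I \<longrightarrow> C I g = 0) \<and> (\<forall>g. Q g = nform n (\<lambda>I. C I g))"
  using MDO_imp_left_span[OF assms]
proof (induction Q rule: left_span.induct)
  case (base Q)
  have mabs0: "mabs I = 0 \<longleftrightarrow> I = (\<lambda>_. 0)" for I :: "'b mindex" by (auto simp: mabs_def)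
  show ?case
    by (intro exI[of _ 0] exI[of _ "\<lambda>I. if mabs I = 0 then Q else (\<lambda>_. 0)"])
      (auto simp: nform_def mabs0 base intro!: MDO0_intros)
next
  case (add Q R)
  then obtain n C m E where C: "\<forall>I. C I \<in> MDO0" "\<And>I g. n < mabs I \<Longrightarrow> C I g = 0" "\<And>g. Q g = nform n (\<lambda>I. C I g)"
    and E: "\<forall>I. E I \<in> MDO0" "\<And>I g. m < mabs I \<Longrightarrow> E I g = 0" "\<And>g. R g = nform m (\<lambda>I. E I g)"
    by blast
  have "Q g + R g = nform (max n m) (\<lambda>I. C I g + E I g)" for g
    unfolding nform_add C(3) E(3)
    using nform_mono[of n "max n m" "\<lambda>I. C I g"] nform_mono[of m "max n m" "\<lambda>I. E I g"] C(2) E(2) by simp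
  then show ?case using C E
    by (intro exI[of _ "max n m"] exI[of _ "\<lambda>I g. C I g + E I g"]) (auto intro!: MDO0_intros)
next
  case (deriv Q i)
  then obtain n C where C: "\<forall>I. C I \<in> MDO0" "\<And>I g. n < mabs I \<Longrightarrow> C I g = 0" "\<And>g. Q g = nform n (\<lambda>I. C I g)"
    by blast
  have "(\<lambda>g. shift i (\<lambda>I. C I g) I) \<in> MDO0" for I
    using C(1) by (cases "0 < I i") (simp_all add: shift_def MDO0_intros del: fun_upd_apply)
  moreover have "shift i (\<lambda>I. C I g) I = 0" if "Suc n < mabs I" for I g
    using that mabs_decr[of I i] by (auto simp: shift_def C(2))
  ultimately show ?case
    by (intro exI[of _ "Suc n"] exI[of _ "\<lambda>I g. shift i (\<lambda>I. C I g) I"]) (auto simp: C(3) total_deriv_nform)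
qed

text \<open>The first slot enters undifferentiated. This linearity over local functions supplies the
  free factor \<open>a\<close> in \<open>nform_faithful\<close>.\<close>

lemma MDO0_linear_first:
  assumes "Q \<in> MDO0"
  shows "Q (g(Min UNIV := a * g (Min UNIV))) = a * Q g"
proof -
  have "Q \<in> {Q. Q (g(Min UNIV := a * g (Min UNIV))) = a * Q g}"
    using assms unfolding MDO0_def
  proof (rule loc_span_closed)
    have "stdmono (I(Min UNIV := \<lambda>_. 0)) (g(Min UNIV := a * g (Min UNIV))) = a * stdmono (I(Min UNIV := \<lambda>_. 0)) g" for I
      unfolding stdmono_def
      by (subst (1 2) prod.remove[of _ "Min UNIV"]) (auto simp: mult.assoc intro!: arg_cong2[of _ _ _ _ "(*)"] prod.cong)
    then show "(\<lambda>g. c * stdmono (I(Min UNIV := \<lambda>_. 0)) g) \<in> {Q. Q (g(Min UNIV := a * g (Min UNIV))) = a * Q g}" for c I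
      by (simp add: mult.left_commute)
  qed (auto simp: distrib_left)
  then show ?thesis by simp
qed

text \<open>Commutators with the coordinates \<open>x\<^sup>i\<close> lower the order of a differential operator and,
  applied to \<open>\<Sum>\<^sub>I D\<^sup>I \<circ> v\<^sub>I\<close>, act on the coefficients without loss of information.\<close>

lemma nform_faithful:
  assumes "\<And>a. nform n (\<lambda>I. a * v I) = 0" "mabs I \<le> n"
  shows "v I = 0"
  using assms
proof (induction n arbitrary: v I)
  case 0
  have "{I :: 'a mindex. mabs I \<le> 0} = {\<lambda>_. 0}" "I = (\<lambda>_. 0)"
    using 0(2) by (auto simp: mabs_def)
  then show ?case using 0(1)[of 1] by (simp add: nform_def)
next
  case (Suc n)
  have step: "real (Suc (I i)) *\<^sub>R v (incr i I) = 0" if "mabs I \<le> n" for i I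
  proof -
    have "nform n (\<lambda>I. a * (real (Suc (I i)) *\<^sub>R v (incr i I))) = 0" for a
    proof -
      have "nform n (\<lambda>I. a * (real (Suc (I i)) *\<^sub>R v (incr i I)))
          = (\<Sum>I | mabs I \<le> n. real (Suc (I i)) *\<^sub>R dx_power I (a * v (incr i I)))"
        by (simp add: nform_def linear_scale[OF linear_dx_power])
      also have "\<dots> = (\<Sum>K | mabs K \<le> Suc n. if 0 < K i then real (K i) *\<^sub>R dx_power (K(i := K i - 1)) (a * v K) else 0)"
        by (subst sum_mabs_shift) simp
      \<comment> \<open>Each summand is the commutator of D^K with x^i, by
        \<open>dx_power_coord\<close>. Next, x^i is absorbed into the arbitrary \<open>a\<close>, so
        that both resulting sums vanish by hypothesis.\<close>
      also have "\<dots> = (\<Sum>K | mabs K \<le> Suc n. dx_power K (coordinate (Base i) * (a * v K))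
          - coordinate (Base i) * dx_power K (a * v K))"
        unfolding dx_power_coord by (rule sum.cong) auto
      also have "\<dots> = nform (Suc n) (\<lambda>I. (coordinate (Base i) * a) * v I)
          - coordinate (Base i) * nform (Suc n) (\<lambda>I. a * v I)"
        unfolding sum_subtractf nform_def sum_distrib_left by (simp add: mult.assoc)
      finally show ?thesis by (simp add: Suc.prems)
    qed
    then show ?thesis using Suc.IH[of "\<lambda>I. real (Suc (I i)) *\<^sub>R v (incr i I)"] that by simp
  qed
  have nz: "v K = 0" if "0 < K i" "mabs K \<le> Suc n" for K i
    using step[of "K(i := K i - 1)" i] mabs_decr[of K i] that by simp
  show ?case
  proof (cases "I = (\<lambda>_. 0)")
    case False
    then obtain i where "0 < I i" by (auto simp: fun_eq_iff)
    then show ?thesis using nz Suc.prems by blast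
  next
    case True
    have "nform (Suc n) v = nform 0 v"
      unfolding nform_def
    proof (rule sum.mono_neutral_right)
      show "\<forall>K\<in>{I. mabs I \<le> Suc n} - {I. mabs I \<le> 0}. dx_power K (v K) = 0"
      proof
        fix K assume K: "K \<in> {I :: 'a mindex. mabs I \<le> Suc n} - {I. mabs I \<le> 0}"
        then obtain i where "0 < K i" by (auto simp: mabs_def)
        then have "v K = 0" using nz K by blast
        then show "dx_power K (v K) = 0" by (simp add: linear_0[OF linear_dx_power])
      qed
    qed (auto simp: finite_mabs_le)
    moreover have "{I :: 'a mindex. mabs I \<le> 0} = {\<lambda>_. 0}" by (auto simp: mabs_def)
    ultimately show ?thesis using Suc.prems(1)[of 1] True by (simp add: nform_def)
  qed
qed

lemma nform_unique:
  assumes "\<And>I. C I \<in> MDO0" "\<And>g. nform n (\<lambda>I. C I g) = 0" "mabs I \<le> n"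
  shows "C I g = 0"
proof (rule nform_faithful[OF _ assms(3)])
  fix a
  show "nform n (\<lambda>I. a * C I g) = 0"
    using assms(2)[of "g(Min UNIV := a * g (Min UNIV))"] by (simp add: MDO0_linear_first assms(1))
qed

text \<open>In normal form a divergence has no constant term, since every \<open>shift i\<close> is
  0 at the zero index, whereas Q is its own constant term. Uniqueness of the coefficients forces Q =
  0.\<close>

lemma MDO0_Div_trivial:
  assumes "Q \<in> MDO0" "Q \<in> Div"
  shows "Q g = 0"
proof -
  obtain B where B: "\<And>i. B i \<in> MDO" "\<And>g. Q g = (\<Sum>i\<in>UNIV. total_deriv i (B i g))"
    using assms(2) unfolding Div_def by auto
  obtain n C where C: "\<And>i I. C i I \<in> MDO0" "\<And>i I g. n i < mabs I \<Longrightarrow> C i I g = 0"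
    "\<And>i g. B i g = nform (n i) (\<lambda>I. C i I g)"
    using nform_exists[OF B(1)] by metis
  \<comment> \<open>A common truncation for all directions i; applying D_i raises it by one, hence
    \<open>Suc m\<close> below.\<close>
  define m where "m = Max (range n)"
  have Bm: "B i g = nform m (\<lambda>I. C i I g)" for i g
    unfolding C(3) by (rule nform_mono[symmetric]) (auto simp: m_def C(2))
  define E where "E I g = (if I = (\<lambda>_. 0) then Q g else 0) - (\<Sum>i\<in>UNIV. shift i (\<lambda>I. C i I g) I)" for I g
  have "E I \<in> MDO0" for I
  proof -
    have "(\<lambda>g. shift i (\<lambda>I. C i I g) I) \<in> MDO0" for i
      using C(1) by (cases "0 < I i") (simp_all add: shift_def MDO0_intros del: fun_upd_apply)
    moreover have "(\<lambda>g. if I = (\<lambda>_. 0) then Q g else 0) \<in> MDO0"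
      using assms(1) by (cases "I = (\<lambda>_. 0)") (simp_all add: MDO0_intros)
    ultimately have "(\<lambda>g. (if I = (\<lambda>_. 0) then Q g else 0) + (-1) *\<^sub>R (\<Sum>i\<in>UNIV. shift i (\<lambda>I. C i I g) I)) \<in> MDO0"
      by (intro MDO0_intros)
    then show ?thesis by (simp add: E_def[abs_def])
  qed
  moreover have "nform (Suc m) (\<lambda>I. E I g) = 0" for g
  proof -
    have "nform (Suc m) (\<lambda>I. (if I = (\<lambda>_. 0) then Q g else 0)) = Q g"
      unfolding nform_def
      by (subst sum.remove[of _ "\<lambda>_. 0"])
        (auto simp: finite_mabs_le linear_0[OF linear_dx_power] intro!: sum.neutral)
    moreover have "nform (Suc m) (\<lambda>I. (-1) *\<^sub>R (\<Sum>i\<in>UNIV. shift i (\<lambda>I. C i I g) I)) = - Q g"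
      unfolding nform_scaleR nform_sum B(2) Bm total_deriv_nform by simp
    ultimately show ?thesis
      using nform_add[of "Suc m" "\<lambda>I. (if I = (\<lambda>_. 0) then Q g else 0)" "\<lambda>I. (-1) *\<^sub>R (\<Sum>i\<in>UNIV. shift i (\<lambda>I. C i I g) I)"]
      by (simp add: E_def)
  qed
  ultimately have "E (\<lambda>_. 0) g = 0" by (rule nform_unique) simp
  then show ?thesis by (simp add: E_def shift_def)
qed

section \<open>Detection by functions of the base coordinates\<close>

text \<open>Let K have least total order among the indices with nonzero coefficient, and test on x^K
  / K! slot by slot. Only indices I \<le> K survive, minimality leaves I = K, and the value is
  \<open>p K\<close>.\<close>

lemma MDO_eq_0_if_base:
  assumes Q: "Q \<in> MDO" and base: "\<And>g. (\<And>j J. pd (Fibre J) (g j) = 0) \<Longrightarrow> Q g = 0"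
  shows "Q g = 0"
proof -
  obtain p where p: "finite {I. p I \<noteq> 0}" "\<And>g. Q g = (\<Sum>I | p I \<noteq> 0. p I * stdmono I g)"
    using loc_span_coeffs[OF Q[unfolded MDO_def]] by blast
  have "{I. p I \<noteq> 0} = {}"
  proof (rule ccontr)
    let ?size = "\<lambda>I. \<Sum>j\<in>UNIV. mabs (I j)"
    assume "{I. p I \<noteq> 0} \<noteq> {}"
    then obtain K where K: "p K \<noteq> 0" "\<And>I. p I \<noteq> 0 \<Longrightarrow> ?size K \<le> ?size I"
      using ex_has_least_nat[of "\<lambda>I. p I \<noteq> 0" _ ?size] by blast
    have "total_deriv i (1 :: 'b loc) = 0" for i using total_deriv_mult[of i 1 1] by simp
    moreover have "pd c (1 :: 'b loc) = 0" for c using pd_mult[of c 1 1] by simp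
    \<comment> \<open>The property \<open>P\<close> is independence of all u_J, which makes
      \<open>base\<close> applicable to the test functions.\<close>
    ultimately have "\<exists>w. (\<forall>J. pd (Fibre J) w = 0) \<and> dx_power (K j) w = 1 \<and> (\<forall>I. \<not> I \<le> K j \<longrightarrow> dx_power I w = 0)" for j
      using dx_test_function_exists[of "\<lambda>w. \<forall>J. pd (Fibre J) w = 0" "K j"]
      by (fastforce simp: pd_scaleR pd_mult pd_coordinate dest: spec[of _ 1])
    then obtain w where w: "\<And>j J. pd (Fibre J) (w j) = 0" "\<And>j. dx_power (K j) (w j) = 1"
      "\<And>j I. \<not> I \<le> K j \<Longrightarrow> dx_power I (w j) = 0" by metis
    have "p I * stdmono I w = (if I = K then p K else 0)" if I: "p I \<noteq> 0" for I
    proof (cases "I \<le> K")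
      case False
      then obtain j where "\<not> I j \<le> K j" by (auto simp: le_fun_def)
      then have "stdmono I w = 0" unfolding stdmono_def using w(3) by (auto intro!: prod_zero)
      then show ?thesis using False by auto
    next
      case True
      have "I = K"
      proof (rule ccontr)
        assume "I \<noteq> K"
        then obtain j i where "I j i \<noteq> K j i" by (metis ext)
        then have lt: "I j i < K j i" using True by (simp add: le_fun_def le_neq_implies_less)
        have le: "mabs (I j) \<le> mabs (K j)" for j
          unfolding mabs_def using True by (intro sum_mono) (simp add: le_fun_def)
        have "mabs (I j) < mabs (K j)"
          unfolding mabs_def using True lt by (intro sum_strict_mono_ex1) (auto simp: le_fun_def)
        then have "?size I < ?size K" using le by (intro sum_strict_mono_ex1) auto
        then show False using K(2)[OF I] by simp
      qed
      then show ?thesis by (simp add: stdmono_def w(2))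
    qed
    then have "Q w = (\<Sum>I | p I \<noteq> 0. if I = K then p K else 0)"
      unfolding p(2) by (intro sum.cong) auto
    also have "\<dots> = p K" using p(1) K(1) by simp
    finally show False using base[of w] w(1) K(1) by simp
  qed
  then show ?thesis unfolding p(2) by (simp only: sum.empty)
qed

section \<open>The Koszul complex\<close>

text \<open>For i in \<epsilon>, the sign with which dx^i wedged with the basis form of
  \<open>\<epsilon> - {i}\<close> gives that of \<epsilon>.\<close>

definition wsign :: "'d::{finite,linorder} \<Rightarrow> 'd set \<Rightarrow> real" where
  "wsign i \<epsilon> = (-1) ^ card {k\<in>\<epsilon>. k < i}"

lemma wsign_square [simp]: "wsign i \<epsilon> * wsign i \<epsilon> = 1"
  by (simp add: wsign_def flip: power_mult_distrib)

text \<open>This expresses that wedging with one dx anticommutes with contraction along another.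
  Exactly one of the counted sets changes by one element; which one depends on the order of i and
  k.\<close>

lemma wsign_exchange:
  assumes "i \<in> \<epsilon>" "k \<notin> \<epsilon>"
  shows "wsign i \<epsilon> * wsign k (insert k (\<epsilon> - {i})) = - (wsign k (insert k \<epsilon>) * wsign i (insert k \<epsilon>))"
proof (cases "k < i")
  case True
  have "{l\<in>insert k \<epsilon>. l < i} = insert k {l\<in>\<epsilon>. l < i}" using True by auto
  moreover have "{l\<in>insert k (\<epsilon> - {i}). l < k} = {l\<in>insert k \<epsilon>. l < k}" using True by auto
  ultimately show ?thesis using assms by (simp add: wsign_def)
next
  case False
  then have ik: "i < k" using assms by (metis linorder_neqE)
  have "{l\<in>insert k \<epsilon>. l < k} = insert i {l\<in>insert k (\<epsilon> - {i}). l < k}" using ik assms by auto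
  moreover have "{l\<in>insert k \<epsilon>. l < i} = {l\<in>\<epsilon>. l < i}" using ik by auto
  ultimately show ?thesis by (simp add: wsign_def)
qed

text \<open>The wedge product with the sum of all D_i dx^i, read on coefficients, where D_i acts as
  \<open>shift i\<close>.\<close>

definition koszul_d :: "('d::{finite,linorder} set \<Rightarrow> 'd mindex \<Rightarrow> 'v::real_vector) \<Rightarrow> 'd set \<Rightarrow> 'd mindex \<Rightarrow> 'v" where
  "koszul_d c \<epsilon> I = (\<Sum>i\<in>\<epsilon>. wsign i \<epsilon> *\<^sub>R shift i (c (\<epsilon> - {i})) I)"

text \<open>The contracting homotopy \<open>\<Sum>\<^sub>i \<partial>/\<partial>D\<^sub>i \<circ> \<iota>\<^sub>i\<close>, normalised by the eigenvalue
  \<open>|I| + N - |\<epsilon>|\<close> of its anticommutator with the Koszul differential.\<close>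

definition koszul_h :: "('d::{finite,linorder} set \<Rightarrow> 'd mindex \<Rightarrow> 'v::real_vector) \<Rightarrow> 'd set \<Rightarrow> 'd mindex \<Rightarrow> 'v" where
  "koszul_h c \<epsilon> I = (1 / (real (mabs I) + real CARD('d) - real (card \<epsilon>))) *\<^sub>R
     (\<Sum>k\<in>-\<epsilon>. (wsign k (insert k \<epsilon>) * real (Suc (I k))) *\<^sub>R c (insert k \<epsilon>) (incr k I))"

text \<open>Mixed terms, with i in \<epsilon> and k outside, occur in dh and in hd with opposite
  signs. The diagonal terms contribute \<open>I i\<close> for i in \<epsilon> and
  \<open>I k + 1\<close> for k outside, together |I| + N - |\<epsilon>|. Since \<open>c\<close> is
  closed, only dh remains.\<close>

lemma koszul_homotopy:
  fixes c :: "'d::{finite,linorder} set \<Rightarrow> 'd mindex \<Rightarrow> 'v::real_vector"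
  assumes closed: "\<And>\<epsilon> I. koszul_d c \<epsilon> I = 0"
    and W: "real (mabs I) + real CARD('d) - real (card \<epsilon>) \<noteq> 0"
  shows "koszul_d (koszul_h c) \<epsilon> I = c \<epsilon> I"
proof -
  let ?W = "real (mabs I) + real CARD('d) - real (card \<epsilon>)"
  define T where "T i k = (if 0 < I i then (wsign i \<epsilon> * wsign k (insert k (\<epsilon> - {i})) * real (Suc (I k)))
      *\<^sub>R c (insert k (\<epsilon> - {i})) (incr k (I(i := I i - 1))) else 0)" for i k
  have 1: "?W *\<^sub>R (wsign i \<epsilon> *\<^sub>R shift i (koszul_h c (\<epsilon> - {i})) I)
      = real (I i) *\<^sub>R c \<epsilon> I + (\<Sum>k\<in>-\<epsilon>. T i k)" if i: "i \<in> \<epsilon>" for i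
  proof (cases "0 < I i")
    case True
    let ?K = "I(i := I i - 1)"
    \<comment> \<open>Removing i from \<epsilon> and lowering \<open>I i\<close> leaves the
      eigenvalue unchanged, so one normalising factor serves all terms.\<close>
    have eqW: "real (mabs ?K) + real CARD('d) - real (card (\<epsilon> - {i})) = ?W"
      using mabs_decr[of I i] True card_Suc_Diff1[of \<epsilon> i] i by simp
    have "?W *\<^sub>R koszul_h c (\<epsilon> - {i}) ?K
      = (\<Sum>k\<in>-(\<epsilon> - {i}). (wsign k (insert k (\<epsilon> - {i})) * real (Suc (?K k)))
          *\<^sub>R c (insert k (\<epsilon> - {i})) (incr k ?K))"
      unfolding koszul_h_def eqW using W by (simp del: fun_upd_apply)
    also have "-(\<epsilon> - {i}) = insert i (- \<epsilon>)" using i by auto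
    also have "(\<Sum>k\<in>insert i (- \<epsilon>). (wsign k (insert k (\<epsilon> - {i})) * real (Suc (?K k)))
          *\<^sub>R c (insert k (\<epsilon> - {i})) (incr k ?K))
      = (wsign i (insert i (\<epsilon> - {i})) * real (Suc (?K i))) *\<^sub>R c (insert i (\<epsilon> - {i})) (incr i ?K)
        + (\<Sum>k\<in>-\<epsilon>. (wsign k (insert k (\<epsilon> - {i})) * real (Suc (?K k)))
          *\<^sub>R c (insert k (\<epsilon> - {i})) (incr k ?K))"
      using i by (subst sum.insert) auto
    also have "insert i (\<epsilon> - {i}) = \<epsilon>" using i by auto
    also have "incr i ?K = I" using True by simp
    also have "Suc (?K i) = I i" using True by simp
    finally have "?W *\<^sub>R koszul_h c (\<epsilon> - {i}) ?K
      = (wsign i \<epsilon> * real (I i)) *\<^sub>R c \<epsilon> I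
        + (\<Sum>k\<in>-\<epsilon>. (wsign k (insert k (\<epsilon> - {i})) * real (Suc (?K k)))
          *\<^sub>R c (insert k (\<epsilon> - {i})) (incr k ?K))" .
    then have "wsign i \<epsilon> *\<^sub>R ?W *\<^sub>R koszul_h c (\<epsilon> - {i}) ?K
      = (wsign i \<epsilon> * wsign i \<epsilon> * real (I i)) *\<^sub>R c \<epsilon> I
        + (\<Sum>k\<in>-\<epsilon>. (wsign i \<epsilon> * wsign k (insert k (\<epsilon> - {i})) * real (Suc (?K k)))
          *\<^sub>R c (insert k (\<epsilon> - {i})) (incr k ?K))"
      by (simp add: scaleR_add_right scaleR_sum_right mult.assoc)
    also have "(\<Sum>k\<in>-\<epsilon>. (wsign i \<epsilon> * wsign k (insert k (\<epsilon> - {i})) * real (Suc (?K k)))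
          *\<^sub>R c (insert k (\<epsilon> - {i})) (incr k ?K)) = (\<Sum>k\<in>-\<epsilon>. T i k)"
      using i True by (intro sum.cong) (auto simp: T_def)
    finally show ?thesis using True by (simp add: shift_def mult.commute del: fun_upd_apply)
  qed (simp add: shift_def T_def)
  \<comment> \<open>Closedness at \<open>insert k \<epsilon>\<close> and \<open>incr k I\<close>
    makes the left side 0; this evaluates the sum of the mixed terms.\<close>
  have 2: "(wsign k (insert k \<epsilon>) * real (Suc (I k))) *\<^sub>R koszul_d c (insert k \<epsilon>) (incr k I)
      = real (Suc (I k)) *\<^sub>R c \<epsilon> I - (\<Sum>i\<in>\<epsilon>. T i k)" if k: "k \<in> - \<epsilon>" for k
  proof -
    have "koszul_d c (insert k \<epsilon>) (incr k I) = wsign k (insert k \<epsilon>) *\<^sub>R c \<epsilon> I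
        + (\<Sum>i\<in>\<epsilon>. wsign i (insert k \<epsilon>) *\<^sub>R shift i (c (insert k \<epsilon> - {i})) (incr k I))"
      using k by (simp add: koszul_d_def shift_def Diff_insert_absorb)
    then have "(wsign k (insert k \<epsilon>) * real (Suc (I k))) *\<^sub>R koszul_d c (insert k \<epsilon>) (incr k I)
      = (wsign k (insert k \<epsilon>) * wsign k (insert k \<epsilon>) * real (Suc (I k))) *\<^sub>R c \<epsilon> I
        + (\<Sum>i\<in>\<epsilon>. (wsign k (insert k \<epsilon>) * wsign i (insert k \<epsilon>) * real (Suc (I k)))
            *\<^sub>R shift i (c (insert k \<epsilon> - {i})) (incr k I))"
      by (simp add: scaleR_add_right scaleR_sum_right mult_ac)
    also have "(\<Sum>i\<in>\<epsilon>. (wsign k (insert k \<epsilon>) * wsign i (insert k \<epsilon>) * real (Suc (I k)))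
            *\<^sub>R shift i (c (insert k \<epsilon> - {i})) (incr k I)) = (\<Sum>i\<in>\<epsilon>. - T i k)"
    proof (rule sum.cong)
      fix i assume i: "i \<in> \<epsilon>"
      then have ne: "i \<noteq> k" using k by auto
      have "insert k \<epsilon> - {i} = insert k (\<epsilon> - {i})" using ne by auto
      moreover have "(incr k I)(i := incr k I i - 1) = incr k (I(i := I i - 1))"
        using ne by (simp add: fun_upd_twist)
      ultimately show "(wsign k (insert k \<epsilon>) * wsign i (insert k \<epsilon>) * real (Suc (I k)))
            *\<^sub>R shift i (c (insert k \<epsilon> - {i})) (incr k I) = - T i k"
        using ne wsign_exchange[OF i, of k] k by (simp add: shift_def T_def)
    qed simp
    finally show ?thesis by (simp add: sum_negf del: fun_upd_apply)
  qed
  have "?W *\<^sub>R koszul_d (koszul_h c) \<epsilon> I = (\<Sum>i\<in>\<epsilon>. real (I i) *\<^sub>R c \<epsilon> I) + (\<Sum>i\<in>\<epsilon>. \<Sum>k\<in>-\<epsilon>. T i k)"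
    using 1 by (simp add: koszul_d_def[of "koszul_h c"] scaleR_sum_right flip: sum.distrib)
  also have "(\<Sum>i\<in>\<epsilon>. \<Sum>k\<in>-\<epsilon>. T i k) = (\<Sum>k\<in>-\<epsilon>. real (Suc (I k)) *\<^sub>R c \<epsilon> I)"
  proof -
    have "(\<Sum>i\<in>\<epsilon>. T i k) = real (Suc (I k)) *\<^sub>R c \<epsilon> I" if "k \<in> -\<epsilon>" for k
      using 2[OF that] by (simp add: closed)
    then show ?thesis by (subst sum.swap) simp
  qed
  also have "(\<Sum>i\<in>\<epsilon>. real (I i) *\<^sub>R c \<epsilon> I) + (\<Sum>k\<in>-\<epsilon>. real (Suc (I k)) *\<^sub>R c \<epsilon> I)
      = ((\<Sum>i\<in>\<epsilon>. real (I i)) + (\<Sum>k\<in>-\<epsilon>. real (I k) + 1)) *\<^sub>R c \<epsilon> I"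
    by (simp add: scaleR_left.sum scaleR_left.add algebra_simps)
  also have "(\<Sum>i\<in>\<epsilon>. real (I i)) + (\<Sum>k\<in>-\<epsilon>. real (I k) + 1) = ?W"
  proof -
    have "(\<Sum>i\<in>\<epsilon>. real (I i)) + (\<Sum>k\<in>-\<epsilon>. real (I k)) = real (mabs I)"
      by (simp add: mabs_def sum.union_disjoint[symmetric] del: of_nat_sum flip: of_nat_sum of_nat_add)
    moreover have "real (card (- \<epsilon>)) = real CARD('d) - real (card \<epsilon>)"
      by (simp add: Compl_eq_Diff_UNIV card_Diff_subset of_nat_diff card_mono)
    ultimately show ?thesis by (simp add: sum.distrib)
  qed
  finally show ?thesis using W by simp
qed

text \<open>The differential of operator-valued forms: its value at \<open>f\<close> is the
  \<epsilon>-component of \<open>d_H\<close> applied to the form with components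
  \<open>\<omega> \<epsilon> f\<close>, as \<open>d_H_nth\<close> shows.\<close>

definition op_d :: "('d::{finite,linorder} set \<Rightarrow> ('n, 'd) multiop) \<Rightarrow> 'd set \<Rightarrow> ('n, 'd) multiop" where
  "op_d \<omega> \<epsilon> f = (\<Sum>i\<in>\<epsilon>. wsign i \<epsilon> *\<^sub>R total_deriv i (\<omega> (\<epsilon> - {i}) f))"

text \<open>The homotopy is applied to the coefficients of the normal form. At \<epsilon> it sees
  \<omega> only through the neighbours \<open>insert i \<epsilon>\<close>, whence the support
  clause.\<close>

lemma MDO_exact:
  fixes \<omega> :: "'d::{finite,linorder} set \<Rightarrow> ('n::{finite,linorder}, 'd) multiop"
  assumes \<omega>: "\<And>\<epsilon>. \<omega> \<epsilon> \<in> MDO" "\<omega> UNIV = (\<lambda>_. 0)" and closed: "\<And>\<epsilon>. op_d \<omega> \<epsilon> = (\<lambda>_. 0)"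
  shows "\<exists>\<eta>. (\<forall>\<epsilon>. \<eta> \<epsilon> \<in> MDO) \<and> op_d \<eta> = \<omega>
    \<and> (\<forall>\<epsilon>. (\<forall>i. i \<notin> \<epsilon> \<longrightarrow> \<omega> (insert i \<epsilon>) = (\<lambda>_. 0)) \<longrightarrow> \<eta> \<epsilon> = (\<lambda>_. 0))"
proof -
  \<comment> \<open>Zero components get zero coefficients, as the support clause and the treatment
    of the top degree require.\<close>
  have "\<exists>n C. (\<forall>I. C I \<in> MDO0) \<and> (\<forall>I g. n < mabs I \<longrightarrow> C I g = 0) \<and> (\<forall>g. \<omega> \<epsilon> g = nform n (\<lambda>I. C I g))
      \<and> (\<omega> \<epsilon> = (\<lambda>_. 0) \<longrightarrow> C = (\<lambda>_ _. 0))" for \<epsilon>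
  proof (cases "\<omega> \<epsilon> = (\<lambda>_. 0)")
    case True
    then show ?thesis by (intro exI[of _ 0] exI[of _ "\<lambda>_ _. 0"]) (simp add: MDO0_intros)
  next
    case False
    then show ?thesis using nform_exists[OF \<omega>(1)[of \<epsilon>]] by auto
  qed
  then obtain n C where C: "\<And>\<epsilon> I. C \<epsilon> I \<in> MDO0" "\<And>\<epsilon> I g. n \<epsilon> < mabs I \<Longrightarrow> C \<epsilon> I g = 0"
    "\<And>\<epsilon> g. \<omega> \<epsilon> g = nform (n \<epsilon>) (\<lambda>I. C \<epsilon> I g)" "\<And>\<epsilon>. \<omega> \<epsilon> = (\<lambda>_. 0) \<Longrightarrow> C \<epsilon> = (\<lambda>_ _. 0)"
    by metis
  define m where "m = Max (range n)"
  have nm: "n \<epsilon> \<le> m" for \<epsilon> by (simp add: m_def)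
  have \<omega>m: "\<omega> \<epsilon> g = nform p (\<lambda>I. C \<epsilon> I g)" if "m \<le> p" for p \<epsilon> g
    unfolding C(3) using nm[of \<epsilon>] that by (intro nform_mono[symmetric]) (auto simp: C(2))
  have d_nform: "(\<Sum>i\<in>\<epsilon>. wsign i \<epsilon> *\<^sub>R total_deriv i (nform m (c (\<epsilon> - {i})))) = nform (Suc m) (koszul_d c \<epsilon>)"
    for c and \<epsilon> :: "'d set"
    by (simp add: koszul_d_def[abs_def] total_deriv_nform nform_sum nform_scaleR)
  have kd0: "koszul_d (\<lambda>\<epsilon> I. C \<epsilon> I g) \<epsilon> I = 0" for g \<epsilon> I
  proof (cases "mabs I \<le> Suc m")
    case True
    have "(\<lambda>g. shift i (\<lambda>I. C (\<epsilon> - {i}) I g) I) \<in> MDO0" for i I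
      using C(1) by (cases "0 < I i") (simp_all add: shift_def MDO0_intros del: fun_upd_apply)
    then have "(\<lambda>g. koszul_d (\<lambda>\<epsilon> I. C \<epsilon> I g) \<epsilon> I) \<in> MDO0" for I
      unfolding koszul_d_def by (intro MDO0_intros)
    moreover have "nform (Suc m) (\<lambda>I. koszul_d (\<lambda>\<epsilon> I. C \<epsilon> I g) \<epsilon> I) = 0" for g
      using closed[of \<epsilon>] d_nform[of \<epsilon> "\<lambda>\<epsilon> I. C \<epsilon> I g"]
      by (simp add: op_d_def fun_eq_iff \<omega>m[OF order_refl])
    ultimately show ?thesis using nform_unique[of "\<lambda>I g. koszul_d (\<lambda>\<epsilon> I. C \<epsilon> I g) \<epsilon> I"] True by blast
  next
    case False
    have "shift i (\<lambda>I. C (\<epsilon> - {i}) I g) I = 0" for i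
      using False mabs_decr[of I i] nm[of "\<epsilon> - {i}"] by (auto simp: shift_def intro!: C(2))
    then show ?thesis by (simp add: koszul_d_def)
  qed
  define \<eta> where "\<eta> \<epsilon> g = nform m (koszul_h (\<lambda>\<epsilon> I. C \<epsilon> I g) \<epsilon>)" for \<epsilon> g
  \<comment> \<open>The eigenvalue vanishes only at the constant coefficient of a top form; there
    both sides are 0 because \<open>\<omega> UNIV\<close> is.\<close>
  have hom: "koszul_d (koszul_h (\<lambda>\<epsilon> I. C \<epsilon> I g)) \<epsilon> I = C \<epsilon> I g" for \<epsilon> I g
  proof (cases "real (mabs I) + real CARD('d) - real (card \<epsilon>) = 0")
    case True
    have "card \<epsilon> \<le> CARD('d)" by (rule card_mono) auto
    then have "mabs I = 0" "card \<epsilon> = CARD('d)" using True by linarith+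
    then have "\<epsilon> = UNIV" "\<And>i. I i = 0"
      by (simp_all add: mabs_def card_eq_UNIV_imp_eq_UNIV)
    then show ?thesis using C(4)[OF \<omega>(2)] by (simp add: koszul_d_def shift_def)
  qed (rule koszul_homotopy[OF kd0])
  show ?thesis
  proof (intro exI[of _ \<eta>] conjI allI impI)
    fix \<epsilon>
    have "(\<lambda>g. koszul_h (\<lambda>\<epsilon> I. C \<epsilon> I g) \<epsilon> I) \<in> MDO" for I
      unfolding koszul_h_def by (intro MDO_intros MDO0_imp_MDO C(1))
    then show "\<eta> \<epsilon> \<in> MDO"
      unfolding \<eta>_def nform_def by (intro MDO_intros MDO_dx_power)
    assume "\<forall>i. i \<notin> \<epsilon> \<longrightarrow> \<omega> (insert i \<epsilon>) = (\<lambda>_. 0)"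
    then have "koszul_h (\<lambda>\<epsilon> I. C \<epsilon> I g) \<epsilon> = (\<lambda>_. 0)" for g
      using C(4) by (auto simp: koszul_h_def fun_eq_iff)
    then show "\<eta> \<epsilon> = (\<lambda>_. 0)" by (simp add: \<eta>_def[abs_def])
  next
    show "op_d \<eta> = \<omega>"
      using \<omega>m[of "Suc m"] by (auto simp: fun_eq_iff op_d_def \<eta>_def d_nform hom[abs_def])
  qed
qed

section \<open>Locally finite sums\<close>

abbreviation vderiv :: "('n \<Rightarrow> 'd::finite vindex) \<Rightarrow> ('n \<Rightarrow> 'd loc) \<Rightarrow> 'n \<Rightarrow> 'd loc" where
  "vderiv \<alpha> f \<equiv> \<lambda>j. du_power (\<alpha> j) (f j)"

text \<open>An index carries its exponent as \<open>\<beta> k\<close> instead of being it, because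
  composition with a slot derivative yields families in which several terms share an
  exponent.\<close>

definition local_sum :: "('k \<Rightarrow> ('n, 'd::finite) multiop) \<Rightarrow> ('k \<Rightarrow> 'n \<Rightarrow> 'd vindex) \<Rightarrow> ('n, 'd) multiop" where
  "local_sum Q \<beta> f = Sum_any (\<lambda>k. Q k (vderiv (\<beta> k) f))"

definition local_family :: "('k \<Rightarrow> ('n::finite, 'd::finite) multiop) \<Rightarrow> ('k \<Rightarrow> 'n \<Rightarrow> 'd vindex) \<Rightarrow> bool" where
  "local_family Q \<beta> \<longleftrightarrow> (\<forall>k. Q k \<in> MDO) \<and>
     (\<forall>m. finite {k. Q k \<noteq> (\<lambda>_. 0) \<and> (\<Sum>j\<in>UNIV. deg_f (\<beta> k j)) \<le> m})"

lemma MDO_linear: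
  assumes "Q \<in> MDO" shows "linear (\<lambda>v. Q (g(j := v)))"
proof -
  have "Q \<in> {Q. linear (\<lambda>v. Q (g(j := v)))}"
    using assms unfolding MDO_def
  proof (rule loc_span_closed)
    fix a I
    have "stdmono I (g(j := v)) = dx_power (I j) v * (\<Prod>l\<in>UNIV - {j}. dx_power (I l) (g l))" for v
      unfolding stdmono_def by (subst prod.remove[of _ j]) auto
    then show "(\<lambda>g. a * stdmono I g) \<in> {Q. linear (\<lambda>v. Q (g(j := v)))}"
      by (auto intro!: linearI simp: linear_add[OF linear_dx_power] linear_scale[OF linear_dx_power] algebra_simps)
  qed (auto intro: linear_compose_add simp: linear_iff algebra_simps)
  then show ?thesis by simp
qed

lemma MDO_slot_zero:
  assumes "Q \<in> MDO" "g j = 0" shows "Q g = 0"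
  using linear_0[OF MDO_linear[OF assms(1), of g j]] assms(2) by (metis fun_upd_triv)

lemma ord_le_common: "\<exists>m. \<forall>j. ord_le m (f (j::'n::finite))"
proof -
  have "\<forall>j. \<exists>m. ord_le m (f j)" using ord_le_exists by blast
  then obtain m where m: "\<And>j. ord_le (m j) (f j)" by metis
  then have "ord_le (Max (range m)) (f j)" for j by (rule ord_le_mono) simp
  then show ?thesis by blast
qed

text \<open>If some \<open>\<alpha> j\<close> had degree above m, slot j would be 0 and so would the
  value. This bound turns local finiteness into finiteness of the sum at \<open>f\<close>.\<close>

lemma MDO_vderiv_nonzero:
  fixes \<alpha> :: "'n::finite \<Rightarrow> 'd::finite vindex"
  assumes "Q \<in> MDO" "\<And>j. ord_le m (f j)" "Q (vderiv \<alpha> f) \<noteq> 0"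
  shows "(\<Sum>j\<in>UNIV. deg_f (\<alpha> j)) \<le> CARD('n) * m"
proof -
  have "deg_f (\<alpha> j) \<le> m" for j
    using assms MDO_slot_zero[OF assms(1), of "vderiv \<alpha> f" j] du_power_eq_0[OF assms(2)[of j], of "\<alpha> j"]
    by (auto simp: not_less[symmetric])
  then show ?thesis using sum_bounded_above[of UNIV "\<lambda>j. deg_f (\<alpha> j)" m] by simp
qed

lemma local_family_finite:
  assumes "local_family Q \<beta>"
  shows "finite {k. Q k (vderiv (\<beta> k) f) \<noteq> 0}"
proof -
  obtain m where m: "\<And>j. ord_le m (f j)" using ord_le_common by blast
  have "{k. Q k (vderiv (\<beta> k) f) \<noteq> 0} \<subseteq> {k. Q k \<noteq> (\<lambda>_. 0) \<and> (\<Sum>j\<in>UNIV. deg_f (\<beta> k j)) \<le> CARD('b) * m}"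
    using MDO_vderiv_nonzero[of _ m f] m assms by (auto simp: local_family_def)
  then show ?thesis using assms finite_subset unfolding local_family_def by blast
qed

lemma local_family_linear:
  assumes "finite S" "\<And>s. s \<in> S \<Longrightarrow> local_family (Q s) \<beta>"
    and "\<And>k. (\<lambda>g. \<Sum>s\<in>S. L s (Q s k g)) \<in> MDO" "\<And>s. s \<in> S \<Longrightarrow> linear (L s)"
  shows "local_family (\<lambda>k g. \<Sum>s\<in>S. L s (Q s k g)) \<beta>"
  unfolding local_family_def
proof (intro conjI allI assms(3))
  fix m
  show "finite {k. (\<lambda>g. \<Sum>s\<in>S. L s (Q s k g)) \<noteq> (\<lambda>_. 0) \<and> (\<Sum>j\<in>UNIV. deg_f (\<beta> k j)) \<le> m}"
  proof (rule finite_subset)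
    show "{k. (\<lambda>g. \<Sum>s\<in>S. L s (Q s k g)) \<noteq> (\<lambda>_. 0) \<and> (\<Sum>j\<in>UNIV. deg_f (\<beta> k j)) \<le> m}
      \<subseteq> (\<Union>s\<in>S. {k. Q s k \<noteq> (\<lambda>_. 0) \<and> (\<Sum>j\<in>UNIV. deg_f (\<beta> k j)) \<le> m})"
    proof
      fix k assume k: "k \<in> {k. (\<lambda>g. \<Sum>s\<in>S. L s (Q s k g)) \<noteq> (\<lambda>_. 0) \<and> (\<Sum>j\<in>UNIV. deg_f (\<beta> k j)) \<le> m}"
      then obtain g where "(\<Sum>s\<in>S. L s (Q s k g)) \<noteq> 0" by (auto simp: fun_eq_iff)
      then obtain s where s: "s \<in> S" "L s (Q s k g) \<noteq> 0" by (meson sum.neutral)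
      then have "Q s k g \<noteq> 0" using linear_0[OF assms(4)] by metis
      then show "k \<in> (\<Union>s\<in>S. {k. Q s k \<noteq> (\<lambda>_. 0) \<and> (\<Sum>j\<in>UNIV. deg_f (\<beta> k j)) \<le> m})"
        using s k by (auto simp: fun_eq_iff)
    qed
    show "finite (\<Union>s\<in>S. {k. Q s k \<noteq> (\<lambda>_. 0) \<and> (\<Sum>j\<in>UNIV. deg_f (\<beta> k j)) \<le> m})"
      using assms(1,2) by (auto simp: local_family_def)
  qed
qed

lemma local_sum_linear:
  assumes "finite S" "\<And>s. s \<in> S \<Longrightarrow> local_family (Q s) \<beta>" "\<And>s. s \<in> S \<Longrightarrow> linear (L s)"
  shows "local_sum (\<lambda>k g. \<Sum>s\<in>S. L s (Q s k g)) \<beta> f = (\<Sum>s\<in>S. L s (local_sum (Q s) \<beta> f))"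
proof -
  let ?K = "\<Union>s\<in>S. {k. Q s k (vderiv (\<beta> k) f) \<noteq> 0}"
  have K: "finite ?K" using assms(1) local_family_finite[OF assms(2)] by auto
  have "{k. (\<Sum>s\<in>S. L s (Q s k (vderiv (\<beta> k) f))) \<noteq> 0} \<subseteq> ?K"
  proof
    fix k assume "k \<in> {k. (\<Sum>s\<in>S. L s (Q s k (vderiv (\<beta> k) f))) \<noteq> 0}"
    then obtain s where s: "s \<in> S" "L s (Q s k (vderiv (\<beta> k) f)) \<noteq> 0" by (auto dest: sum.not_neutral_contains_not_neutral)
    then have "Q s k (vderiv (\<beta> k) f) \<noteq> 0" using linear_0[OF assms(3)] by metis
    then show "k \<in> ?K" using s by auto
  qed
  then have "local_sum (\<lambda>k g. \<Sum>s\<in>S. L s (Q s k g)) \<beta> f = (\<Sum>k\<in>?K. \<Sum>s\<in>S. L s (Q s k (vderiv (\<beta> k) f)))"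
    unfolding local_sum_def by (rule Sum_any.expand_superset[OF K])
  also have "\<dots> = (\<Sum>s\<in>S. \<Sum>k\<in>?K. L s (Q s k (vderiv (\<beta> k) f)))" by (rule sum.swap)
  also have "\<dots> = (\<Sum>s\<in>S. L s (\<Sum>k\<in>?K. Q s k (vderiv (\<beta> k) f)))"
    by (intro sum.cong) (simp_all add: linear_sum[OF assms(3)])
  also have "\<dots> = (\<Sum>s\<in>S. L s (local_sum (Q s) \<beta> f))"
    unfolding local_sum_def
    by (intro sum.cong arg_cong[of _ _ "L _"] Sum_any.expand_superset[OF K, symmetric]) auto
  finally show ?thesis .
qed

text \<open>Regroups a sum over pairs (I, \<alpha>) by \<alpha>. The term \<open>T\<close> is
  abstract so that one lemma serves standard monomials, polarized monomials and the integrated terms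
  of the characteristic.\<close>

lemma Sum_any_coeffs_eq_local_sum:
  assumes p: "admissible p" and T: "\<And>I \<alpha>. T I \<alpha> \<in> MDO" "\<And>I \<alpha>. p I \<alpha> = 0 \<Longrightarrow> T I \<alpha> = (\<lambda>_. 0)"
  defines "Q \<equiv> \<lambda>\<alpha> g. \<Sum>I | p I \<alpha> \<noteq> 0. T I \<alpha> g"
  shows "local_family Q (\<lambda>\<alpha>. \<alpha>)"
    and "Sum_any (\<lambda>(I, \<alpha>). T I \<alpha> (vderiv \<alpha> f)) = local_sum Q (\<lambda>\<alpha>. \<alpha>) f"
proof -
  let ?X = "\<lambda>m. {(I, \<alpha>). p I \<alpha> \<noteq> 0 \<and> (\<Sum>j\<in>UNIV. deg_f (\<alpha> j)) \<le> m}"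
  have X: "finite (?X m)" for m using p unfolding admissible_def by blast
  have fin: "finite {I. p I \<alpha> \<noteq> 0}" for \<alpha>
    by (rule finite_subset[OF _ finite_imageI[OF X[of "\<Sum>j\<in>UNIV. deg_f (\<alpha> j)"], of fst]]) force
  show fam: "local_family Q (\<lambda>\<alpha>. \<alpha>)"
    unfolding local_family_def
  proof (intro conjI allI)
    fix m
    show "finite {\<alpha>. Q \<alpha> \<noteq> (\<lambda>_. 0) \<and> (\<Sum>j\<in>UNIV. deg_f (\<alpha> j)) \<le> m}"
    proof (rule finite_subset[OF _ finite_imageI[OF X[of m], of snd]])
      show "{\<alpha>. Q \<alpha> \<noteq> (\<lambda>_. 0) \<and> (\<Sum>j\<in>UNIV. deg_f (\<alpha> j)) \<le> m} \<subseteq> snd ` ?X m"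
      proof
        fix \<alpha> assume \<alpha>: "\<alpha> \<in> {\<alpha>. Q \<alpha> \<noteq> (\<lambda>_. 0) \<and> (\<Sum>j\<in>UNIV. deg_f (\<alpha> j)) \<le> m}"
        then obtain g where "Q \<alpha> g \<noteq> 0" by (auto simp: fun_eq_iff)
        then obtain I where "p I \<alpha> \<noteq> 0"
          unfolding Q_def by (auto elim: sum.not_neutral_contains_not_neutral)
        then show "\<alpha> \<in> snd ` ?X m" using \<alpha> by force
      qed
    qed
  qed (auto simp: Q_def intro!: MDO_intros T)
  obtain m where m: "\<And>j. ord_le m (f j)" using ord_le_common by blast
  let ?M = "CARD('a) * m"
  let ?A = "snd ` ?X ?M"
  let ?Y = "Sigma ?A (\<lambda>\<alpha>. {I. p I \<alpha> \<noteq> 0})"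
  have Y: "finite ?Y" using X fin by auto
  have "Sum_any (\<lambda>(I, \<alpha>). T I \<alpha> (vderiv \<alpha> f)) = (\<Sum>(I, \<alpha>)\<in>prod.swap ` ?Y. T I \<alpha> (vderiv \<alpha> f))"
  proof (rule Sum_any.expand_superset)
    show "{a. (case a of (I, \<alpha>) \<Rightarrow> T I \<alpha> (vderiv \<alpha> f)) \<noteq> 0} \<subseteq> prod.swap ` ?Y"
    proof (rule subsetI)
      fix a assume "a \<in> {a. (case a of (I, \<alpha>) \<Rightarrow> T I \<alpha> (vderiv \<alpha> f)) \<noteq> 0}"
      then obtain I \<alpha> where a: "a = (I, \<alpha>)" and nz: "T I \<alpha> (vderiv \<alpha> f) \<noteq> 0" by (cases a) simp
      then have pn: "p I \<alpha> \<noteq> 0" using T(2)[of I \<alpha>] by auto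
      then have "(I, \<alpha>) \<in> ?X ?M" using MDO_vderiv_nonzero[OF T(1) m nz] by simp
      then have "\<alpha> \<in> ?A" by (rule image_eqI[rotated]) simp
      then show "a \<in> prod.swap ` ?Y"
        unfolding a using pn by (intro image_eqI[of _ _ "(\<alpha>, I)"]) simp_all
    qed
  qed (use Y in simp)
  also have "\<dots> = (\<Sum>(\<alpha>, I)\<in>?Y. T I \<alpha> (vderiv \<alpha> f))"
    by (subst sum.reindex) (auto intro!: sum.cong)
  also have "\<dots> = (\<Sum>\<alpha>\<in>?A. Q \<alpha> (vderiv \<alpha> f))"
    unfolding Q_def using X fin by (subst sum.Sigma) auto
  also have "\<dots> = local_sum Q (\<lambda>\<alpha>. \<alpha>) f"
    unfolding local_sum_def
  proof (rule Sum_any.expand_superset[symmetric])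
    show "{\<alpha>. Q \<alpha> (vderiv \<alpha> f) \<noteq> 0} \<subseteq> ?A"
    proof (rule subsetI)
      fix \<alpha> assume "\<alpha> \<in> {\<alpha>. Q \<alpha> (vderiv \<alpha> f) \<noteq> 0}"
      then have nz: "Q \<alpha> (vderiv \<alpha> f) \<noteq> 0" by simp
      then obtain I where "p I \<alpha> \<noteq> 0"
        unfolding Q_def by (auto elim: sum.not_neutral_contains_not_neutral)
      moreover have "(\<Sum>j\<in>UNIV. deg_f (\<alpha> j)) \<le> ?M"
        using MDO_vderiv_nonzero[of "Q \<alpha>" m f \<alpha>] m nz fam unfolding local_family_def by blast
      ultimately have "(I, \<alpha>) \<in> ?X ?M" by simp
      then show "\<alpha> \<in> ?A" by (rule image_eqI[rotated]) simp
    qed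
  qed (use X in simp)
  finally show "Sum_any (\<lambda>(I, \<alpha>). T I \<alpha> (vderiv \<alpha> f)) = local_sum Q (\<lambda>\<alpha>. \<alpha>) f" .
qed

text \<open>Zero operators are given zero coefficients; otherwise spurious coefficients at
  infinitely many \<alpha> could violate \<open>admissible\<close>.\<close>

lemma local_sum_coeffs:
  assumes fam: "local_family Q (\<lambda>\<alpha>. \<alpha>)" and span: "\<And>\<alpha>. Q \<alpha> \<in> loc_span b" and b: "\<And>I. b I \<in> MDO"
  shows "\<exists>p. admissible p \<and> (\<forall>f. local_sum Q (\<lambda>\<alpha>. \<alpha>) f = Sum_any (\<lambda>(I, \<alpha>). p I \<alpha> * b I (vderiv \<alpha> f)))"
proof -
  have "\<exists>p. finite {I. p I \<noteq> 0} \<and> (\<forall>g. Q \<alpha> g = (\<Sum>I | p I \<noteq> 0. p I * b I g)) \<and> (Q \<alpha> = (\<lambda>_. 0) \<longrightarrow> p = (\<lambda>_. 0))" for \<alpha>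
  proof (cases "Q \<alpha> = (\<lambda>_. 0)")
    case True
    then show ?thesis by (intro exI[of _ "\<lambda>_. 0"]) auto
  next
    case False
    then show ?thesis using loc_span_coeffs[OF span[of \<alpha>]] by blast
  qed
  then have "\<forall>\<alpha>. \<exists>p. finite {I. p I \<noteq> 0} \<and> (\<forall>g. Q \<alpha> g = (\<Sum>I | p I \<noteq> 0. p I * b I g))
      \<and> (Q \<alpha> = (\<lambda>_. 0) \<longrightarrow> p = (\<lambda>_. 0))" by (rule allI)
  from choice[OF this] obtain p where p: "\<And>\<alpha>. finite {I. p \<alpha> I \<noteq> 0}"
    "\<And>\<alpha> g. Q \<alpha> g = (\<Sum>I | p \<alpha> I \<noteq> 0. p \<alpha> I * b I g)"
    "\<And>\<alpha>. Q \<alpha> = (\<lambda>_. 0) \<Longrightarrow> p \<alpha> = (\<lambda>_. 0)" by blast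
  have adm: "admissible (\<lambda>I \<alpha>. p \<alpha> I)"
    unfolding admissible_def
  proof
    fix m
    let ?A = "{\<alpha>. Q \<alpha> \<noteq> (\<lambda>_. 0) \<and> (\<Sum>j\<in>UNIV. deg_f (\<alpha> j)) \<le> m}"
    have "finite ?A" using fam unfolding local_family_def by blast
    then have "finite (prod.swap ` Sigma ?A (\<lambda>\<alpha>. {I. p \<alpha> I \<noteq> 0}))" using p(1) by auto
    moreover have "{(I, \<alpha>). p \<alpha> I \<noteq> 0 \<and> (\<Sum>j\<in>UNIV. deg_f (\<alpha> j)) \<le> m}
        \<subseteq> prod.swap ` Sigma ?A (\<lambda>\<alpha>. {I. p \<alpha> I \<noteq> 0})"
    proof clarify
      fix I \<alpha> assume "p \<alpha> I \<noteq> 0" "(\<Sum>j\<in>UNIV. deg_f (\<alpha> j)) \<le> m"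
      moreover from this have "Q \<alpha> \<noteq> (\<lambda>_. 0)" using p(3)[of \<alpha>] by metis
      ultimately show "(I, \<alpha>) \<in> prod.swap ` Sigma ?A (\<lambda>\<alpha>. {I. p \<alpha> I \<noteq> 0})"
        by (intro image_eqI[of _ _ "(\<alpha>, I)"]) simp_all
    qed
    ultimately show "finite {(I, \<alpha>). p \<alpha> I \<noteq> 0 \<and> (\<Sum>j\<in>UNIV. deg_f (\<alpha> j)) \<le> m}"
      by (rule finite_subset[rotated])
  qed
  have "Q = (\<lambda>\<alpha> g. \<Sum>I | p \<alpha> I \<noteq> 0. p \<alpha> I * b I g)" using p(2) by blast
  then have "local_sum Q (\<lambda>\<alpha>. \<alpha>) f = Sum_any (\<lambda>(I, \<alpha>). p \<alpha> I * b I (vderiv \<alpha> f))" for f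
    using Sum_any_coeffs_eq_local_sum(2)[OF adm, of "\<lambda>I \<alpha> g. p \<alpha> I * b I g" f] b
    by (simp add: MDO_intros)
  then show ?thesis using adm by blast
qed

text \<open>Terms with equal exponent are collected. In one fibre of \<open>\<beta>\<close> the
  degree is constant, so only finitely many terms there are nonzero.\<close>

lemma local_sum_in_LDO:
  fixes Q :: "'k \<Rightarrow> ('n::finite, 'd::finite) multiop"
  assumes fam: "local_family Q \<beta>"
  shows "local_sum Q \<beta> \<in> LDO"
proof -
  let ?deg = "\<lambda>\<alpha> :: 'n \<Rightarrow> 'd vindex. \<Sum>j\<in>UNIV. deg_f (\<alpha> j)"
  let ?K = "\<lambda>m. {k. Q k \<noteq> (\<lambda>_. 0) \<and> ?deg (\<beta> k) \<le> m}"
  have K: "finite (?K m)" for m using fam unfolding local_family_def by blast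
  have Q: "Q k \<in> MDO" for k using fam unfolding local_family_def by blast
  define R where "R \<alpha> g = (\<Sum>k | Q k \<noteq> (\<lambda>_. 0) \<and> \<beta> k = \<alpha>. Q k g)" for \<alpha> g
  have R: "R \<alpha> \<in> MDO" for \<alpha> unfolding R_def by (intro MDO_intros Q)
  have R0: "\<alpha> \<in> \<beta> ` ?K m" if "R \<alpha> g \<noteq> 0" "?deg \<alpha> \<le> m" for \<alpha> g m
  proof -
    have "\<exists>k\<in>{k. Q k \<noteq> (\<lambda>_. 0) \<and> \<beta> k = \<alpha>}. Q k g \<noteq> 0"
      using that(1) unfolding R_def by (meson sum.neutral)
    then obtain k where "Q k \<noteq> (\<lambda>_. 0) \<and> \<beta> k = \<alpha>" by blast
    then show ?thesis using that(2) by (intro image_eqI[of _ _ k]) auto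
  qed
  have famR: "local_family R (\<lambda>\<alpha>. \<alpha>)"
    unfolding local_family_def
  proof (intro conjI allI R)
    fix m
    have "{\<alpha>. R \<alpha> \<noteq> (\<lambda>_. 0) \<and> ?deg \<alpha> \<le> m} \<subseteq> \<beta> ` ?K m"
    proof (rule subsetI)
      fix \<alpha> assume \<alpha>: "\<alpha> \<in> {\<alpha>. R \<alpha> \<noteq> (\<lambda>_. 0) \<and> ?deg \<alpha> \<le> m}"
      then obtain g where "R \<alpha> g \<noteq> 0" by (auto simp: fun_eq_iff)
      then show "\<alpha> \<in> \<beta> ` ?K m" using \<alpha> by (intro R0) auto
    qed
    then show "finite {\<alpha>. R \<alpha> \<noteq> (\<lambda>_. 0) \<and> ?deg \<alpha> \<le> m}"
      using finite_imageI[OF K] by (rule finite_subset)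
  qed
  have "local_sum Q \<beta> f = local_sum R (\<lambda>\<alpha>. \<alpha>) f" for f
  proof -
    obtain m where m: "\<And>j. ord_le m (f j)" using ord_le_common by blast
    let ?M = "CARD('n) * m"
    have "local_sum Q \<beta> f = (\<Sum>k\<in>?K ?M. Q k (vderiv (\<beta> k) f))"
      unfolding local_sum_def
    proof (rule Sum_any.expand_superset[OF K])
      show "{k. Q k (vderiv (\<beta> k) f) \<noteq> 0} \<subseteq> ?K ?M"
        using MDO_vderiv_nonzero[of _ m f] Q m by (auto simp: fun_eq_iff)
    qed
    also have "\<dots> = (\<Sum>\<alpha>\<in>\<beta> ` ?K ?M. \<Sum>k | k \<in> ?K ?M \<and> \<beta> k = \<alpha>. Q k (vderiv (\<beta> k) f))"
      by (rule sum.image_gen[OF K])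
    also have "\<dots> = (\<Sum>\<alpha>\<in>\<beta> ` ?K ?M. R \<alpha> (vderiv \<alpha> f))"
      unfolding R_def by (intro sum.cong) auto
    also have "\<dots> = local_sum R (\<lambda>\<alpha>. \<alpha>) f"
      unfolding local_sum_def
    proof (rule Sum_any.expand_superset[OF finite_imageI[OF K], symmetric])
      show "{\<alpha>. R \<alpha> (vderiv \<alpha> f) \<noteq> 0} \<subseteq> \<beta> ` ?K ?M"
      proof (rule subsetI)
        fix \<alpha> assume "\<alpha> \<in> {\<alpha>. R \<alpha> (vderiv \<alpha> f) \<noteq> 0}"
        then have nz: "R \<alpha> (vderiv \<alpha> f) \<noteq> 0" by simp
        then show "\<alpha> \<in> \<beta> ` ?K ?M"
          using MDO_vderiv_nonzero[of "R \<alpha>" m f \<alpha>] R m by (intro R0) auto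
      qed
    qed
    finally show ?thesis .
  qed
  moreover obtain p where "admissible p"
    "\<And>f. local_sum R (\<lambda>\<alpha>. \<alpha>) f = Sum_any (\<lambda>(I, \<alpha>). p I \<alpha> * stdmono I (vderiv \<alpha> f))"
    using local_sum_coeffs[OF famR, of stdmono] R MDO_intros(8) unfolding MDO_def by blast
  ultimately show ?thesis
    unfolding LDO_def op_of_coeffs_def[abs_def]
    by (intro CollectI exI[of _ p]) (auto simp: fun_eq_iff stdmono_def)
qed

lemma LDO_family:
  assumes "A \<in> LDO"
  obtains Q where "local_family Q (\<lambda>\<alpha>. \<alpha>)" "A = local_sum Q (\<lambda>\<alpha>. \<alpha>)"
proof -
  obtain p where p: "admissible p" "A = op_of_coeffs p" using assms unfolding LDO_def by blast
  have M: "(\<lambda>g. p I \<alpha> * stdmono I g) \<in> MDO" for I \<alpha> by (intro MDO_intros)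
  have Z: "p I \<alpha> = 0 \<Longrightarrow> (\<lambda>g. p I \<alpha> * stdmono I g) = (\<lambda>_. 0)" for I \<alpha> by simp
  have "A = local_sum (\<lambda>\<alpha> g. \<Sum>I | p I \<alpha> \<noteq> 0. p I \<alpha> * stdmono I g) (\<lambda>\<alpha>. \<alpha>)"
    using Sum_any_coeffs_eq_local_sum(2)[OF p(1), of "\<lambda>I \<alpha> g. p I \<alpha> * stdmono I g", OF M Z]
    by (simp add: p(2) op_of_coeffs_def fun_eq_iff stdmono_def)
  then show ?thesis
    using Sum_any_coeffs_eq_local_sum(1)[OF p(1), of "\<lambda>I \<alpha> g. p I \<alpha> * stdmono I g", OF M Z] that by blast
qed

section \<open>Uniqueness of the vertical components\<close>

definition vsize :: "'d vindex \<Rightarrow> nat" where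
  "vsize \<alpha> = (\<Sum>J\<in>Poly_Mapping.keys \<alpha>. Poly_Mapping.lookup \<alpha> J)"

lemma vsize_superset:
  "finite S \<Longrightarrow> Poly_Mapping.keys \<alpha> \<subseteq> S \<Longrightarrow> vsize \<alpha> = (\<Sum>J\<in>S. Poly_Mapping.lookup \<alpha> J)"
  unfolding vsize_def by (rule sum.mono_neutral_left) (auto simp: in_keys_iff)

lemma vsize_mono:
  assumes "Poly_Mapping.lookup \<beta> \<le> Poly_Mapping.lookup \<alpha>"
  shows "vsize \<beta> \<le> vsize \<alpha>" and "vsize \<alpha> \<le> vsize \<beta> \<Longrightarrow> \<beta> = \<alpha>"
proof -
  have sub: "Poly_Mapping.keys \<beta> \<subseteq> Poly_Mapping.keys \<alpha>"
    using assms by (auto simp: in_keys_iff le_fun_def) (metis le_0_eq not_gr_zero)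
  have \<beta>: "vsize \<beta> = (\<Sum>J\<in>Poly_Mapping.keys \<alpha>. Poly_Mapping.lookup \<beta> J)"
    by (rule vsize_superset) (simp_all add: sub)
  show "vsize \<beta> \<le> vsize \<alpha>"
    unfolding \<beta> unfolding vsize_def using assms by (intro sum_mono) (simp add: le_fun_def)
  assume le: "vsize \<alpha> \<le> vsize \<beta>"
  show "\<beta> = \<alpha>"
  proof (rule ccontr)
    assume "\<beta> \<noteq> \<alpha>"
    then obtain J where "Poly_Mapping.lookup \<beta> J \<noteq> Poly_Mapping.lookup \<alpha> J"
      using poly_mapping_eqI[of \<beta> \<alpha>] by metis
    then have lt: "Poly_Mapping.lookup \<beta> J < Poly_Mapping.lookup \<alpha> J"
      using assms by (simp add: le_fun_def le_neq_implies_less)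
    then have "vsize \<beta> < vsize \<alpha>"
      unfolding \<beta> unfolding vsize_def using assms
      by (intro sum_strict_mono_ex1) (auto simp: le_fun_def in_keys_iff intro!: bexI[of _ J])
    then show False using le by simp
  qed
qed

text \<open>With \<mu> of least total exponent, any other \<alpha> surviving on the test function
  would lie below \<mu>, against minimality. The conclusion Q \<mu> = 0 is reached on functions of x
  only; \<open>MDO_eq_0_if_base\<close> extends it to all arguments.\<close>

lemma local_sum_unique:
  fixes Q :: "('n::finite \<Rightarrow> 'd::finite vindex) \<Rightarrow> ('n, 'd) multiop"
  assumes fam: "local_family Q (\<lambda>\<alpha>. \<alpha>)" and zero: "local_sum Q (\<lambda>\<alpha>. \<alpha>) = (\<lambda>_. 0)"
  shows "Q \<alpha> = (\<lambda>_. 0)"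
proof (rule ccontr)
  let ?size = "\<lambda>\<alpha> :: 'n \<Rightarrow> 'd vindex. \<Sum>j\<in>UNIV. vsize (\<alpha> j)"
  assume "Q \<alpha> \<noteq> (\<lambda>_. 0)"
  then obtain \<mu> where \<mu>: "Q \<mu> \<noteq> (\<lambda>_. 0)" "\<And>\<alpha>. Q \<alpha> \<noteq> (\<lambda>_. 0) \<Longrightarrow> ?size \<mu> \<le> ?size \<alpha>"
    using ex_has_least_nat[of "\<lambda>\<alpha>. Q \<alpha> \<noteq> (\<lambda>_. 0)" _ ?size] by blast
  have Q: "Q \<alpha> \<in> MDO" for \<alpha> using fam unfolding local_family_def by blast
  have "\<forall>j. \<exists>w. \<forall>h. (\<forall>J. pd (Fibre J) h = 0) \<longrightarrow> du_power (\<mu> j) (w * h) = h \<and>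
    (\<forall>\<gamma>. \<not> Poly_Mapping.lookup \<gamma> \<le> Poly_Mapping.lookup (\<mu> j) \<longrightarrow> du_power \<gamma> (w * h) = 0)"
  proof
    fix j
    show "\<exists>w. \<forall>h. (\<forall>J. pd (Fibre J) h = 0) \<longrightarrow> du_power (\<mu> j) (w * h) = h \<and>
      (\<forall>\<gamma>. \<not> Poly_Mapping.lookup \<gamma> \<le> Poly_Mapping.lookup (\<mu> j) \<longrightarrow> du_power \<gamma> (w * h) = 0)"
      using du.test_function_exists[of "Poly_Mapping.lookup (\<mu> j)" "\<lambda>_. True"]
      unfolding du_power_def using finite_lookup by blast
  qed
  from choice[OF this] obtain w where w:
    "\<And>j h. (\<forall>J. pd (Fibre J) h = 0) \<Longrightarrow> du_power (\<mu> j) (w j * h) = h"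
    "\<And>j h \<gamma>. (\<forall>J. pd (Fibre J) h = 0) \<Longrightarrow> \<not> Poly_Mapping.lookup \<gamma> \<le> Poly_Mapping.lookup (\<mu> j)
      \<Longrightarrow> du_power \<gamma> (w j * h) = 0" by blast
  have "Q \<mu> g = 0" if g: "\<And>j J. pd (Fibre J) (g j) = 0" for g
  proof -
    let ?f = "\<lambda>j. w j * g j"
    have other: "Q \<alpha> (vderiv \<alpha> ?f) = 0" if "\<alpha> \<noteq> \<mu>" for \<alpha>
    proof (cases "Q \<alpha> = (\<lambda>_. 0)")
      case False
      have "\<exists>j. \<not> Poly_Mapping.lookup (\<alpha> j) \<le> Poly_Mapping.lookup (\<mu> j)"
      proof (rule ccontr)
        assume "\<nexists>j. \<not> Poly_Mapping.lookup (\<alpha> j) \<le> Poly_Mapping.lookup (\<mu> j)"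
        then have le: "Poly_Mapping.lookup (\<alpha> j) \<le> Poly_Mapping.lookup (\<mu> j)" for j by blast
        have "?size \<alpha> = ?size \<mu>"
          using \<mu>(2)[OF False] sum_mono[of UNIV "\<lambda>j. vsize (\<alpha> j)" "\<lambda>j. vsize (\<mu> j)"] vsize_mono(1)[OF le]
          by simp
        then have "vsize (\<alpha> j) = vsize (\<mu> j)" for j
          using sum_mono_inv[of "\<lambda>j. vsize (\<alpha> j)" UNIV "\<lambda>j. vsize (\<mu> j)" j] vsize_mono(1)[OF le] by simp
        then have "\<alpha> = \<mu>" using vsize_mono(2)[OF le] by (simp add: fun_eq_iff)
        then show False using that by simp
      qed
      then obtain j where "du_power (\<alpha> j) (?f j) = 0" using w(2) g by blast
      then show ?thesis using MDO_slot_zero[OF Q, of "vderiv \<alpha> ?f" j] by simp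
    qed simp
    have "local_sum Q (\<lambda>\<alpha>. \<alpha>) ?f = (\<Sum>\<alpha>\<in>{\<mu>}. Q \<alpha> (vderiv \<alpha> ?f))"
      unfolding local_sum_def by (rule Sum_any.expand_superset) (use other in auto)
    also have "\<dots> = Q \<mu> g" using w(1) g by simp
    finally show ?thesis using zero by simp
  qed
  then have "Q \<mu> g = 0" for g by (rule MDO_eq_0_if_base[OF Q])
  then show False using \<mu>(1) by (simp add: fun_eq_iff)
qed

section \<open>Closure properties of LDO\<close>

lemma LDO_linear_comb:
  fixes L :: "'s \<Rightarrow> 'd::finite loc \<Rightarrow> 'd loc" and A :: "'s \<Rightarrow> ('n::finite, 'd) multiop"
  assumes S: "finite S" and A: "\<And>s. s \<in> S \<Longrightarrow> A s \<in> LDO"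
    and L: "\<And>s. s \<in> S \<Longrightarrow> linear (L s)"
    and closed: "\<And>s Q :: ('n, 'd) multiop. s \<in> S \<Longrightarrow> Q \<in> MDO \<Longrightarrow> (\<lambda>g. L s (Q g)) \<in> MDO"
  shows "(\<lambda>f. \<Sum>s\<in>S. L s (A s f)) \<in> LDO"
proof -
  have "\<forall>s\<in>S. \<exists>Q. local_family Q (\<lambda>\<alpha>. \<alpha>) \<and> A s = local_sum Q (\<lambda>\<alpha>. \<alpha>)"
    using A by (metis LDO_family)
  from bchoice[OF this] obtain Q where Q: "\<And>s. s \<in> S \<Longrightarrow> local_family (Q s) (\<lambda>\<alpha>. \<alpha>)"
    "\<And>s. s \<in> S \<Longrightarrow> A s = local_sum (Q s) (\<lambda>\<alpha>. \<alpha>)" by blast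
  have M: "(\<lambda>g. \<Sum>s\<in>S. L s (Q s \<alpha> g)) \<in> MDO" for \<alpha>
    using Q(1) unfolding local_family_def by (intro MDO_intros closed) auto
  have "(\<lambda>f. \<Sum>s\<in>S. L s (A s f)) = local_sum (\<lambda>\<alpha> g. \<Sum>s\<in>S. L s (Q s \<alpha> g)) (\<lambda>\<alpha>. \<alpha>)"
    using local_sum_linear[OF S Q(1) L] by (auto simp: fun_eq_iff Q(2) intro!: sum.cong)
  also have "\<dots> \<in> LDO"
    by (intro local_sum_in_LDO local_family_linear S Q(1) M L)
  finally show ?thesis .
qed

lemma LDO_zero: "(\<lambda>_. 0) \<in> LDO"
  using LDO_linear_comb[of "{} :: unit set" _ "\<lambda>_ x. x"] by simp

lemma LDO_sum_scaleR:
  assumes "finite S" "\<And>s. s \<in> S \<Longrightarrow> A s \<in> LDO"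
  shows "(\<lambda>f. \<Sum>s\<in>S. r s *\<^sub>R A s f) \<in> LDO"
  by (rule LDO_linear_comb[OF assms]) (auto intro: linearI MDO_intros simp: scaleR_add_right)

lemma LDO_sum:
  assumes "finite S" "\<And>s. s \<in> S \<Longrightarrow> A s \<in> LDO"
  shows "(\<lambda>f. \<Sum>s\<in>S. A s f) \<in> LDO"
  using LDO_sum_scaleR[where r = "\<lambda>_. 1", OF assms] by simp

lemma LDO_scaleR: "A \<in> LDO \<Longrightarrow> (\<lambda>f. r *\<^sub>R A f) \<in> LDO"
  using LDO_sum_scaleR[of "{()}" "\<lambda>_. A" "\<lambda>_. r"] by simp

lemma LDO_linear:
  fixes A :: "('n::finite, 'd::finite) multiop"
  assumes "A \<in> LDO"
  shows "linear (\<lambda>v. A (f(j := v)))"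
proof -
  obtain Q where fam: "local_family Q (\<lambda>\<alpha>. \<alpha>)" and A: "A = local_sum Q (\<lambda>\<alpha>. \<alpha>)"
    using LDO_family[OF assms] .
  have Q: "Q \<alpha> \<in> MDO" for \<alpha> using fam unfolding local_family_def by blast
  have upd: "vderiv \<alpha> (f(j := v)) = (vderiv \<alpha> f)(j := du_power (\<alpha> j) v)" for \<alpha> v
    by (auto simp: fun_eq_iff)
  have fin: "finite {\<alpha>. Q \<alpha> (vderiv \<alpha> f) \<noteq> 0}" for f by (rule local_family_finite[OF fam])
  have lin: "linear (\<lambda>v. Q \<alpha> (vderiv \<alpha> (f(j := v))))" for \<alpha>
    unfolding upd using linear_compose[OF linear_du_power[of "\<alpha> j"] MDO_linear[OF Q[of \<alpha>], of "vderiv \<alpha> f" j]]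
    by (simp add: comp_def)
  show ?thesis
  proof (rule linearI)
    fix u v
    show "A (f(j := u + v)) = A (f(j := u)) + A (f(j := v))"
      unfolding A local_sum_def linear_add[OF lin] by (rule Sum_any.distrib) (rule fin)+
  next
    fix r v
    show "A (f(j := r *\<^sub>R v)) = r *\<^sub>R A (f(j := v))"
      unfolding A local_sum_def linear_scale[OF lin]
      using Sum_any_right_distrib[OF fin[of "f(j := v)"], of "r *\<^sub>R 1"] by simp
  qed
qed

text \<open>Commuting D_i past the vertical derivatives in slot j gives the main terms
  \<open>Q \<alpha> \<circ> slot_deriv j i\<close> and corrections with other exponents. A
  correction of degree at most m stems from an \<alpha> of degree at most m + 1, so the corrections
  form a local family as well.\<close>

lemma LDO_slot:
  fixes A :: "('n::finite, 'd::finite) multiop"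
  assumes "A \<in> LDO"
  shows "A \<circ> slot_deriv j i \<in> LDO"
proof -
  obtain Q where fam: "local_family Q (\<lambda>\<alpha>. \<alpha>)" and A: "A = local_sum Q (\<lambda>\<alpha>. \<alpha>)"
    using LDO_family[OF assms] .
  have Q: "Q \<alpha> \<in> MDO" for \<alpha> using fam unfolding local_family_def by blast
  have finQ: "finite {\<alpha>. Q \<alpha> \<noteq> (\<lambda>_. 0) \<and> (\<Sum>j\<in>UNIV. deg_f (\<alpha> j)) \<le> m}" for m
    using fam unfolding local_family_def by blast
  have "\<forall>\<alpha>. \<exists>bs. (\<forall>\<beta>\<in>set bs. deg_f \<alpha> \<le> Suc (deg_f \<beta>)) \<and>
    (\<forall>f. du_power \<alpha> (total_deriv i f) = total_deriv i (du_power \<alpha> f) + (\<Sum>\<beta>\<leftarrow>bs. du_power \<beta> f))"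
    by (rule allI, rule du_power_total_deriv)
  from choice[OF this] obtain bs where
    bs: "\<And>\<alpha> \<beta>. \<beta> \<in> set (bs \<alpha>) \<Longrightarrow> deg_f \<alpha> \<le> Suc (deg_f \<beta>)"
    "\<And>\<alpha> f. du_power \<alpha> (total_deriv i f) = total_deriv i (du_power \<alpha> f) + (\<Sum>\<beta>\<leftarrow>bs \<alpha>. du_power \<beta> f)"
    by blast
  \<comment> \<open>Corrections are indexed by \<alpha> and a position t in the list
    \<open>bs (\<alpha> j)\<close>; positions beyond its end get 0.\<close>
  define R where "R = (\<lambda>(\<alpha>, t). if t < length (bs (\<alpha> j)) then Q \<alpha> else (\<lambda>_. 0))"
  define \<rho> where "\<rho> = (\<lambda>(\<alpha> :: 'n \<Rightarrow> 'd vindex, t). \<alpha>(j := bs (\<alpha> j) ! t))"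
  have fam1: "local_family (\<lambda>\<alpha>. Q \<alpha> \<circ> slot_deriv j i) (\<lambda>\<alpha>. \<alpha>)"
    unfolding local_family_def
  proof (intro conjI allI MDO_slot Q)
    show "finite {\<alpha>. Q \<alpha> \<circ> slot_deriv j i \<noteq> (\<lambda>_. 0) \<and> (\<Sum>j\<in>UNIV. deg_f (\<alpha> j)) \<le> m}" for m
      by (rule finite_subset[OF _ finQ[of m]]) auto
  qed
  have fam2: "local_family R \<rho>"
    unfolding local_family_def
  proof (intro conjI allI)
    show "R k \<in> MDO" for k by (cases k) (auto simp: R_def Q MDO_intros)
    fix m
    have "{k. R k \<noteq> (\<lambda>_. 0) \<and> (\<Sum>l\<in>UNIV. deg_f (\<rho> k l)) \<le> m}
      \<subseteq> Sigma {\<alpha>. Q \<alpha> \<noteq> (\<lambda>_. 0) \<and> (\<Sum>j\<in>UNIV. deg_f (\<alpha> j)) \<le> Suc m} (\<lambda>\<alpha>. {..<length (bs (\<alpha> j))})"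
    proof (rule subsetI)
      fix k assume k: "k \<in> {k. R k \<noteq> (\<lambda>_. 0) \<and> (\<Sum>l\<in>UNIV. deg_f (\<rho> k l)) \<le> m}"
      obtain \<alpha> t where kt: "k = (\<alpha>, t)" by (cases k)
      have t: "t < length (bs (\<alpha> j))" "Q \<alpha> \<noteq> (\<lambda>_. 0)" using k by (auto simp: kt R_def split: if_splits)
      have "deg_f (\<alpha> j) \<le> Suc (deg_f (\<rho> k j))" using bs(1)[OF nth_mem[OF t(1)]] by (simp add: kt \<rho>_def)
      moreover have "(\<Sum>l\<in>UNIV - {j}. deg_f (\<rho> k l)) = (\<Sum>l\<in>UNIV - {j}. deg_f (\<alpha> l))"
        by (rule sum.cong) (auto simp: kt \<rho>_def)
      ultimately have "(\<Sum>l\<in>UNIV. deg_f (\<alpha> l)) \<le> Suc (\<Sum>l\<in>UNIV. deg_f (\<rho> k l))"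
        by (subst (1 2) sum.remove[of _ j]) auto
      then show "k \<in> Sigma {\<alpha>. Q \<alpha> \<noteq> (\<lambda>_. 0) \<and> (\<Sum>j\<in>UNIV. deg_f (\<alpha> j)) \<le> Suc m} (\<lambda>\<alpha>. {..<length (bs (\<alpha> j))})"
        using k t by (simp add: kt)
    qed
    then show "finite {k. R k \<noteq> (\<lambda>_. 0) \<and> (\<Sum>l\<in>UNIV. deg_f (\<rho> k l)) \<le> m}"
      by (rule finite_subset) (use finQ in auto)
  qed
  have split: "A (slot_deriv j i f) = local_sum (\<lambda>\<alpha>. Q \<alpha> \<circ> slot_deriv j i) (\<lambda>\<alpha>. \<alpha>) f + local_sum R \<rho> f" for f
  proof -
    define T where "T \<alpha> = (\<Sum>t<length (bs (\<alpha> j)). Q \<alpha> (vderiv (\<rho> (\<alpha>, t)) f))" for \<alpha>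
    have Qslot: "Q \<alpha> (vderiv \<alpha> (slot_deriv j i f)) = (Q \<alpha> \<circ> slot_deriv j i) (vderiv \<alpha> f) + T \<alpha>" for \<alpha>
    proof -
      let ?g = "vderiv \<alpha> f"
      have "vderiv \<alpha> (slot_deriv j i f) = ?g(j := total_deriv i (?g j) + (\<Sum>t<length (bs (\<alpha> j)). du_power (bs (\<alpha> j) ! t) (f j)))"
        by (auto simp: fun_eq_iff slot_deriv_def bs(2) sum_list_sum_nth atLeast0LessThan)
      moreover have "?g(j := du_power (bs (\<alpha> j) ! t) (f j)) = vderiv (\<rho> (\<alpha>, t)) f" for t
        by (auto simp: \<rho>_def fun_eq_iff)
      ultimately show ?thesis
        unfolding T_def
        by (simp add: linear_add[OF MDO_linear[OF Q]] linear_sum[OF MDO_linear[OF Q]] slot_deriv_def)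
    qed
    let ?K = "{\<alpha>. Q \<alpha> (vderiv \<alpha> (slot_deriv j i f)) \<noteq> 0} \<union> {\<alpha>. (Q \<alpha> \<circ> slot_deriv j i) (vderiv \<alpha> f) \<noteq> 0}
      \<union> fst ` {k. R k (vderiv (\<rho> k) f) \<noteq> 0}"
    have K: "finite ?K"
      using local_family_finite[OF fam] local_family_finite[OF fam1] local_family_finite[OF fam2] by auto
    let ?S = "Sigma ?K (\<lambda>\<alpha>. {..<length (bs (\<alpha> j))})"
    have "local_sum R \<rho> f = (\<Sum>k\<in>?S. R k (vderiv (\<rho> k) f))"
      unfolding local_sum_def
    proof (rule Sum_any.expand_superset)
      show "{k. R k (vderiv (\<rho> k) f) \<noteq> 0} \<subseteq> ?S"
      proof (rule subsetI)
        fix k assume k: "k \<in> {k. R k (vderiv (\<rho> k) f) \<noteq> 0}"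
        then have "snd k < length (bs (fst k j))" by (cases k) (auto simp: R_def split: if_splits)
        moreover have "fst k \<in> ?K" using k by blast
        ultimately show "k \<in> ?S" by (simp add: mem_Times_iff mem_Sigma_iff[of "fst k" "snd k", simplified])
      qed
    qed (use K in auto)
    also have "\<dots> = (\<Sum>\<alpha>\<in>?K. \<Sum>t<length (bs (\<alpha> j)). R (\<alpha>, t) (vderiv (\<rho> (\<alpha>, t)) f))"
      by (subst sum.Sigma[OF K]) (auto intro!: sum.cong)
    also have "\<dots> = (\<Sum>\<alpha>\<in>?K. T \<alpha>)"
      unfolding T_def by (intro sum.cong) (auto simp: R_def)
    finally have "local_sum R \<rho> f = (\<Sum>\<alpha>\<in>?K. T \<alpha>)" .
    moreover have "local_sum (\<lambda>\<alpha>. Q \<alpha> \<circ> slot_deriv j i) (\<lambda>\<alpha>. \<alpha>) f = (\<Sum>\<alpha>\<in>?K. (Q \<alpha> \<circ> slot_deriv j i) (vderiv \<alpha> f))"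
      unfolding local_sum_def by (rule Sum_any.expand_superset[OF K]) blast
    moreover have "A (slot_deriv j i f) = (\<Sum>\<alpha>\<in>?K. Q \<alpha> (vderiv \<alpha> (slot_deriv j i f)))"
      unfolding A local_sum_def by (rule Sum_any.expand_superset[OF K]) blast
    ultimately show ?thesis by (simp only: Qslot sum.distrib)
  qed
  have "(\<lambda>f. \<Sum>b\<in>UNIV. (if b then local_sum (\<lambda>\<alpha>. Q \<alpha> \<circ> slot_deriv j i) (\<lambda>\<alpha>. \<alpha>) else local_sum R \<rho>) f) \<in> LDO"
    by (rule LDO_sum) (use local_sum_in_LDO[OF fam1] local_sum_in_LDO[OF fam2] in auto)
  then show ?thesis by (simp add: UNIV_bool comp_def split add.commute)
qed

section \<open>Polarized monomials\<close>

lemma slot_deriv_commute: "slot_deriv j i (slot_deriv k l g) = slot_deriv k l (slot_deriv j i g)"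
  by (cases "j = k") (auto simp: slot_deriv_def fun_eq_iff total_deriv_commute)

lemma dy_commute: "dy j i (dy k l A) = dy k l (dy j i A)"
  by (auto simp: dy_def fun_eq_iff slot_deriv_commute[of _ l _ i] intro: sum.swap)

text \<open>In the distinguished direction the sum over slots is the total derivative of the
  product, by \<open>total_deriv_stdmono\<close>, and commutes with the outer powers; the other
  directions act inside.\<close>

lemma dy_polmono: "dy j i (polmono I) = polmono (I(j := incr i (I j)))"
proof (cases "j = Min UNIV")
  case True
  have "dy j i (polmono I) g = dx_power (I (Min UNIV)) (total_deriv i (stdmono (I(Min UNIV := \<lambda>_. 0)) g))" for g
    using True
    by (simp add: dy_def polmono_def stdmono_slot total_deriv_stdmono linear_sum[OF linear_dx_power] del: fun_upd_apply)
  then show ?thesis using True by (simp add: fun_eq_iff[where f = "dy _ _ _"] polmono_def dx_power_Suc')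
next
  case False
  have "(I(Min UNIV := \<lambda>_. 0))(j := incr i ((I(Min UNIV := \<lambda>_. 0)) j)) = (I(j := incr i (I j)))(Min UNIV := \<lambda>_. 0)"
    using False by (auto simp: fun_eq_iff)
  then show ?thesis using False
    by (simp add: fun_eq_iff[where f = "_ \<circ> _"] dy_def polmono_def stdmono_slot)
qed

lemma polarized_monomial_eq: "polarized_monomial I \<alpha> f = polmono I (vderiv \<alpha> f)"
  for I :: "'n::{finite,linorder} \<Rightarrow> 'd::finite mindex"
proof -
  let ?D = "\<lambda>(j :: 'n, i :: 'd). dy j i"
  interpret commuting_operators ?D
    by standard (auto simp: dy_commute split: prod.splits)
  have "power_op ?D K (\<lambda>g. \<Prod>j\<in>UNIV. g j) = polmono (\<lambda>j i. K (j, i))" for K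
    using fin_supp_finite[of K]
  proof (induction K rule: fin_supp_induct)
    case zero
    show ?case by (simp add: fun_eq_iff[where f = "polmono _"] fun_eq_iff[where g = "polmono _"] polmono_def stdmono_def)
  next
    case (Suc K c)
    obtain j i where c: "c = (j, i)" by (cases c)
    have "(\<lambda>j' i'. (K(c := Suc (K c))) (j', i')) = (\<lambda>j i. K (j, i))(j := incr i (\<lambda>i. K (j, i)))"
      by (auto simp: c fun_eq_iff)
    then show ?case
      using power_op_Suc[OF Suc.hyps, of c] Suc.IH dy_polmono[of j i "\<lambda>j i. K (j, i)"] by (simp only: c prod.case)
  qed
  from this[of "\<lambda>(j, i). I j i"] show ?thesis by (simp add: polarized_monomial_def)
qed

section \<open>The characteristic as an obstruction to being a total divergence\<close>

lemma polarized_coeffs_spec: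
  assumes "A \<in> LDO"
  shows "admissible (polarized_coeffs A) \<and> A = polarized_op (polarized_coeffs A)"
proof -
  obtain Q where fam: "local_family Q (\<lambda>\<alpha>. \<alpha>)" and A: "A = local_sum Q (\<lambda>\<alpha>. \<alpha>)"
    using LDO_family[OF assms] .
  have "Q \<alpha> \<in> loc_span polmono" for \<alpha>
    using fam MDO_imp_loc_span_polmono unfolding local_family_def by blast
  then obtain q where "admissible q"
    "\<And>f. local_sum Q (\<lambda>\<alpha>. \<alpha>) f = Sum_any (\<lambda>(I, \<alpha>). q I \<alpha> * polmono I (vderiv \<alpha> f))"
    using local_sum_coeffs[OF fam, of polmono] loc_span_polmono_imp_MDO[OF loc_span_base] by blast
  then have "admissible q \<and> A = polarized_op q"
    by (simp add: A polarized_op_def polarized_monomial_eq fun_eq_iff)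
  then show ?thesis unfolding polarized_coeffs_def by (rule someI[of "\<lambda>q. admissible q \<and> A = polarized_op q"])
qed

text \<open>For each \<alpha>, integration by parts identifies the component
  \<open>Q \<alpha>\<close> of A modulo \<open>Div\<close> with the component
  \<open>C \<alpha>\<close> of the characteristic, which lies in \<open>MDO0\<close>. Both
  directions then argue by components, using \<open>local_sum_unique\<close> and
  \<open>MDO0_Div_trivial\<close>.\<close>

lemma characteristic_eq_0_iff:
  fixes A :: "('n::{finite,linorder}, 'd::finite) multiop"
  assumes "A \<in> LDO"
  shows "characteristic A = (\<lambda>_. 0) \<longleftrightarrow>
    (\<exists>B. (\<forall>i. B i \<in> LDO) \<and> A = (\<lambda>f. \<Sum>i\<in>UNIV. total_deriv i (B i f)))"
proof -
  let ?m = "Min (UNIV :: 'n set)"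
  define q where "q = polarized_coeffs A"
  have q: "admissible q" "A = polarized_op q"
    using polarized_coeffs_spec[OF assms] by (simp_all add: q_def)
  define T where "T I \<alpha> = (\<lambda>g. q I \<alpha> * polmono I g)" for I \<alpha>
  define U where "U I \<alpha> = (\<lambda>g. ((-1) ^ mabs (I ?m) * dx_power (I ?m) (q I \<alpha>)) * stdmono (I(?m := \<lambda>_. 0)) g)" for I \<alpha>
  define Q where "Q = (\<lambda>\<alpha> g. \<Sum>I | q I \<alpha> \<noteq> 0. T I \<alpha> g)"
  define C where "C = (\<lambda>\<alpha> g. \<Sum>I | q I \<alpha> \<noteq> 0. U I \<alpha> g)"
  have T: "T I \<alpha> \<in> MDO" "q I \<alpha> = 0 \<Longrightarrow> T I \<alpha> = (\<lambda>_. 0)" for I \<alpha>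
    unfolding T_def by (auto intro: MDO_intros loc_span_polmono_imp_MDO[OF loc_span_base])
  have U0: "U I \<alpha> \<in> MDO0" for I \<alpha> unfolding U_def by (intro MDO0_intros)
  have U: "q I \<alpha> = 0 \<Longrightarrow> U I \<alpha> = (\<lambda>_. 0)" for I \<alpha>
    by (simp add: U_def linear_0[OF linear_dx_power])
  have famQ: "local_family Q (\<lambda>\<alpha>. \<alpha>)" and AQ: "A = local_sum Q (\<lambda>\<alpha>. \<alpha>)"
    using Sum_any_coeffs_eq_local_sum[OF q(1), of T, OF T, folded Q_def]
    by (auto simp: q(2) polarized_op_def T_def polarized_monomial_eq fun_eq_iff)
  have "polmono (I(?m := \<lambda>_. 0)) = stdmono (I(?m := \<lambda>_. 0))" for I :: "'n \<Rightarrow> 'd mindex"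
    by (simp add: polmono_def fun_eq_iff[where f = "polmono _"])
  then have famC: "local_family C (\<lambda>\<alpha>. \<alpha>)" and chC: "characteristic A = local_sum C (\<lambda>\<alpha>. \<alpha>)"
    using Sum_any_coeffs_eq_local_sum[OF q(1), of U, OF MDO0_imp_MDO[OF U0] U, folded C_def]
    by (auto simp: characteristic_def U_def polarized_monomial_eq fun_eq_iff[where f = "characteristic _"] q_def[symmetric]
        simp del: fun_upd_apply)
  have C0: "C \<alpha> \<in> MDO0" for \<alpha> unfolding C_def by (intro MDO0_intros U0)
  have "(\<lambda>g. T I \<alpha> g - U I \<alpha> g) \<in> Div" for I \<alpha>
    unfolding T_def U_def polmono_def by (intro integration_by_parts MDO_intros)
  then have "(\<lambda>g. \<Sum>I | q I \<alpha> \<noteq> 0. T I \<alpha> g - U I \<alpha> g) \<in> Div" for \<alpha> by (intro Div_sum)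
  then have QC: "(\<lambda>g. Q \<alpha> g - C \<alpha> g) \<in> Div" for \<alpha> by (simp add: Q_def C_def sum_subtractf)
  have Q: "Q \<alpha> \<in> MDO" for \<alpha> using famQ unfolding local_family_def by blast
  show ?thesis
  proof
    assume "characteristic A = (\<lambda>_. 0)"
    then have "C \<alpha> = (\<lambda>_. 0)" for \<alpha> using local_sum_unique[OF famC] chC by simp
    then have "Q \<alpha> \<in> Div" for \<alpha> using QC[of \<alpha>] by simp
    \<comment> \<open>The potentials are taken to be 0 where \<open>Q \<alpha>\<close> is 0, so that
      they form a local family.\<close>
    then have "\<exists>B. (\<forall>i. B i \<in> MDO) \<and> Q \<alpha> = (\<lambda>g. \<Sum>i\<in>UNIV. total_deriv i (B i g)) \<and>
        (Q \<alpha> = (\<lambda>_. 0) \<longrightarrow> (\<forall>i. B i = (\<lambda>_. 0)))" for \<alpha>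
    proof (cases "Q \<alpha> = (\<lambda>_. 0)")
      case True
      then show ?thesis by (intro exI[of _ "\<lambda>_ _. 0"]) (simp add: MDO_intros)
    next
      case False
      then show ?thesis using \<open>Q \<alpha> \<in> Div\<close> unfolding Div_def by auto
    qed
    then have "\<forall>\<alpha>. \<exists>B. (\<forall>i. B i \<in> MDO) \<and> Q \<alpha> = (\<lambda>g. \<Sum>i\<in>UNIV. total_deriv i (B i g)) \<and>
        (Q \<alpha> = (\<lambda>_. 0) \<longrightarrow> (\<forall>i. B i = (\<lambda>_. 0)))" by (rule allI)
    from choice[OF this] obtain B where B: "\<And>\<alpha> i. B \<alpha> i \<in> MDO"
      "\<And>\<alpha>. Q \<alpha> = (\<lambda>g. \<Sum>i\<in>UNIV. total_deriv i (B \<alpha> i g))"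
      "\<And>\<alpha> i. Q \<alpha> = (\<lambda>_. 0) \<Longrightarrow> B \<alpha> i = (\<lambda>_. 0)" by blast
    have famB: "local_family (\<lambda>\<alpha>. B \<alpha> i) (\<lambda>\<alpha>. \<alpha>)" for i
      unfolding local_family_def
    proof (intro conjI allI B(1))
      fix m
      have "{\<alpha>. B \<alpha> i \<noteq> (\<lambda>_. 0) \<and> (\<Sum>j\<in>UNIV. deg_f (\<alpha> j)) \<le> m}
        \<subseteq> {\<alpha>. Q \<alpha> \<noteq> (\<lambda>_. 0) \<and> (\<Sum>j\<in>UNIV. deg_f (\<alpha> j)) \<le> m}"
        using B(3) by blast
      then show "finite {\<alpha>. B \<alpha> i \<noteq> (\<lambda>_. 0) \<and> (\<Sum>j\<in>UNIV. deg_f (\<alpha> j)) \<le> m}"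
        using famQ finite_subset unfolding local_family_def by blast
    qed
    have "Q = (\<lambda>\<alpha> g. \<Sum>i\<in>UNIV. total_deriv i (B \<alpha> i g))" using B(2) by blast
    then have "local_sum Q (\<lambda>\<alpha>. \<alpha>) = local_sum (\<lambda>\<alpha> g. \<Sum>i\<in>UNIV. total_deriv i (B \<alpha> i g)) (\<lambda>\<alpha>. \<alpha>)"
      by (rule arg_cong)
    then have "A = (\<lambda>f. \<Sum>i\<in>UNIV. total_deriv i (local_sum (\<lambda>\<alpha>. B \<alpha> i) (\<lambda>\<alpha>. \<alpha>) f))"
      using local_sum_linear[of UNIV "\<lambda>i \<alpha>. B \<alpha> i" "\<lambda>\<alpha>. \<alpha>" total_deriv, OF finite famB linear_total_deriv]
      by (intro ext) (simp only: AQ)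
    then show "\<exists>B. (\<forall>i. B i \<in> LDO) \<and> A = (\<lambda>f. \<Sum>i\<in>UNIV. total_deriv i (B i f))"
      by (intro exI[of _ "\<lambda>i. local_sum (\<lambda>\<alpha>. B \<alpha> i) (\<lambda>\<alpha>. \<alpha>)"]) (auto intro: local_sum_in_LDO famB)
  next
    assume "\<exists>B. (\<forall>i. B i \<in> LDO) \<and> A = (\<lambda>f. \<Sum>i\<in>UNIV. total_deriv i (B i f))"
    then obtain B where B: "\<And>i. B i \<in> LDO" "A = (\<lambda>f. \<Sum>i\<in>UNIV. total_deriv i (B i f))" by blast
    have "\<forall>i. \<exists>R. local_family R (\<lambda>\<alpha>. \<alpha>) \<and> B i = local_sum R (\<lambda>\<alpha>. \<alpha>)"
      using B(1) by (metis LDO_family)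
    from choice[OF this] obtain R where R: "\<And>i. local_family (R i) (\<lambda>\<alpha>. \<alpha>)" "\<And>i. B i = local_sum (R i) (\<lambda>\<alpha>. \<alpha>)"
      by blast
    have RM: "R i \<alpha> \<in> MDO" for i \<alpha> using R(1) unfolding local_family_def by blast
    \<comment> \<open>The identity "A minus divergence equals 0" becomes one family indexed by
      \<open>'d option\<close>, with \<open>None\<close> standing for A, so that uniqueness applies
      to its components.\<close>
    let ?L = "\<lambda>s. case s of None \<Rightarrow> (\<lambda>x. x) | Some i \<Rightarrow> (\<lambda>x. - total_deriv i x)"
    let ?F = "\<lambda>s. case s of None \<Rightarrow> Q | Some i \<Rightarrow> R i"
    have lin: "linear (?L s)" for s
      by (cases s) (auto intro!: linearI simp: total_deriv_add total_deriv_scaleR)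
    have fam: "local_family (?F s) (\<lambda>\<alpha>. \<alpha>)" for s by (cases s) (auto simp: famQ R)
    have optsum: "(\<Sum>s\<in>UNIV. h s) = h None + (\<Sum>i\<in>UNIV. h (Some i))" for h :: "'d option \<Rightarrow> 'd loc"
      by (simp add: UNIV_option_conv sum.reindex)
    have M: "(\<lambda>g. \<Sum>s\<in>UNIV. ?L s (?F s \<alpha> g)) \<in> MDO" for \<alpha>
      unfolding optsum by (simp add: MDO_intros MDO_total_deriv Q RM)
    have "local_sum (\<lambda>\<alpha> g. \<Sum>s\<in>UNIV. ?L s (?F s \<alpha> g)) (\<lambda>\<alpha>. \<alpha>) = (\<lambda>_. 0)"
      using local_sum_linear[of UNIV ?F "\<lambda>\<alpha>. \<alpha>" ?L, OF _ fam lin]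
      by (simp add: fun_eq_iff optsum AQ[symmetric] R(2)[symmetric] B(2) sum_negf)
    then have "(\<lambda>g. \<Sum>s\<in>UNIV. ?L s (?F s \<alpha> g)) = (\<lambda>_. 0)" for \<alpha>
      by (rule local_sum_unique[OF local_family_linear, rotated -1]) (auto intro: fam M lin)
    then have "Q \<alpha> = (\<lambda>g. \<Sum>i\<in>UNIV. total_deriv i (R i \<alpha> g))" for \<alpha>
      by (simp add: optsum fun_eq_iff sum_negf)
    then have "Q \<alpha> \<in> Div" for \<alpha>
      unfolding Div_def by (intro CollectI exI[of _ "\<lambda>i. R i \<alpha>"] conjI) (auto intro: RM)
    then have "(\<lambda>g. Q \<alpha> g + - (Q \<alpha> g - C \<alpha> g)) \<in> Div" for \<alpha> by (intro Div_add Div_uminus QC)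
    then have "C \<alpha> \<in> Div" for \<alpha> by simp
    then have "C \<alpha> g = 0" for \<alpha> g by (rule MDO0_Div_trivial[OF C0])
    then show "characteristic A = (\<lambda>_. 0)" by (simp add: chC local_sum_def fun_eq_iff)
  qed
qed

text \<open>Uniqueness of components makes each of them closed, so \<open>MDO_exact\<close> applies
  for every \<alpha>. By its support clause \<open>\<eta> \<alpha> \<epsilon>\<close> is nonzero
  only if some \<open>Q (insert i \<epsilon>) \<alpha>\<close> is; as i ranges over a finite type,
  the primitives form a local family.\<close>

lemma LDO_exact:
  fixes \<omega> :: "'d::{finite,linorder} set \<Rightarrow> ('n::{finite,linorder}, 'd) multiop"
  assumes \<omega>: "\<And>\<epsilon>. \<omega> \<epsilon> \<in> LDO" "\<omega> UNIV = (\<lambda>_. 0)" and closed: "\<And>\<epsilon>. op_d \<omega> \<epsilon> = (\<lambda>_. 0)"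
  shows "\<exists>\<eta>. (\<forall>\<epsilon>. \<eta> \<epsilon> \<in> LDO) \<and> op_d \<eta> = \<omega>
    \<and> (\<forall>\<epsilon>. (\<forall>i. i \<notin> \<epsilon> \<longrightarrow> \<omega> (insert i \<epsilon>) = (\<lambda>_. 0)) \<longrightarrow> \<eta> \<epsilon> = (\<lambda>_. 0))"
proof -
  have "\<forall>\<epsilon>. \<exists>Q. local_family Q (\<lambda>\<alpha>. \<alpha>) \<and> \<omega> \<epsilon> = local_sum Q (\<lambda>\<alpha>. \<alpha>)"
    using \<omega>(1) by (metis LDO_family)
  from choice[OF this] obtain Q where Q: "\<And>\<epsilon>. local_family (Q \<epsilon>) (\<lambda>\<alpha>. \<alpha>)" "\<And>\<epsilon>. \<omega> \<epsilon> = local_sum (Q \<epsilon>) (\<lambda>\<alpha>. \<alpha>)"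
    by blast
  have QM: "Q \<epsilon> \<alpha> \<in> MDO" for \<epsilon> \<alpha> using Q(1) unfolding local_family_def by blast
  have Q0: "Q \<epsilon> \<alpha> = (\<lambda>_. 0)" if "\<omega> \<epsilon> = (\<lambda>_. 0)" for \<epsilon> \<alpha>
    using local_sum_unique[OF Q(1)] that Q(2) by metis
  let ?L = "\<lambda>\<epsilon> i x. wsign i \<epsilon> *\<^sub>R total_deriv i x"
  have lin: "linear (?L \<epsilon> i)" for \<epsilon> :: "'d set" and i
    by (auto intro!: linearI simp: total_deriv_add total_deriv_scaleR scaleR_add_right)
  have op_d_local_sum: "op_d (\<lambda>\<epsilon>. local_sum (R \<epsilon>) (\<lambda>\<alpha>. \<alpha>)) \<epsilon> = local_sum (\<lambda>\<alpha>. op_d (\<lambda>\<epsilon>. R \<epsilon> \<alpha>) \<epsilon>) (\<lambda>\<alpha>. \<alpha>)"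
    if "\<And>\<epsilon>. local_family (R \<epsilon>) (\<lambda>\<alpha>. \<alpha>)" for R :: "'d set \<Rightarrow> ('n \<Rightarrow> 'd vindex) \<Rightarrow> ('n, 'd) multiop" and \<epsilon>
    using local_sum_linear[of \<epsilon> "\<lambda>i. R (\<epsilon> - {i})" "\<lambda>\<alpha>. \<alpha>" "?L \<epsilon>", OF _ that lin]
    by (simp add: fun_eq_iff op_d_def[abs_def])
  have "op_d (\<lambda>\<epsilon>. Q \<epsilon> \<alpha>) \<epsilon> = (\<lambda>_. 0)" for \<epsilon> \<alpha>
  proof (rule local_sum_unique[of "\<lambda>\<alpha>. op_d (\<lambda>\<epsilon>. Q \<epsilon> \<alpha>) \<epsilon>"])
    have M: "(\<lambda>g. \<Sum>i\<in>\<epsilon>. ?L \<epsilon> i (Q (\<epsilon> - {i}) \<alpha> g)) \<in> MDO" for \<alpha>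
      by (intro MDO_intros MDO_total_deriv QM)
    show "local_family (\<lambda>\<alpha>. op_d (\<lambda>\<epsilon>. Q \<epsilon> \<alpha>) \<epsilon>) (\<lambda>\<alpha>. \<alpha>)"
      using local_family_linear[of \<epsilon> "\<lambda>i. Q (\<epsilon> - {i})" "\<lambda>\<alpha>. \<alpha>" "?L \<epsilon>", OF _ Q(1) M lin]
      by (simp add: op_d_def[abs_def])
    have "\<omega> = (\<lambda>\<epsilon>. local_sum (Q \<epsilon>) (\<lambda>\<alpha>. \<alpha>))" using Q(2) by blast
    then show "local_sum (\<lambda>\<alpha>. op_d (\<lambda>\<epsilon>. Q \<epsilon> \<alpha>) \<epsilon>) (\<lambda>\<alpha>. \<alpha>) = (\<lambda>_. 0)"
      using closed[of \<epsilon>] op_d_local_sum[OF Q(1)] by simp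
  qed
  then have "\<exists>\<eta>. (\<forall>\<epsilon>. \<eta> \<epsilon> \<in> MDO) \<and> op_d \<eta> = (\<lambda>\<epsilon>. Q \<epsilon> \<alpha>)
    \<and> (\<forall>\<epsilon>. (\<forall>i. i \<notin> \<epsilon> \<longrightarrow> Q (insert i \<epsilon>) \<alpha> = (\<lambda>_. 0)) \<longrightarrow> \<eta> \<epsilon> = (\<lambda>_. 0))" for \<alpha>
    by (intro MDO_exact QM Q0 \<omega>(2))
  then have "\<forall>\<alpha>. \<exists>\<eta>. (\<forall>\<epsilon>. \<eta> \<epsilon> \<in> MDO) \<and> op_d \<eta> = (\<lambda>\<epsilon>. Q \<epsilon> \<alpha>)
    \<and> (\<forall>\<epsilon>. (\<forall>i. i \<notin> \<epsilon> \<longrightarrow> Q (insert i \<epsilon>) \<alpha> = (\<lambda>_. 0)) \<longrightarrow> \<eta> \<epsilon> = (\<lambda>_. 0))" by (rule allI)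
  from choice[OF this] obtain \<eta> where \<eta>: "\<And>\<alpha> \<epsilon>. \<eta> \<alpha> \<epsilon> \<in> MDO" "\<And>\<alpha>. op_d (\<eta> \<alpha>) = (\<lambda>\<epsilon>. Q \<epsilon> \<alpha>)"
    "\<And>\<alpha> \<epsilon>. (\<And>i. i \<notin> \<epsilon> \<Longrightarrow> Q (insert i \<epsilon>) \<alpha> = (\<lambda>_. 0)) \<Longrightarrow> \<eta> \<alpha> \<epsilon> = (\<lambda>_. 0)" by blast
  have fam\<eta>: "local_family (\<lambda>\<alpha>. \<eta> \<alpha> \<epsilon>) (\<lambda>\<alpha>. \<alpha>)" for \<epsilon>
    unfolding local_family_def
  proof (intro conjI allI \<eta>(1))
    fix m
    have "{\<alpha>. \<eta> \<alpha> \<epsilon> \<noteq> (\<lambda>_. 0) \<and> (\<Sum>j\<in>UNIV. deg_f (\<alpha> j)) \<le> m}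
      \<subseteq> (\<Union>i. {\<alpha>. Q (insert i \<epsilon>) \<alpha> \<noteq> (\<lambda>_. 0) \<and> (\<Sum>j\<in>UNIV. deg_f (\<alpha> j)) \<le> m})"
      using \<eta>(3) by blast
    moreover have "finite (\<Union>i. {\<alpha>. Q (insert i \<epsilon>) \<alpha> \<noteq> (\<lambda>_. 0) \<and> (\<Sum>j\<in>UNIV. deg_f (\<alpha> j)) \<le> m})"
    proof (rule finite_UN_I)
      show "finite {\<alpha>. Q (insert i \<epsilon>) \<alpha> \<noteq> (\<lambda>_. 0) \<and> (\<Sum>j\<in>UNIV. deg_f (\<alpha> j)) \<le> m}" for i
        using Q(1)[of "insert i \<epsilon>"] unfolding local_family_def by blast
    qed simp
    ultimately show "finite {\<alpha>. \<eta> \<alpha> \<epsilon> \<noteq> (\<lambda>_. 0) \<and> (\<Sum>j\<in>UNIV. deg_f (\<alpha> j)) \<le> m}"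
      by (rule finite_subset)
  qed
  show ?thesis
  proof (intro exI[of _ "\<lambda>\<epsilon>. local_sum (\<lambda>\<alpha>. \<eta> \<alpha> \<epsilon>) (\<lambda>\<alpha>. \<alpha>)"] conjI allI impI)
    show "local_sum (\<lambda>\<alpha>. \<eta> \<alpha> \<epsilon>) (\<lambda>\<alpha>. \<alpha>) \<in> LDO" for \<epsilon> by (rule local_sum_in_LDO[OF fam\<eta>])
    show "op_d (\<lambda>\<epsilon>. local_sum (\<lambda>\<alpha>. \<eta> \<alpha> \<epsilon>) (\<lambda>\<alpha>. \<alpha>)) = \<omega>"
      using op_d_local_sum[of "\<lambda>\<epsilon> \<alpha>. \<eta> \<alpha> \<epsilon>", OF fam\<eta>] \<eta>(2) Q(2) by (simp add: fun_eq_iff[where g = \<omega>])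
    fix \<epsilon>
    assume "\<forall>i. i \<notin> \<epsilon> \<longrightarrow> \<omega> (insert i \<epsilon>) = (\<lambda>_. 0)"
    then have "\<eta> \<alpha> \<epsilon> = (\<lambda>_. 0)" for \<alpha> by (intro \<eta>(3) Q0) auto
    then show "local_sum (\<lambda>\<alpha>. \<eta> \<alpha> \<epsilon>) (\<lambda>\<alpha>. \<alpha>) = (\<lambda>_. 0)" by (simp add: local_sum_def fun_eq_iff)
  qed
qed

section \<open>The horizontal differential\<close>

lemma minus_one_power_mult_loc: "(- 1) ^ n * (x :: 'd::finite loc) = ((- 1) ^ n :: real) *\<^sub>R x"
  by (cases "even n") auto

lemma d_H_nth: "d_H w $ \<epsilon> = (\<Sum>i\<in>\<epsilon>. wsign i \<epsilon> *\<^sub>R total_deriv i (w $ (\<epsilon> - {i})))"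
proof -
  have "d_H w $ \<epsilon> = (\<Sum>i\<in>UNIV. if i \<in> \<epsilon> then wsign i \<epsilon> *\<^sub>R total_deriv i (w $ (\<epsilon> - {i})) else 0)"
    by (simp add: d_H_def wedge_dx_def wsign_def minus_one_power_mult_loc cong: if_cong)
  then show ?thesis by (simp add: sum.If_cases)
qed

lemma linear_d_H: "linear d_H"
  by (rule linearI)
    (simp_all add: vec_eq_iff d_H_nth total_deriv_add total_deriv_scaleR scaleR_add_right sum.distrib
      scaleR_sum_right scaleR_left_commute mult.commute)

lemma sum_antisymmetric:
  fixes F :: "'i \<Rightarrow> 'i \<Rightarrow> 'v::real_vector"
  assumes "finite S" "\<And>i k. i \<in> S \<Longrightarrow> k \<in> S \<Longrightarrow> i \<noteq> k \<Longrightarrow> F i k = - F k i"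
  shows "(\<Sum>i\<in>S. \<Sum>k\<in>S - {i}. F i k) = 0"
proof -
  let ?G = "\<lambda>i k. if i = k then 0 else F i k"
  have eq: "(\<Sum>i\<in>S. \<Sum>k\<in>S - {i}. F i k) = (\<Sum>i\<in>S. \<Sum>k\<in>S. ?G i k)"
    by (rule sum.cong[OF refl], rule sum.mono_neutral_cong_left) (use assms(1) in auto)
  have "(\<Sum>i\<in>S. \<Sum>k\<in>S. ?G i k) = (\<Sum>i\<in>S. \<Sum>k\<in>S. ?G k i)" by (rule sum.swap)
  also have "\<dots> = (\<Sum>i\<in>S. \<Sum>k\<in>S. - ?G i k)"
    by (intro sum.cong refl) (auto dest: assms(2))
  also have "\<dots> = - (\<Sum>i\<in>S. \<Sum>k\<in>S. ?G i k)" by (simp only: sum_negf)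
  finally have "2 *\<^sub>R (\<Sum>i\<in>S. \<Sum>k\<in>S. ?G i k) = 0"
    unfolding eq_neg_iff_add_eq_0 scaleR_2 .
  then have "(\<Sum>i\<in>S. \<Sum>k\<in>S. ?G i k) = 0" by simp
  then show ?thesis using eq by simp
qed

lemma wsign_antisymmetric:
  assumes "i \<in> \<epsilon>" "k \<in> \<epsilon>" "i \<noteq> k"
  shows "wsign i \<epsilon> * wsign k (\<epsilon> - {i}) = - (wsign k \<epsilon> * wsign i (\<epsilon> - {k}))"
proof -
  have "insert k (\<epsilon> - {k} - {i}) = \<epsilon> - {i}" "insert k (\<epsilon> - {k}) = \<epsilon>" using assms by auto
  then have *: "wsign i (\<epsilon> - {k}) * wsign k (\<epsilon> - {i}) = - (wsign k \<epsilon> * wsign i \<epsilon>)"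
    using wsign_exchange[of i "\<epsilon> - {k}" k] assms by simp
  have "x * y = - (t * z)" if "z * y = - (t * x)" "x * x = 1" "z * z = 1" for x y z t :: real
    using that by algebra
  from this[OF *] show ?thesis by simp
qed

lemma d_H_d_H: "d_H (d_H w) = 0"
proof -
  have "d_H (d_H w) $ \<epsilon> = 0" for \<epsilon>
  proof -
    have "d_H (d_H w) $ \<epsilon> = (\<Sum>i\<in>\<epsilon>. \<Sum>k\<in>\<epsilon> - {i}. (wsign i \<epsilon> * wsign k (\<epsilon> - {i}))
        *\<^sub>R total_deriv i (total_deriv k (w $ (\<epsilon> - {i} - {k}))))"
      by (simp add: d_H_nth total_deriv_sum total_deriv_scaleR scaleR_sum_right)
    also have "\<dots> = 0"
    proof (rule sum_antisymmetric)
      fix i k assume ik: "i \<in> \<epsilon>" "k \<in> \<epsilon>" "i \<noteq> k"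
      have "\<epsilon> - {i} - {k} = \<epsilon> - {k} - {i}" by auto
      then show "(wsign i \<epsilon> * wsign k (\<epsilon> - {i})) *\<^sub>R total_deriv i (total_deriv k (w $ (\<epsilon> - {i} - {k})))
        = - ((wsign k \<epsilon> * wsign i (\<epsilon> - {k})) *\<^sub>R total_deriv k (total_deriv i (w $ (\<epsilon> - {k} - {i}))))"
        by (simp add: wsign_antisymmetric[OF ik] total_deriv_commute[of i k])
    qed simp
    finally show ?thesis .
  qed
  then show ?thesis by (simp add: vec_eq_iff)
qed

lemma d_H_Omega_Suc:
  assumes "w \<in> Omega (Suc s)" shows "d_H w \<in> Omega s"
  unfolding Omega_def
proof (intro CollectI allI impI)
  fix \<epsilon> assume "d_H w $ \<epsilon> \<noteq> 0"
  then have "\<exists>i\<in>\<epsilon>. wsign i \<epsilon> *\<^sub>R total_deriv i (w $ (\<epsilon> - {i})) \<noteq> 0"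
    unfolding d_H_nth by (meson sum.neutral)
  then obtain i where i: "i \<in> \<epsilon>" "w $ (\<epsilon> - {i}) \<noteq> 0" by fastforce
  then have "card (\<epsilon> - {i}) + Suc s = CARD('a)" using assms by (auto simp: Omega_def)
  then show "card \<epsilon> + s = CARD('a)" using card_Suc_Diff1[of \<epsilon> i] i(1) by simp
qed

lemma d_H_Omega_0:
  assumes "w \<in> Omega 0" shows "d_H w = 0"
proof -
  have "w $ (\<epsilon> - {i}) = 0" if "i \<in> \<epsilon>" for i \<epsilon>
  proof (rule ccontr)
    assume "w $ (\<epsilon> - {i}) \<noteq> 0"
    then have "card (\<epsilon> - {i}) = CARD('a)" using assms by (auto simp: Omega_def)
    then have "\<epsilon> - {i} = UNIV" by (simp add: card_eq_UNIV_imp_eq_UNIV)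
    then show False by blast
  qed
  then show ?thesis by (simp add: vec_eq_iff d_H_nth)
qed

lemma axis_Omega: "h \<noteq> 0 \<Longrightarrow> axis \<epsilon> h \<in> Omega s \<longleftrightarrow> card \<epsilon> + s = CARD('d)"
  for \<epsilon> :: "'d::finite set"
  by (auto simp: Omega_def axis_def)

lemma d_H_axis: "d_H (axis \<epsilon> h) = (\<Sum>i\<in>-\<epsilon>. wsign i (insert i \<epsilon>) *\<^sub>R axis (insert i \<epsilon>) (total_deriv i h))"
proof -
  have "d_H (axis \<epsilon> h) $ \<delta> = (\<Sum>i\<in>-\<epsilon>. wsign i (insert i \<epsilon>) *\<^sub>R axis (insert i \<epsilon>) (total_deriv i h)) $ \<delta>" for \<delta>
  proof -
    have "d_H (axis \<epsilon> h) $ \<delta> = (\<Sum>i\<in>UNIV. if i \<in> \<delta> \<and> \<delta> - {i} = \<epsilon> then wsign i \<delta> *\<^sub>R total_deriv i h else 0)"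
      unfolding d_H_nth by (rule sum.mono_neutral_cong_left) (auto simp: axis_def)
    also have "\<dots> = (\<Sum>i\<in>-\<epsilon>. wsign i (insert i \<epsilon>) *\<^sub>R (axis (insert i \<epsilon>) (total_deriv i h) $ \<delta>))"
      by (rule sum.mono_neutral_cong_right) (auto simp: axis_def insert_absorb)
    finally show ?thesis by simp
  qed
  then show ?thesis by (simp add: vec_eq_iff)
qed

section \<open>Multilinear maps on tuples of forms\<close>

abbreviation basis_tuple :: "('n \<Rightarrow> 'd::finite set) \<Rightarrow> ('n \<Rightarrow> 'd loc) \<Rightarrow> 'n \<Rightarrow> 'd form" where
  "basis_tuple E h \<equiv> \<lambda>j. axis (E j) (h j)"

lemma multilinear_slot_zero: "multilinear F \<Longrightarrow> w j = 0 \<Longrightarrow> F w = 0"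
  unfolding multilinear_def by (metis fun_upd_triv linear_0)

text \<open>Induction on a set of slots containing all those that hold no basis form; one slot is
  expanded into components, each homogeneous of the same degree.\<close>

lemma multilinear_ext:
  fixes F G :: "('n::finite, 'd::finite) tensor_map"
  assumes "multilinear F" "multilinear G"
    and eq: "\<And>E h. (\<And>j. axis (E j) (h j) \<in> Omega (k j)) \<Longrightarrow> F (basis_tuple E h) = G (basis_tuple E h)"
    and w: "\<And>j. w j \<in> Omega (k j)"
  shows "F w = G w"
proof -
  have "(\<And>j. w j \<in> Omega (k j)) \<Longrightarrow> (\<And>j. j \<notin> S \<Longrightarrow> \<exists>\<epsilon> h. w j = axis \<epsilon> h) \<Longrightarrow> F w = G w" if "finite S" for S w
    using that
  proof (induction S arbitrary: w rule: finite_induct)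
    case empty
    then have "\<forall>j. \<exists>\<epsilon> h. w j = axis \<epsilon> h" by simp
    then obtain E h where Eh: "\<And>j. w j = axis (E j) (h j)" by metis
    then have "w = basis_tuple E h" by (rule ext)
    moreover have "axis (E j) (h j) \<in> Omega (k j)" for j using empty.prems(1)[of j] Eh by simp
    ultimately show ?case using eq[of E h] by simp
  next
    case (insert j S)
    have wj: "w = w(j := \<Sum>\<epsilon>\<in>UNIV. axis \<epsilon> (w j $ \<epsilon>))"
    proof -
      have "(\<Sum>\<epsilon>\<in>UNIV. axis \<epsilon> (w j $ \<epsilon>)) = w j"
        by (simp add: vec_eq_iff axis_def)
      then show ?thesis by simp
    qed
    have lin: "H w = (\<Sum>\<epsilon>\<in>UNIV. H (w(j := axis \<epsilon> (w j $ \<epsilon>))))" if "multilinear H" for H :: "('n, 'd) tensor_map"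
    proof -
      have "linear (\<lambda>v. H (w(j := v)))" using that unfolding multilinear_def by blast
      then show ?thesis by (subst wj) (rule linear_sum)
    qed
    have "F (w(j := axis \<epsilon> (w j $ \<epsilon>))) = G (w(j := axis \<epsilon> (w j $ \<epsilon>)))" for \<epsilon>
    proof (rule insert.IH)
      show "(w(j := axis \<epsilon> (w j $ \<epsilon>))) l \<in> Omega (k l)" for l
        using insert.prems(1)[of l] by (auto simp: Omega_def axis_def)
      show "\<exists>\<delta> h. (w(j := axis \<epsilon> (w j $ \<epsilon>))) l = axis \<delta> h" if "l \<notin> S" for l
        using insert.prems(2)[of l] that by auto
    qed
    then show ?case by (simp only: lin[OF assms(1)] lin[OF assms(2)])
  qed
  from this[of UNIV w] w show ?thesis by simp
qed

lemma multilinear_comp_d_H: "multilinear F \<Longrightarrow> multilinear (\<lambda>w. d_H (F w))"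
  unfolding multilinear_def using linear_compose[OF _ linear_d_H] by (fastforce simp: comp_def)

lemma multilinear_comp_tensor_d:
  assumes "multilinear F" shows "multilinear (comp_tensor_d F k)"
  unfolding multilinear_def comp_tensor_d_def
proof (intro allI linear_compose_sum ballI)
  fix w l j
  have F: "linear (\<lambda>v. F (w(l := v)))" for w l using assms unfolding multilinear_def by blast
  have "linear (\<lambda>v. F ((w(l := v))(j := d_H ((w(l := v)) j))))"
  proof (cases "l = j")
    case True
    then show ?thesis using linear_compose[OF linear_d_H F[of w j]] by (simp add: comp_def)
  next
    case False
    then show ?thesis using F[of "w(j := d_H (w j))" l] by (simp add: fun_upd_twist)
  qed
  then show "linear (\<lambda>v. (- 1) ^ (\<Sum>l | l < j. k l) *\<^sub>R F ((w(l := v))(j := d_H ((w(l := v)) j))))"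
    by (rule linear_compose_scale_right)
qed

text \<open>Degree \<open>k j = 0\<close> cannot be lowered; there \<open>d_H (w j)\<close> is 0 and
  multilinearity makes both summands vanish.\<close>

lemma comp_tensor_d_cong:
  assumes "\<And>j. w j \<in> Omega (k j)" "(\<Sum>j\<in>UNIV. k j) = Suc s" "multilinear F" "multilinear G"
    and "\<And>k' w'. (\<Sum>j\<in>UNIV. k' j) = s \<Longrightarrow> (\<And>j. w' j \<in> Omega (k' j)) \<Longrightarrow> F w' = G w'"
  shows "comp_tensor_d F k w = comp_tensor_d G k w"
  unfolding comp_tensor_d_def
proof (rule sum.cong[OF refl])
  fix j
  have "F (w(j := d_H (w j))) = G (w(j := d_H (w j)))"
  proof (cases "k j")
    case 0
    then have "d_H (w j) = 0" using d_H_Omega_0 assms(1) by metis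
    then show ?thesis
      using multilinear_slot_zero[OF assms(3), of "w(j := d_H (w j))" j]
        multilinear_slot_zero[OF assms(4), of "w(j := d_H (w j))" j] by simp
  next
    case (Suc m)
    show ?thesis
    proof (rule assms(5)[of "k(j := m)"])
      show "(w(j := d_H (w j))) l \<in> Omega ((k(j := m)) l)" for l
        using assms(1)[of l] Suc d_H_Omega_Suc by auto
      have "(\<Sum>l\<in>UNIV. (k(j := m)) l) = m + (\<Sum>l\<in>UNIV - {j}. k l)"
        by (subst sum.remove[of _ j]) (auto intro!: sum.cong)
      then show "(\<Sum>l\<in>UNIV. (k(j := m)) l) = s"
        using assms(2) Suc by (simp add: sum.remove[of UNIV j k])
    qed
  qed
  then show "(- 1) ^ (\<Sum>l | l < j. k l) *\<^sub>R F (w(j := d_H (w j))) = (- 1) ^ (\<Sum>l | l < j. k l) *\<^sub>R G (w(j := d_H (w j)))"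
    by simp
qed

text \<open>This is d o d = 0 on the tensor power, stated for maps out of it. Terms with both
  differentials in one slot die by \<open>d_H_d_H\<close>; for distinct slots the coefficients
  \<open>c\<close> are antisymmetric and the values \<open>X\<close> symmetric.\<close>

lemma comp_tensor_d_twice:
  fixes F G :: "('n::{finite,linorder}, 'd::{finite,linorder}) tensor_map"
  assumes w: "\<And>j. w j \<in> Omega (k j)" and k: "(\<Sum>j\<in>UNIV. k j) = Suc s"
    and F: "multilinear F" and G: "multilinear G"
    and FG: "\<And>k' w'. (\<Sum>j\<in>UNIV. k' j) = s \<Longrightarrow> (\<And>j. w' j \<in> Omega (k' j)) \<Longrightarrow> F w' = comp_tensor_d G k' w'"
  shows "comp_tensor_d F k w = 0"
proof -
  define sg where "sg k j = ((- 1) ^ (\<Sum>l | l < j. k l) :: real)" for k :: "'n \<Rightarrow> nat" and j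
  define X where "X j l = G (w(j := d_H (w j), l := d_H (w l)))" for j l
  define c where "c j l = sg k j * sg k l * (if j < l then -1 else 1)" for j l
  have summand: "sg k j *\<^sub>R F (w(j := d_H (w j))) = (\<Sum>l\<in>UNIV - {j}. c j l *\<^sub>R X j l)" for j
  proof (cases "k j")
    case 0
    then have z: "d_H (w j) = 0" using d_H_Omega_0 w by metis
    have "X j l = 0" if "l \<noteq> j" for l
      unfolding X_def using that z by (intro multilinear_slot_zero[OF G, of _ j]) simp
    moreover have "F (w(j := d_H (w j))) = 0" using z by (intro multilinear_slot_zero[OF F, of _ j]) simp
    ultimately show ?thesis by simp
  next
    case (Suc m)
    let ?w = "w(j := d_H (w j))" and ?k = "k(j := m)"
    have hom: "?w l \<in> Omega (?k l)" for l
      using w[of l] Suc d_H_Omega_Suc by auto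
    have "(\<Sum>l\<in>UNIV. ?k l) = m + (\<Sum>l\<in>UNIV - {j}. k l)"
      by (subst sum.remove[of _ j]) (auto intro!: sum.cong)
    then have "(\<Sum>l\<in>UNIV. ?k l) = s"
      using k Suc by (simp add: sum.remove[of UNIV j k])
    then have "F ?w = (\<Sum>l\<in>UNIV. sg ?k l *\<^sub>R G (?w(l := d_H (?w l))))"
      using FG[of ?k ?w] hom by (simp add: comp_tensor_d_def sg_def del: fun_upd_apply)
    also have "\<dots> = (\<Sum>l\<in>UNIV - {j}. sg ?k l *\<^sub>R G (?w(l := d_H (?w l))))"
      by (rule sum.mono_neutral_right) (auto simp: d_H_d_H multilinear_slot_zero[OF G, of _ j])
    also have "\<dots> = (\<Sum>l\<in>UNIV - {j}. (sg k l * (if j < l then -1 else 1)) *\<^sub>R X j l)"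
    proof (rule sum.cong[OF refl])
      fix l assume l: "l \<in> UNIV - {j}"
      \<comment> \<open>Differentiating slot j lowers its degree by one, which flips the Koszul sign
        of the later slots and of no others.\<close>
      have "sg ?k l = sg k l * (if j < l then -1 else 1)"
      proof (cases "j < l")
        case True
        have "(\<Sum>i | i < l. k i) = k j + (\<Sum>i\<in>{i. i < l} - {j}. k i)"
          using True by (intro sum.remove) auto
        moreover have "(\<Sum>i | i < l. ?k i) = ?k j + (\<Sum>i\<in>{i. i < l} - {j}. ?k i)"
          using True by (intro sum.remove) auto
        moreover have "(\<Sum>i\<in>{i. i < l} - {j}. ?k i) = (\<Sum>i\<in>{i. i < l} - {j}. k i)"
          by (rule sum.cong) auto
        ultimately have "(\<Sum>i | i < l. k i) = Suc (\<Sum>i | i < l. ?k i)" using Suc by simp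
        then show ?thesis using True by (simp add: sg_def del: fun_upd_apply)
      next
        case False
        have "(\<Sum>i | i < l. ?k i) = (\<Sum>i | i < l. k i)"
          using False by (intro sum.cong) auto
        then show ?thesis using False by (simp add: sg_def del: fun_upd_apply)
      qed
      then show "sg ?k l *\<^sub>R G (?w(l := d_H (?w l))) = (sg k l * (if j < l then -1 else 1)) *\<^sub>R X j l"
        using l by (simp add: X_def)
    qed
    finally show ?thesis by (simp add: scaleR_sum_right c_def mult.assoc)
  qed
  have "comp_tensor_d F k w = (\<Sum>j\<in>UNIV. \<Sum>l\<in>UNIV - {j}. c j l *\<^sub>R X j l)"
    unfolding comp_tensor_d_def summand[symmetric] sg_def ..
  also have "\<dots> = 0"
  proof (rule sum_antisymmetric)
    fix j l :: 'n assume "j \<noteq> l"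
    then have "c j l = - c l j" "X j l = X l j"
      by (auto simp: c_def X_def fun_upd_twist)
    then show "c j l *\<^sub>R X j l = - (c l j *\<^sub>R X l j)" by simp
  qed simp
  finally show ?thesis .
qed

lemma d_H_comp_tensor_d: "d_H (comp_tensor_d F k w) = comp_tensor_d (\<lambda>w. d_H (F w)) k w"
  by (simp add: comp_tensor_d_def linear_sum[OF linear_d_H] linear_scale[OF linear_d_H])

section \<open>Maps with matrix coefficients in LDO\<close>

definition tuple_degree :: "('n::finite \<Rightarrow> 'd::finite set) \<Rightarrow> nat" where
  "tuple_degree E = (\<Sum>j\<in>UNIV. CARD('d) - card (E j))"

text \<open>On a basis tuple only its own matrix entry survives, because operators in
  \<open>LDO\<close> vanish when a slot is 0.\<close>

definition matrix_map :: "(('n::finite \<Rightarrow> 'd::finite set) \<Rightarrow> 'd set \<Rightarrow> ('n, 'd) multiop) \<Rightarrow> ('n, 'd) tensor_map" where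
  "matrix_map A w = (\<chi> \<epsilon>. \<Sum>E\<in>UNIV. A E \<epsilon> (\<lambda>j. w j $ E j))"

lemma LDO_slot_zero: "A \<in> LDO \<Longrightarrow> f j = 0 \<Longrightarrow> A f = 0"
  using linear_0[OF LDO_linear[of A f j]] by (metis fun_upd_triv)

lemma multilinear_matrix_map:
  fixes A :: "('n::finite \<Rightarrow> 'd::finite set) \<Rightarrow> 'd set \<Rightarrow> ('n, 'd) multiop"
  assumes "\<And>E \<epsilon>. A E \<epsilon> \<in> LDO"
  shows "multilinear (matrix_map A)"
  unfolding multilinear_def
proof (intro allI)
  fix w :: "'n \<Rightarrow> 'd form" and l
  have eq: "(\<lambda>j. (w(l := v)) j $ E j) = (\<lambda>j. w j $ E j)(l := v $ E l)" for E v by auto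
  have 1: "A E \<epsilon> (\<lambda>j. (w(l := u + v)) j $ E j) = A E \<epsilon> (\<lambda>j. (w(l := u)) j $ E j) + A E \<epsilon> (\<lambda>j. (w(l := v)) j $ E j)" for E \<epsilon> u v
    unfolding eq using linear_add[OF LDO_linear[OF assms]] by simp
  have 2: "A E \<epsilon> (\<lambda>j. (w(l := r *\<^sub>R v)) j $ E j) = r *\<^sub>R A E \<epsilon> (\<lambda>j. (w(l := v)) j $ E j)" for E \<epsilon> r v
    unfolding eq using linear_scale[OF LDO_linear[OF assms]] by simp
  show "linear (\<lambda>v. matrix_map A (w(l := v)))"
    by (rule linearI)
      (simp_all add: vec_eq_iff matrix_map_def 1 2 sum.distrib scaleR_sum_right del: fun_upd_apply)
qed

lemma matrix_map_basis:
  assumes "\<And>E \<epsilon>. A E \<epsilon> \<in> LDO"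
  shows "matrix_map A (basis_tuple E h) $ \<epsilon> = A E \<epsilon> h"
proof -
  have "A E' \<epsilon> (\<lambda>j. basis_tuple E h j $ E' j) = (if E' = E then A E \<epsilon> h else 0)" for E'
  proof (cases "E' = E")
    case False
    then obtain j where "E' j \<noteq> E j" by (metis ext)
    then have "basis_tuple E h j $ E' j = 0" by (simp add: axis_def)
    then show ?thesis using False LDO_slot_zero[OF assms] by simp
  qed (simp add: axis_def)
  then show ?thesis by (simp add: matrix_map_def)
qed

lemma LDO_map_matrix_map:
  fixes A :: "('n::finite \<Rightarrow> 'd::finite set) \<Rightarrow> 'd set \<Rightarrow> ('n, 'd) multiop"
  assumes LDO: "\<And>E \<epsilon>. A E \<epsilon> \<in> LDO"
    and zero: "\<And>E \<epsilon>. tuple_degree E \<noteq> s \<or> card \<epsilon> + s \<noteq> CARD('d) \<Longrightarrow> A E \<epsilon> = (\<lambda>_. 0)"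
  shows "LDO_map s (matrix_map A)"
  unfolding LDO_map_def
proof (intro conjI exI[of _ A] allI LDO multilinear_matrix_map)
  fix E h
  have "(\<Sum>\<epsilon>\<in>{\<epsilon>. card \<epsilon> + s = CARD('d)}. axis \<epsilon> (A E \<epsilon> h)) $ \<delta> = A E \<delta> h" for \<delta>
    using zero[of E \<delta>] by (auto simp: axis_def)
  then show "matrix_map A (basis_tuple E h) = (if (\<Sum>j\<in>UNIV. CARD('d) - card (E j)) = s
      then \<Sum>\<epsilon>\<in>{\<epsilon>. card \<epsilon> + s = CARD('d)}. axis \<epsilon> (A E \<epsilon> h) else 0)"
    using zero[of E] by (auto simp: vec_eq_iff matrix_map_basis[OF LDO] tuple_degree_def)
qed

lemma LDO_map_multilinear: "LDO_map s F \<Longrightarrow> multilinear F"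
  unfolding LDO_map_def by blast

lemma LDO_map_entry:
  fixes F :: "('n::finite, 'd::finite) tensor_map"
  assumes "LDO_map s F"
  shows "(\<lambda>h. F (basis_tuple E h) $ \<epsilon>) \<in> LDO"
    and "tuple_degree E \<noteq> s \<or> card \<epsilon> + s \<noteq> CARD('d) \<Longrightarrow> F (basis_tuple E h) $ \<epsilon> = 0"
proof -
  obtain A where A: "\<And>E \<epsilon>. A E \<epsilon> \<in> LDO" "\<And>E h. F (basis_tuple E h) =
      (if tuple_degree E = s then \<Sum>\<epsilon>\<in>{\<epsilon>. card \<epsilon> + s = CARD('d)}. axis \<epsilon> (A E \<epsilon> h) else 0)"
    using assms unfolding LDO_map_def tuple_degree_def by blast
  have e: "F (basis_tuple E h) $ \<epsilon> = (if tuple_degree E = s \<and> card \<epsilon> + s = CARD('d) then A E \<epsilon> h else 0)" for h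
  proof -
    have "(\<Sum>\<epsilon>\<in>{\<epsilon>. card \<epsilon> + s = CARD('d)}. axis \<epsilon> (A E \<epsilon> h)) $ \<epsilon>
        = (if card \<epsilon> + s = CARD('d) then A E \<epsilon> h else 0)"
      by (auto simp: axis_def)
    then show ?thesis by (simp add: A(2))
  qed
  show "(\<lambda>h. F (basis_tuple E h) $ \<epsilon>) \<in> LDO"
    unfolding e using A(1)
    by (cases "tuple_degree E = s"; cases "card \<epsilon> + s = CARD('d)") (simp_all add: LDO_zero)
  show "F (basis_tuple E h) $ \<epsilon> = 0" if "tuple_degree E \<noteq> s \<or> card \<epsilon> + s \<noteq> CARD('d)"
    using that unfolding e by auto
qed

definition corank :: "('n \<Rightarrow> 'd::finite set) \<Rightarrow> 'n \<Rightarrow> nat" where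
  "corank E j = CARD('d) - card (E j)"

lemma sum_corank: "(\<Sum>j\<in>UNIV. corank E j) = tuple_degree E"
  by (simp add: corank_def tuple_degree_def)

lemma basis_tuple_Omega: "axis (E j) x \<in> Omega (corank E j)"
  using card_mono[of UNIV "E j"] by (auto simp: Omega_def axis_def corank_def)

lemma comp_tensor_d_basis:
  fixes F :: "('n::{finite,linorder}, 'd::{finite,linorder}) tensor_map"
  assumes F: "multilinear F"
  shows "comp_tensor_d F k (basis_tuple E h) $ \<epsilon> = (\<Sum>(j, i)\<in>Sigma UNIV (\<lambda>j. - E j).
     ((-1) ^ (\<Sum>l | l < j. k l) * wsign i (insert i (E j)))
       *\<^sub>R (F (basis_tuple (E(j := insert i (E j))) (slot_deriv j i h)) $ \<epsilon>))"
proof -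
  have "F ((basis_tuple E h)(j := d_H (axis (E j) (h j)))) = (\<Sum>i\<in>-E j. wsign i (insert i (E j))
      *\<^sub>R F (basis_tuple (E(j := insert i (E j))) (slot_deriv j i h)))" for j
  proof -
    have lin: "linear (\<lambda>v. F ((basis_tuple E h)(j := v)))" using F unfolding multilinear_def by blast
    have "(basis_tuple E h)(j := axis (insert i (E j)) (total_deriv i (h j)))
        = basis_tuple (E(j := insert i (E j))) (slot_deriv j i h)" for i
      by (auto simp: slot_deriv_def)
    then show ?thesis unfolding d_H_axis by (simp add: linear_sum[OF lin] linear_scale[OF lin] del: fun_upd_apply)
  qed
  then have "comp_tensor_d F k (basis_tuple E h) = (\<Sum>j\<in>UNIV. (-1) ^ (\<Sum>l | l < j. k l) *\<^sub>R
     (\<Sum>i\<in>-E j. wsign i (insert i (E j)) *\<^sub>R F (basis_tuple (E(j := insert i (E j))) (slot_deriv j i h))))"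
    by (simp add: comp_tensor_d_def)
  also have "\<dots> = (\<Sum>(j, i)\<in>Sigma UNIV (\<lambda>j. - E j). ((-1) ^ (\<Sum>l | l < j. k l) * wsign i (insert i (E j)))
       *\<^sub>R F (basis_tuple (E(j := insert i (E j))) (slot_deriv j i h)))"
    by (subst sum.Sigma[symmetric]) (auto simp: scaleR_sum_right)
  finally show ?thesis by (simp add: case_prod_beta)
qed

lemma comp_tensor_d_entry:
  fixes F :: "('n::{finite,linorder}, 'd::{finite,linorder}) tensor_map"
  assumes F: "LDO_map s F"
  shows "(\<lambda>h. comp_tensor_d F k (basis_tuple E h) $ \<epsilon>) \<in> LDO"
    and "card \<epsilon> + s \<noteq> CARD('d) \<Longrightarrow> comp_tensor_d F k (basis_tuple E h) $ \<epsilon> = 0"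
proof -
  have "(\<lambda>h. F (basis_tuple E' (slot_deriv j i h)) $ \<epsilon>) \<in> LDO" for E' j i
    using LDO_slot[OF LDO_map_entry(1)[OF F]] by (simp add: comp_def)
  then show "(\<lambda>h. comp_tensor_d F k (basis_tuple E h) $ \<epsilon>) \<in> LDO"
    unfolding comp_tensor_d_basis[OF LDO_map_multilinear[OF F]] case_prod_beta
    by (intro LDO_sum_scaleR) auto
  show "comp_tensor_d F k (basis_tuple E h) $ \<epsilon> = 0" if "card \<epsilon> + s \<noteq> CARD('d)"
    unfolding comp_tensor_d_basis[OF LDO_map_multilinear[OF F]] using LDO_map_entry(2)[OF F] that
    by (intro sum.neutral) auto
qed

text \<open>\<open>G\<close> depends on k because the signs of \<open>comp_tensor_d\<close> do. On a
  basis tuple with nonzero entries k is forced to be \<open>corank E\<close>; with a zero entry both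
  sides vanish.\<close>

lemma multilinear_ext_degree:
  fixes F :: "('n::finite, 'd::finite) tensor_map" and G :: "('n \<Rightarrow> nat) \<Rightarrow> ('n, 'd) tensor_map"
  assumes F: "multilinear F" and G: "\<And>k. multilinear (G k)"
    and eq: "\<And>E h. tuple_degree E = s \<Longrightarrow> F (basis_tuple E h) = G (corank E) (basis_tuple E h)"
    and k: "(\<Sum>j\<in>UNIV. k j) = s" and w: "\<And>j. w j \<in> Omega (k j)"
  shows "F w = G k w"
proof (rule multilinear_ext[where k = k, OF F G _ w])
  fix E :: "'n \<Rightarrow> 'd set" and h assume Eh: "\<And>j. axis (E j) (h j) \<in> Omega (k j)"
  show "F (basis_tuple E h) = G k (basis_tuple E h)"
  proof (cases "\<exists>j. h j = 0")
    case True
    then obtain j where "axis (E j) (h j) = 0" by (auto simp: axis_def vec_eq_iff)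
    then show ?thesis using multilinear_slot_zero[OF F, of "basis_tuple E h" j]
        multilinear_slot_zero[OF G, of "basis_tuple E h" j] by simp
  next
    case False
    then have "card (E j) + k j = CARD('d)" for j using Eh[of j] axis_Omega by blast
    then have "k j = corank E j" for j unfolding corank_def by (metis add_diff_cancel_left')
    then have "k = corank E" by blast
    then show ?thesis using eq[of E h] k by (simp add: sum_corank)
  qed
qed

section \<open>Lifting one degree at a time\<close>

definition lifts :: "nat \<Rightarrow> ('n::{finite,linorder}, 'd::{finite,linorder}) tensor_map \<Rightarrow> ('n, 'd) tensor_map \<Rightarrow> bool" where
  "lifts s f g \<longleftrightarrow> (\<forall>k w. (\<Sum>j\<in>UNIV. k j) = Suc s \<and> (\<forall>j. w j \<in> Omega (k j)) \<longrightarrow> d_H (f w) = comp_tensor_d g k w)"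

lemma chain_map_iff_lifts: "chain_map f \<longleftrightarrow> (\<forall>s. lifts s (f (Suc s)) (f s))"
proof -
  have "(\<forall>s\<ge>1. P s) \<longleftrightarrow> (\<forall>s. P (Suc s))" for P :: "nat \<Rightarrow> bool"
    by (metis Suc_le_D Suc_le_mono One_nat_def le0)
  then show ?thesis by (simp add: chain_map_def lifts_def)
qed

text \<open>On basis tuples of degree s + 1 the lifting equation is one equation between
  operator-valued forms for each E, and the E are independent of each other. The degree condition on
  \<eta> makes the solution an \<open>LDO_map\<close>.\<close>

lemma lift_from_primitive:
  fixes g :: "('n::{finite,linorder}, 'd::{finite,linorder}) tensor_map"
  assumes g: "LDO_map s g"
    and prim: "\<And>E. tuple_degree E = Suc s \<Longrightarrow> \<exists>\<eta>. (\<forall>\<epsilon>. \<eta> \<epsilon> \<in> LDO)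
      \<and> op_d \<eta> = (\<lambda>\<epsilon> h. comp_tensor_d g (corank E) (basis_tuple E h) $ \<epsilon>)
      \<and> (\<forall>\<epsilon>. card \<epsilon> + Suc s \<noteq> CARD('d) \<longrightarrow> \<eta> \<epsilon> = (\<lambda>_. 0))"
  shows "\<exists>f. LDO_map (Suc s) f \<and> lifts s f g"
proof -
  have "\<forall>E. \<exists>\<eta>. tuple_degree E = Suc s \<longrightarrow> ((\<forall>\<epsilon>. \<eta> \<epsilon> \<in> LDO)
      \<and> op_d \<eta> = (\<lambda>\<epsilon> h. comp_tensor_d g (corank E) (basis_tuple E h) $ \<epsilon>)
      \<and> (\<forall>\<epsilon>. card \<epsilon> + Suc s \<noteq> CARD('d) \<longrightarrow> \<eta> \<epsilon> = (\<lambda>_. 0)))" using prim by blast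
  from choice[OF this] obtain \<eta> where \<eta>: "\<And>E \<epsilon>. tuple_degree E = Suc s \<Longrightarrow> \<eta> E \<epsilon> \<in> LDO"
    "\<And>E. tuple_degree E = Suc s \<Longrightarrow> op_d (\<eta> E) = (\<lambda>\<epsilon> h. comp_tensor_d g (corank E) (basis_tuple E h) $ \<epsilon>)"
    "\<And>E \<epsilon>. tuple_degree E = Suc s \<Longrightarrow> card \<epsilon> + Suc s \<noteq> CARD('d) \<Longrightarrow> \<eta> E \<epsilon> = (\<lambda>_. 0)" by blast
  define A where "A E \<epsilon> = (if tuple_degree E = Suc s then \<eta> E \<epsilon> else (\<lambda>_. 0))" for E \<epsilon>
  have A: "A E \<epsilon> \<in> LDO" for E \<epsilon> by (simp add: A_def \<eta>(1) LDO_zero)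
  have "LDO_map (Suc s) (matrix_map A)"
    by (rule LDO_map_matrix_map[OF A]) (auto simp: A_def \<eta>(3))
  moreover have "lifts s (matrix_map A) g"
    unfolding lifts_def
  proof (intro allI impI, elim conjE)
    fix k and w :: "'n \<Rightarrow> 'd form" assume k: "(\<Sum>j\<in>UNIV. k j) = Suc s" and w: "\<forall>j. w j \<in> Omega (k j)"
    show "d_H (matrix_map A w) = comp_tensor_d g k w"
    proof (rule multilinear_ext_degree[where s = "Suc s" and G = "comp_tensor_d g" and F = "\<lambda>w. d_H (matrix_map A w)"])
      fix E :: "'n \<Rightarrow> 'd set" and h assume E: "tuple_degree E = Suc s"
      have "d_H (matrix_map A (basis_tuple E h)) $ \<epsilon> = op_d (\<eta> E) \<epsilon> h" for \<epsilon>
        by (simp add: d_H_nth op_d_def matrix_map_basis[OF A] A_def E)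
      then show "d_H (matrix_map A (basis_tuple E h)) = comp_tensor_d g (corank E) (basis_tuple E h)"
        by (simp add: vec_eq_iff \<eta>(2)[OF E])
    next
      show "multilinear (\<lambda>w. d_H (matrix_map A w))"
        by (rule multilinear_comp_d_H[OF multilinear_matrix_map[OF A]])
    qed (use k w g in \<open>auto intro: multilinear_comp_tensor_d LDO_map_multilinear\<close>)
  qed
  ultimately show ?thesis by blast
qed

text \<open>From \<open>d_H\<close> f = g o d follows \<open>d_H\<close> (f o d) = g o d o d = 0.
  The closed form f o d has form degree N - s - 1, hence no top component, and
  \<open>LDO_exact\<close> integrates it.\<close>

lemma lift_step:
  fixes f g :: "('n::{finite,linorder}, 'd::{finite,linorder}) tensor_map"
  assumes f: "LDO_map (Suc s) f" and g: "multilinear g" and fg: "lifts s f g"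
  shows "\<exists>f'. LDO_map (Suc (Suc s)) f' \<and> lifts (Suc s) f' f"
proof (rule lift_from_primitive[OF f])
  fix E :: "'n \<Rightarrow> 'd set" assume E: "tuple_degree E = Suc (Suc s)"
  let ?\<omega> = "\<lambda>\<epsilon> h. comp_tensor_d f (corank E) (basis_tuple E h) $ \<epsilon>"
  have LDO: "?\<omega> \<epsilon> \<in> LDO" for \<epsilon> by (rule comp_tensor_d_entry(1)[OF f])
  have supp: "?\<omega> \<epsilon> = (\<lambda>_. 0)" if "card \<epsilon> + Suc s \<noteq> CARD('d)" for \<epsilon>
    using comp_tensor_d_entry(2)[OF f that] by blast
  have "op_d ?\<omega> \<epsilon> h = 0" for \<epsilon> h
  proof -
    have "op_d ?\<omega> \<epsilon> h = d_H (comp_tensor_d f (corank E) (basis_tuple E h)) $ \<epsilon>"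
      by (simp add: op_d_def d_H_nth)
    also have "d_H (comp_tensor_d f (corank E) (basis_tuple E h)) = 0"
      unfolding d_H_comp_tensor_d
    proof (rule comp_tensor_d_twice[where s = "Suc s" and G = g])
      show "(\<Sum>j\<in>UNIV. corank E j) = Suc (Suc s)" using E by (simp add: sum_corank)
      show "d_H (f w') = comp_tensor_d g k' w'" if "(\<Sum>j\<in>UNIV. k' j) = Suc s" "\<And>j. w' j \<in> Omega (k' j)" for k' w'
        using fg that unfolding lifts_def by blast
    qed (use f g in \<open>auto intro: basis_tuple_Omega multilinear_comp_d_H LDO_map_multilinear\<close>)
    finally show ?thesis by simp
  qed
  then have "\<exists>\<eta>. (\<forall>\<epsilon>. \<eta> \<epsilon> \<in> LDO) \<and> op_d \<eta> = ?\<omega>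
      \<and> (\<forall>\<epsilon>. (\<forall>i. i \<notin> \<epsilon> \<longrightarrow> ?\<omega> (insert i \<epsilon>) = (\<lambda>_. 0)) \<longrightarrow> \<eta> \<epsilon> = (\<lambda>_. 0))"
    by (intro LDO_exact LDO supp) (auto simp: fun_eq_iff)
  then obtain \<eta> where \<eta>: "\<And>\<epsilon>. \<eta> \<epsilon> \<in> LDO" "op_d \<eta> = ?\<omega>"
    "\<And>\<epsilon>. (\<And>i. i \<notin> \<epsilon> \<Longrightarrow> ?\<omega> (insert i \<epsilon>) = (\<lambda>_. 0)) \<Longrightarrow> \<eta> \<epsilon> = (\<lambda>_. 0)" by blast
  \<comment> \<open>In the wrong form degree all neighbours \<open>insert i \<epsilon>\<close> miss
    the degree of the form, so the support clause applies.\<close>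
  have "\<eta> \<epsilon> = (\<lambda>_. 0)" if "card \<epsilon> + Suc (Suc s) \<noteq> CARD('d)" for \<epsilon>
    by (rule \<eta>(3), rule supp) (use that in simp)
  then show "\<exists>\<eta>. (\<forall>\<epsilon>. \<eta> \<epsilon> \<in> LDO) \<and> op_d \<eta> = ?\<omega>
      \<and> (\<forall>\<epsilon>. card \<epsilon> + Suc (Suc s) \<noteq> CARD('d) \<longrightarrow> \<eta> \<epsilon> = (\<lambda>_. 0))"
    using \<eta>(1,2) by blast
qed

section \<open>Maps supported on tuples of top forms\<close>

lemma tuple_degree_0_iff: "tuple_degree (E :: 'n::finite \<Rightarrow> 'd::finite set) = 0 \<longleftrightarrow> E = (\<lambda>_. UNIV)"
proof
  assume "tuple_degree E = 0"
  then have "CARD('d) - card (E j) = 0" for j by (simp add: tuple_degree_def)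
  then have "card (E j) = CARD('d)" for j using card_mono[of UNIV "E j"] by (metis diff_is_0_eq finite le_antisym top_greatest)
  then show "E = (\<lambda>_. UNIV)" by (auto simp: fun_eq_iff card_eq_UNIV_imp_eq_UNIV)
qed (simp add: tuple_degree_def)

text \<open>The source has degree 0, but the components \<open>B \<epsilon>\<close> may have any
  form degree. This covers both A and a primitive of A, a map from degree 0 to
  \<open>Omega 1\<close> that does not fit the shape of \<open>LDO_map\<close>.\<close>

definition top_map :: "('d set \<Rightarrow> ('n, 'd) multiop) \<Rightarrow> ('n::finite, 'd::finite) tensor_map" where
  "top_map B = matrix_map (\<lambda>E \<epsilon>. if E = (\<lambda>_. UNIV) then B \<epsilon> else (\<lambda>_. 0))"

lemma top_map_basis:
  assumes "\<And>\<epsilon>. B \<epsilon> \<in> LDO"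
  shows "top_map B (basis_tuple E h) $ \<epsilon> = (if E = (\<lambda>_. UNIV) then B \<epsilon> h else 0)"
  unfolding top_map_def by (subst matrix_map_basis) (auto simp: assms LDO_zero)

lemma multilinear_top_map: "(\<And>\<epsilon>. B \<epsilon> \<in> LDO) \<Longrightarrow> multilinear (top_map B)"
  unfolding top_map_def by (intro multilinear_matrix_map) (auto simp: LDO_zero)

definition top_op :: "('n, 'd) multiop \<Rightarrow> 'd::finite set \<Rightarrow> ('n, 'd) multiop" where
  "top_op A \<epsilon> = (if \<epsilon> = UNIV then A else (\<lambda>_. 0))"

lemma top_op_LDO: "A \<in> LDO \<Longrightarrow> top_op A \<epsilon> \<in> LDO"
  by (simp add: top_op_def LDO_zero)

lemma LDO_map_top:
  assumes "A \<in> LDO" shows "LDO_map 0 (top_map (top_op A))"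
  unfolding top_map_def
proof (rule LDO_map_matrix_map)
  show "(if E = (\<lambda>_. UNIV) then top_op A \<epsilon> else (\<lambda>_. 0)) \<in> LDO" for E \<epsilon>
    using top_op_LDO[OF assms] by (simp add: LDO_zero)
  show "(if E = (\<lambda>_. UNIV) then top_op A \<epsilon> else (\<lambda>_. 0)) = (\<lambda>_. 0)"
    if "tuple_degree E \<noteq> 0 \<or> card \<epsilon> + 0 \<noteq> CARD('b)" for E \<epsilon>
    using that tuple_degree_0_iff[of E] by (auto simp: top_op_def)
qed

lemma top_map_top:
  assumes "A \<in> LDO" shows "top_map (top_op A) (\<lambda>j. axis UNIV (h j)) = axis UNIV (A h)"
proof -
  have "top_map (top_op A) (\<lambda>j. axis UNIV (h j)) $ \<epsilon> = axis UNIV (A h) $ \<epsilon>" for \<epsilon>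
    unfolding top_map_basis[OF top_op_LDO[OF assms], of "\<lambda>x. x" "\<lambda>_. UNIV"]
    by (auto simp: axis_def top_op_def)
  then show ?thesis by (simp add: vec_eq_iff)
qed

text \<open>A divergence is the differential of the (N-1)-form obtained by contracting the volume
  form with the vector \<open>C\<close>; the contraction accounts for the signs
  \<open>wsign l UNIV\<close>.\<close>

lemma top_primitive:
  fixes C :: "'d::{finite,linorder} \<Rightarrow> ('n::{finite,linorder}, 'd) multiop"
  assumes C: "\<And>l. C l \<in> LDO"
  shows "\<exists>\<eta>. (\<forall>\<epsilon>. \<eta> \<epsilon> \<in> LDO) \<and> op_d \<eta> = top_op (\<lambda>f. \<Sum>l\<in>UNIV. total_deriv l (C l f))
    \<and> (\<forall>\<epsilon>. card \<epsilon> + 1 \<noteq> CARD('d) \<longrightarrow> \<eta> \<epsilon> = (\<lambda>_. 0))"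
proof -
  \<comment> \<open>The sum has at most one term: it selects the l with
    \<open>\<epsilon> = UNIV - {l}\<close> and gives 0 if there is none.\<close>
  define \<eta> where "\<eta> \<epsilon> f = (\<Sum>l | \<epsilon> = UNIV - {l}. wsign l UNIV *\<^sub>R C l f)" for \<epsilon> f
  have "{l'. UNIV - {l} = UNIV - {l'}} = {l}" for l :: 'd by auto
  then have \<eta>1: "\<eta> (UNIV - {l}) f = wsign l UNIV *\<^sub>R C l f" for l f by (simp add: \<eta>_def)
  have "\<eta> (\<epsilon> - {i}) = (\<lambda>_. 0)" if "\<epsilon> \<noteq> UNIV" "i \<in> \<epsilon>" for \<epsilon> i
  proof -
    have "{l. \<epsilon> - {i} = UNIV - {l}} = {}" using that by blast
    then show ?thesis unfolding \<eta>_def[abs_def] by (simp only: sum.empty)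
  qed
  then have "op_d \<eta> = top_op (\<lambda>f. \<Sum>l\<in>UNIV. total_deriv l (C l f))"
    by (auto simp: fun_eq_iff op_d_def top_op_def \<eta>1 total_deriv_scaleR)
  moreover have "\<eta> \<epsilon> = (\<lambda>_. 0)" if "card \<epsilon> + 1 \<noteq> CARD('d)" for \<epsilon>
  proof -
    have "card (UNIV - {l :: 'd}) + 1 = CARD('d)" for l using card_Suc_Diff1[of UNIV l] by simp
    then have "{l. \<epsilon> = UNIV - {l}} = {}" using that by blast
    then show ?thesis unfolding \<eta>_def[abs_def] by (simp only: sum.empty)
  qed
  moreover have "\<eta> \<epsilon> \<in> LDO" for \<epsilon> unfolding \<eta>_def[abs_def] by (intro LDO_sum_scaleR C) auto
  ultimately show ?thesis by blast
qed

section \<open>Sufficiency, necessity and the short lift\<close>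

lemma lift_of_closed:
  fixes A :: "('n::{finite,linorder}, 'd::{finite,linorder}) multiop"
  assumes A: "A \<in> LDO" and char: "\<And>i j. characteristic (A \<circ> slot_deriv j i) = (\<lambda>_. 0)"
  shows "\<exists>f. is_lift A f"
proof -
  let ?g = "top_map (top_op A)"
  have g: "LDO_map 0 ?g" by (rule LDO_map_top[OF A])
  have "\<forall>j i. \<exists>B. (\<forall>l. B l \<in> LDO) \<and> A \<circ> slot_deriv j i = (\<lambda>f. \<Sum>l\<in>UNIV. total_deriv l (B l f))"
    using char characteristic_eq_0_iff[OF LDO_slot[OF A]] by blast
  then obtain B where B: "\<And>j i l. B j i l \<in> LDO"
    "\<And>j i. A \<circ> slot_deriv j i = (\<lambda>f. \<Sum>l\<in>UNIV. total_deriv l (B j i l f))" by metis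
  have "\<exists>f. LDO_map (Suc 0) f \<and> lifts 0 f ?g"
  proof (rule lift_from_primitive[OF g])
    fix E :: "'n \<Rightarrow> 'd set" assume E: "tuple_degree E = Suc 0"
    let ?\<omega> = "\<lambda>\<epsilon> h. comp_tensor_d ?g (corank E) (basis_tuple E h) $ \<epsilon>"
    \<comment> \<open>In degree 1 one slot lacks a single dx. The coefficient is 0 unless adding i
      to slot j completes the tuple to top forms.\<close>
    define r where "r j i = (if E(j := insert i (E j)) = (\<lambda>_. UNIV)
      then (-1) ^ (\<Sum>l | l < j. corank E l) * wsign i (insert i (E j)) else 0)" for j i
    define C where "C l f = (\<Sum>(j, i)\<in>Sigma UNIV (\<lambda>j. - E j). r j i *\<^sub>R B j i l f)" for l f
    have C: "C l \<in> LDO" for l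
      unfolding C_def[abs_def] case_prod_beta by (intro LDO_sum_scaleR B(1)) auto
    have "?\<omega> \<epsilon> = top_op (\<lambda>f. \<Sum>l\<in>UNIV. total_deriv l (C l f)) \<epsilon>" for \<epsilon>
    proof (cases "\<epsilon> = UNIV")
      case False
      then have "card \<epsilon> + 0 \<noteq> CARD('d)" by (metis add_0_right card_eq_UNIV_imp_eq_UNIV finite)
      then show ?thesis using comp_tensor_d_entry(2)[OF g] False by (simp add: top_op_def)
    next
      case True
      have "?\<omega> UNIV h = (\<Sum>(j, i)\<in>Sigma UNIV (\<lambda>j. - E j). r j i *\<^sub>R (A \<circ> slot_deriv j i) h)" for h
        unfolding comp_tensor_d_basis[OF LDO_map_multilinear[OF g]] top_map_basis[OF top_op_LDO[OF A]]
        by (intro sum.cong refl) (simp add: case_prod_beta r_def top_op_def del: fun_upd_apply)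
      also have "\<dots> h = (\<Sum>(j, i)\<in>Sigma UNIV (\<lambda>j. - E j). \<Sum>l\<in>UNIV. r j i *\<^sub>R total_deriv l (B j i l h))" for h
        by (simp add: B(2) scaleR_sum_right)
      also have "\<dots> h = (\<Sum>l\<in>UNIV. total_deriv l (C l h))" for h
        unfolding C_def case_prod_beta
        by (subst sum.swap) (simp add: total_deriv_sum total_deriv_scaleR)
      finally show ?thesis using True by (simp add: top_op_def fun_eq_iff)
    qed
    then have "?\<omega> = top_op (\<lambda>f. \<Sum>l\<in>UNIV. total_deriv l (C l f))" by blast
    then show "\<exists>\<eta>. (\<forall>\<epsilon>. \<eta> \<epsilon> \<in> LDO) \<and> op_d \<eta> = ?\<omega>
        \<and> (\<forall>\<epsilon>. card \<epsilon> + Suc 0 \<noteq> CARD('d) \<longrightarrow> \<eta> \<epsilon> = (\<lambda>_. 0))"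
      using top_primitive[of C, OF C] by simp
  qed
  then obtain f1 where f1: "LDO_map (Suc 0) f1" "lifts 0 f1 ?g" by blast
  \<comment> \<open>The invariant at s contains a lift one degree further up, since
    \<open>lift_step\<close> extends a pair of consecutive maps. The clauses for s = 0 and s = 1
    prescribe the start.\<close>
  have "\<exists>f. \<forall>s. (LDO_map s (f s) \<and> (s = 0 \<longrightarrow> f s = ?g) \<and> (s = 1 \<longrightarrow> f s = f1)
      \<and> (\<exists>f'. LDO_map (Suc s) f' \<and> lifts s f' (f s) \<and> (s = 0 \<longrightarrow> f' = f1))) \<and> lifts s (f (Suc s)) (f s)"
  proof (rule dependent_nat_choice)
    show "\<exists>x. LDO_map 0 x \<and> ((0::nat) = 0 \<longrightarrow> x = ?g) \<and> ((0::nat) = 1 \<longrightarrow> x = f1)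
        \<and> (\<exists>f'. LDO_map (Suc 0) f' \<and> lifts 0 f' x \<and> ((0::nat) = 0 \<longrightarrow> f' = f1))"
      using g f1 by auto
  next
    fix x s
    assume x: "LDO_map s x \<and> (s = 0 \<longrightarrow> x = ?g) \<and> (s = 1 \<longrightarrow> x = f1)
        \<and> (\<exists>f'. LDO_map (Suc s) f' \<and> lifts s f' x \<and> (s = 0 \<longrightarrow> f' = f1))"
    then obtain f' where f': "LDO_map (Suc s) f'" "lifts s f' x" "s = 0 \<longrightarrow> f' = f1" by blast
    then show "\<exists>y. (LDO_map (Suc s) y \<and> (Suc s = 0 \<longrightarrow> y = ?g) \<and> (Suc s = 1 \<longrightarrow> y = f1)
        \<and> (\<exists>f'. LDO_map (Suc (Suc s)) f' \<and> lifts (Suc s) f' y \<and> (Suc s = 0 \<longrightarrow> f' = f1))) \<and> lifts s y x"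
      using lift_step[OF f'(1) _ f'(2)] x LDO_map_multilinear by (intro exI[of _ f']) auto
  qed
  then obtain f where "\<And>s. LDO_map s (f s)" "f 0 = ?g" "\<And>s. lifts s (f (Suc s)) (f s)" by blast
  then have "is_lift A f"
    by (simp add: is_lift_def chain_map_iff_lifts top_map_top[OF A])
  then show ?thesis by blast
qed

text \<open>The chain map equation in degree 1 is evaluated on top forms with dx^i omitted in slot
  j. The tensor differential restores dx^i and differentiates slot j in direction i, so A o d/dx^i_j
  is a divergence of entries of f_1.\<close>

lemma closed_of_lift:
  fixes A :: "('n::{finite,linorder}, 'd::{finite,linorder}) multiop"
  assumes A: "A \<in> LDO" and f: "is_lift A f"
  shows "characteristic (A \<circ> slot_deriv j i) = (\<lambda>_. 0)"
proof -
  define E where "E = (\<lambda>_::'n. UNIV :: 'd set)(j := UNIV - {i})"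
  define k where "k = (\<lambda>_::'n. 0::nat)(j := 1)"
  have LM: "LDO_map s (f s)" for s using f unfolding is_lift_def by blast
  have f0: "f 0 (basis_tuple (\<lambda>_. UNIV) h) = axis UNIV (A h)" for h using f unfolding is_lift_def by blast
  have l1: "lifts 0 (f 1) (f 0)" using f unfolding is_lift_def chain_map_iff_lifts by simp
  have card1: "card (UNIV - {i}) + 1 = CARD('d)" using card_Suc_Diff1[of UNIV i] by simp
  have Om: "axis (E l) x \<in> Omega (k l)" for l x
    using card1 by (auto simp: Omega_def axis_def E_def k_def)
  have sumk: "(\<Sum>l\<in>UNIV. k l) = Suc 0" by (simp add: k_def)
  have "A (slot_deriv j i h) = (\<Sum>l\<in>UNIV. total_deriv l ((wsign i UNIV * wsign l UNIV) *\<^sub>R f 1 (basis_tuple E h) $ (UNIV - {l})))" for h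
  proof -
    have S: "Sigma UNIV (\<lambda>l. - E l) = {(j, i)}" by (auto simp: E_def split: if_splits)
    have "insert i (E j) = UNIV" "E(j := UNIV) = (\<lambda>_. UNIV)" by (auto simp: E_def fun_eq_iff)
    moreover have "(\<Sum>l | l < j. k l) = 0" by (auto simp: k_def)
    ultimately have "comp_tensor_d (f 0) k (basis_tuple E h) $ UNIV = wsign i UNIV *\<^sub>R A (slot_deriv j i h)"
      unfolding comp_tensor_d_basis[OF LDO_map_multilinear[OF LM]] S
      by (simp add: f0 del: fun_upd_apply)
    moreover have "d_H (f 1 (basis_tuple E h)) = comp_tensor_d (f 0) k (basis_tuple E h)"
      using l1[unfolded lifts_def, rule_format, of k "basis_tuple E h"] sumk Om by blast
    ultimately have "wsign i UNIV *\<^sub>R A (slot_deriv j i h)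
        = (\<Sum>l\<in>UNIV. wsign l UNIV *\<^sub>R total_deriv l (f 1 (basis_tuple E h) $ (UNIV - {l})))"
      by (simp add: d_H_nth flip: \<open>d_H _ = _\<close>)
    \<comment> \<open>A second factor \<open>wsign i UNIV\<close> cancels the sign from the tensor
      differential, its square being 1.\<close>
    then have "wsign i UNIV *\<^sub>R wsign i UNIV *\<^sub>R A (slot_deriv j i h)
        = wsign i UNIV *\<^sub>R (\<Sum>l\<in>UNIV. wsign l UNIV *\<^sub>R total_deriv l (f 1 (basis_tuple E h) $ (UNIV - {l})))"
      by simp
    then show ?thesis by (simp add: total_deriv_scaleR scaleR_sum_right)
  qed
  then have "A \<circ> slot_deriv j i = (\<lambda>h. \<Sum>l\<in>UNIV. total_deriv l ((wsign i UNIV * wsign l UNIV) *\<^sub>R f 1 (basis_tuple E h) $ (UNIV - {l})))"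
    by (simp add: fun_eq_iff)
  moreover have "(\<lambda>h. (wsign i UNIV * wsign l UNIV) *\<^sub>R f 1 (basis_tuple E h) $ (UNIV - {l})) \<in> LDO" for l
    by (intro LDO_scaleR LDO_map_entry(1)[OF LM])
  ultimately show ?thesis
    unfolding characteristic_eq_0_iff[OF LDO_slot[OF A]]
    by (intro exI[of _ "\<lambda>l h. (wsign i UNIV * wsign l UNIV) *\<^sub>R f 1 (basis_tuple E h) $ (UNIV - {l})"]) simp
qed

text \<open>The lift is null-homotopic: with \<open>?b\<close> a primitive of A on degree 0 and zero
  elsewhere, it is the sum of \<open>d_H\<close> o b and b o d. Its components in degrees 0 and 1
  are A and b o d, the others vanish.\<close>

lemma short_lift:
  fixes A :: "('n::{finite,linorder}, 'd::{finite,linorder}) multiop"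
  assumes A: "A \<in> LDO" and char: "characteristic A = (\<lambda>_. 0)"
  shows "\<exists>f. is_lift A f \<and> (\<forall>s\<ge>2. f s = (\<lambda>_. 0))"
proof -
  obtain B where B: "\<And>l. B l \<in> LDO" "A = (\<lambda>f. \<Sum>l\<in>UNIV. total_deriv l (B l f))"
    using char characteristic_eq_0_iff[OF A] by blast
  obtain \<eta> where \<eta>: "\<And>\<epsilon>. \<eta> \<epsilon> \<in> LDO" "op_d \<eta> = top_op A"
    "\<And>\<epsilon>. card \<epsilon> + 1 \<noteq> CARD('d) \<Longrightarrow> \<eta> \<epsilon> = (\<lambda>_. 0)"
    using top_primitive[of B, OF B(1)] B(2) by auto
  let ?g = "top_map (top_op A)" and ?b = "top_map \<eta>"
  have g: "LDO_map 0 ?g" by (rule LDO_map_top[OF A])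
  have b: "multilinear ?b" by (rule multilinear_top_map[OF \<eta>(1)])
  have db: "d_H (?b w) = ?g w" if "\<And>j. w j \<in> Omega (k j)" for k w
  proof (rule multilinear_ext[where k = k, OF multilinear_comp_d_H[OF b] LDO_map_multilinear[OF g] _ that])
    show "d_H (?b (basis_tuple E h)) = ?g (basis_tuple E h)" for E h
      using fun_cong[OF fun_cong[OF \<eta>(2)], of _ h]
      by (auto simp: vec_eq_iff d_H_nth top_map_basis \<eta>(1) top_op_LDO[OF A] op_d_def)
  qed
  \<comment> \<open>\<open>?b\<close> shifts the degree by one, so
    \<open>comp_tensor_d_entry\<close> does not apply and the entries are read off from the basis
    formula.\<close>
  have LDO1: "(\<lambda>h. comp_tensor_d ?b (corank E) (basis_tuple E h) $ \<epsilon>) \<in> LDO" for E \<epsilon>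
  proof -
    have "(\<lambda>h. ?b (basis_tuple E' (slot_deriv j i h)) $ \<epsilon>) \<in> LDO" for E' j i
      using LDO_slot[OF \<eta>(1)[of \<epsilon>]]
      by (cases "E' = (\<lambda>_. UNIV)") (simp_all add: top_map_basis[OF \<eta>(1)] LDO_zero comp_def)
    then show ?thesis
      unfolding comp_tensor_d_basis[OF b] case_prod_beta by (intro LDO_sum_scaleR) auto
  qed
  \<comment> \<open>Taking k to be \<open>corank E\<close> and cutting off outside tuple degree 1
    turns b o d into one map independent of k, as \<open>LDO_map 1\<close> demands.\<close>
  define M where "M E \<epsilon> = (if tuple_degree E = 1 then (\<lambda>h. comp_tensor_d ?b (corank E) (basis_tuple E h) $ \<epsilon>) else (\<lambda>_. 0))"
    for E \<epsilon>
  have M: "M E \<epsilon> \<in> LDO" for E \<epsilon> by (simp add: M_def LDO1 LDO_zero)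
  have f1: "LDO_map 1 (matrix_map M)"
  proof (rule LDO_map_matrix_map[OF M])
    fix E :: "'n \<Rightarrow> 'd set" and \<epsilon> :: "'d set" assume "tuple_degree E \<noteq> 1 \<or> card \<epsilon> + 1 \<noteq> CARD('d)"
    then show "M E \<epsilon> = (\<lambda>_. 0)"
      by (auto simp: M_def fun_eq_iff comp_tensor_d_basis[OF b] top_map_basis[OF \<eta>(1)] \<eta>(3) intro!: sum.neutral)
  qed
  have f1b: "matrix_map M w = comp_tensor_d ?b k w" if "(\<Sum>j\<in>UNIV. k j) = 1" "\<And>j. w j \<in> Omega (k j)" for k w
  proof (rule multilinear_ext_degree[where s = 1 and G = "comp_tensor_d ?b", OF _ _ _ that])
    show "multilinear (matrix_map M)" by (rule multilinear_matrix_map[OF M])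
    show "multilinear (comp_tensor_d ?b k)" for k by (rule multilinear_comp_tensor_d[OF b])
    fix E :: "'n \<Rightarrow> 'd set" and h assume "tuple_degree E = 1"
    then have "matrix_map M (basis_tuple E h) $ \<epsilon> = comp_tensor_d ?b (corank E) (basis_tuple E h) $ \<epsilon>" for \<epsilon>
      unfolding matrix_map_basis[OF M] by (simp add: M_def)
    then show "matrix_map M (basis_tuple E h) = comp_tensor_d ?b (corank E) (basis_tuple E h)"
      by (simp add: vec_eq_iff)
  qed
  define f where "f s = (if s = 0 then ?g else if s = 1 then matrix_map M else (\<lambda>_. 0))" for s :: nat
  have z: "LDO_map s (\<lambda>_ :: 'n \<Rightarrow> 'd form. 0 :: 'd form)" for s
    unfolding LDO_map_def multilinear_def
    by (intro conjI allI exI[of _ "\<lambda>_ _ _. 0"]) (auto simp: LDO_zero linear_zero axis_def vec_eq_iff)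
  have "LDO_map s (f s)" for s using g f1 z by (simp add: f_def)
  moreover have "lifts s (f (Suc s)) (f s)" for s
    unfolding lifts_def
  proof (intro allI impI, elim conjE)
    fix k and w :: "'n \<Rightarrow> 'd form" assume k: "(\<Sum>j\<in>UNIV. k j) = Suc s" and w: "\<forall>j. w j \<in> Omega (k j)"
    consider "s = 0" | "s = 1" | "s \<ge> 2" by linarith
    then show "d_H (f (Suc s) w) = comp_tensor_d (f s) k w"
    proof cases
      case 1
      have "d_H (matrix_map M w) = comp_tensor_d (\<lambda>w. d_H (?b w)) k w"
        using f1b[of k w] k w 1 by (simp add: d_H_comp_tensor_d)
      also have "\<dots> = comp_tensor_d ?g k w"
        by (rule comp_tensor_d_cong[OF _ k])
          (use w db b g in \<open>auto intro: multilinear_comp_d_H LDO_map_multilinear\<close>)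
      finally show ?thesis using 1 by (simp add: f_def)
    next
      case 2
      have "comp_tensor_d (matrix_map M) k w = 0"
        by (rule comp_tensor_d_twice[OF _ k, where G = ?b])
          (use w f1b b f1 2 in \<open>auto intro: LDO_map_multilinear\<close>)
      then show ?thesis using 2 linear_0[OF linear_d_H] by (simp add: f_def)
    next
      case 3
      then show ?thesis using linear_0[OF linear_d_H] by (simp add: f_def comp_tensor_d_def)
    qed
  qed
  ultimately have "is_lift A f"
    by (simp add: is_lift_def chain_map_iff_lifts f_def[of 0] top_map_top[OF A])
  then show ?thesis by (intro exI[of _ f]) (simp add: f_def)
qed

theorem corollary4p9:
  fixes A :: "('n::{finite,linorder}, 'd::{finite,linorder}) multiop"
  assumes "A \<in> LDO"
  shows "((\<exists>f. is_lift A f) \<longleftrightarrow> (\<forall>i j. characteristic (A \<circ> slot_deriv j i) = (\<lambda>_. 0)))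
    \<and> (characteristic A = (\<lambda>_. 0) \<longrightarrow> (\<exists>f. is_lift A f \<and> (\<forall>s\<ge>2. f s = (\<lambda>_. 0))))"
  using lift_of_closed[OF assms] closed_of_lift[OF assms] short_lift[OF assms] by blast

end
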